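(* Let $\mathfrak g$ be the affine Lie algebra of type $\mathrm A^{(2)}_{2n-2}$ ($n\ge 3$) with index set $I=\{1,\dots,n\}$, and let $\iota=(\cdots,i_3,i_2,i_1)$ be an infinite sequence of elements of $I$ which is adapted to the generalized Cartan matrix of $\mathfrak g$. Then $\iota$ satisfies the $\Xi'$-positivity condition, and $\mathrm{Im}(\Psi_\iota)$ is the set of all $\mathbf a\in\mathbb Z^\infty$ such that for every $s\in\mathbb Z_{\ge1}$: (1) $L^1_{s,k,\iota}(T)(\mathbf a)\ge0$ for all $k\in I\setminus\{1\}$ and all $T\in\mathrm{REYD}_{\mathrm A^{(2)},k}$; and (2) $L^1_{s,1,\iota}(Y)(\mathbf a)\ge0$ for all $Y\in\mathrm{YW}_{\mathrm A^{(2)},1}$.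
   Context: **Cartan matrix.** $a_{i,j}=\langle h_i,\alpha_j\rangle$, $I=\{1,\dots,n\}$. Type $\mathrm A^{(2)}_{2n-2}$ ($n\ge3$), in the numbering used here: $a_{i,i}=2$; $a_{i,j}=-1$ if $|i-j|=1$ except $a_{2,1}=-2$ and $a_{n,n-1}=-2$; all other entries are $0$. **Sequences.** All sequences $\iota=(\cdots,i_k,\cdots,i_2,i_1)$ of elements of $I$ are assumed to satisfy: $i_k\ne i_{k+1}$ for all $k$ and $\#\{k: i_k=i\}=\infty$ for every $i\in I$. $\iota$ is *adapted* if for all $i,j\in I$ with $a_{i,j}<0$ the subsequence of $\iota$ consisting of all $i$'s and $j$'s is $(\cdots,i,j,i,j)$ or $(\cdots,j,i,j,i)$. For $i,j$ with $a_{i,j}<0$ put $p_{i,j}=1$ if this subsequence is $(\cdots,j,i,j,i)$ (last entry $i$) and $p_{i,j}=0$ if it is $(\cdots,i,j,i,j)$ (last entry $j$). Put also $p_{1,1}=0$. **Crystal $\mathbb Z^\infty_\iota$ and $\Psi_\iota$.** $\mathbb Z^\infty=\{(\cdots,a_k,\cdots,a_2,a_1): a_k\in\mathbb Z,\ a_k=0 \text{ for } k\gg0\}$; $\mathbb Q^\infty$ is defined likewise with $a_k\in\mathbb Q$. For $\mathbf a\in\mathbb Z^\infty$, $k\ge1$ put $\sigma_k(\mathbf a)=a_k+\sum_{j>k}\langle h_{i_k},\alpha_{i_j}\rangle a_j$. Define $\mathrm{wt}(\mathbf a)=-\sum_{j\ge1}a_j\alpha_{i_j}$, $\varepsilon_i(\mathbf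 a)=\max\{\sigma_k(\mathbf a): k\ge 1,\ i_k=i\}$, $\varphi_i(\mathbf a)=\langle h_i,\mathrm{wt}(\mathbf a)\rangle+\varepsilon_i(\mathbf a)$, $M^{(i)}=\{k: i_k=i,\ \sigma_k(\mathbf a)=\varepsilon_i(\mathbf a)\}$, $(\tilde f_i\mathbf a)_k=a_k+\delta_{k,\min M^{(i)}}$, and $(\tilde e_i\mathbf a)_k=a_k-\delta_{k,\max M^{(i)}}$ if $\varepsilon_i(\mathbf a)>0$, $\tilde e_i\mathbf a=0$ if $\varepsilon_i(\mathbf a)=0$. This makes $\mathbb Z^\infty$ a crystal, denoted $\mathbb Z^\infty_\iota$. Let $B(\infty)$ be Kashiwara's crystal base of $U_q^-(\mathfrak g)$ and $u_\infty$ its highest weight vector. $\Psi_\iota:B(\infty)\hookrightarrow\mathbb Z^\infty_\iota$ denotes the unique strict embedding of crystals (injective map preserving $\mathrm{wt},\varepsilon_i,\varphi_i$ and commuting with all $\tilde e_i,\tilde f_i$, where $0\mapsto0$) with $\Psi_\iota(u_\infty)=(\cdots,0,0)$ (its existence and uniqueness are known). **Operators $S'_k$ and $\Xi'$-positivity.** $x_k\in(\mathbb Q^\infty)^*$ is $x_k(\mathbf a)=a_k$ for $k\ge1$. Let $k^{(+)}=\min\{l>k: i_l=i_k\}$, $k^{(-)}=\max(\{1\le l<k: i_l=i_k\}\cup\{0\})$, $\beta_k=x_k+\sum_{k<j<k^{(+)}}\langle h_{i_k},\alpha_{i_j}\rangle x_j+x_{k^{(+)}}$ for $k\ge1$, $\beta_0=0$.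 For $\varphi=\sum_k c_kx_k$ set $S'_k(\varphi)=\varphi-\beta_k$ if $c_k>0$, $S'_k(\varphi)=\varphi+\beta_{k^{(-)}}$ if $c_k<0$, $S'_k(\varphi)=\varphi$ if $c_k=0$. Let $\Xi'_\iota=\{S'_{j_l}\cdots S'_{j_1}x_{j_0}: l\ge0,\ j_0,\dots,j_l\ge1\}$. $\iota$ satisfies the *$\Xi'$-positivity condition* if for every $\varphi=\sum_kc_kx_k\in\Xi'_\iota$ and every $k$ with $k^{(-)}=0$ one has $c_k\ge0$. **Double indices.** The index $j\in\mathbb Z_{\ge1}$ is identified with $(s,l)\in\mathbb Z_{\ge1}\times I$ if $i_j=l$ and $l$ occurs exactly $s$ times in $i_j,i_{j-1},\dots,i_1$; then $x_{s,l}:=x_j$. **Revised extended Young diagrams.** For $k\in I\setminus\{1\}$, $\mathrm{REYD}_{\mathrm A^{(2)},k}$ is the set of sequences $T=(y_t)_{t\in\mathbb Z}$ of integers such that: $y_t=k$ for $t\gg0$ and $y_t=k+t$ for $t\ll0$; for $t\in\mathbb Z$ with $k+t\not\equiv0 \pmod{2n-1}$, $y_{t+1}\in\{y_t,y_t+1\}$; for $t>0$ with $k+t\equiv0\pmod{2n-1}$, $y_{t+1}\ge y_t$; for $t<0$ with $k+t\equiv0\pmod{2n-1}$, $y_{t+1}\le y_t+1$. The point $(i,y_i)$ is *admissible* in $T$ if replacing $y_i$ by $y_i-1$ (other entries unchanged) gives an element of $\mathrm{REYD}_{\mathrm A^{(2)},k}$. The point $(i,y_{i-1})$ is *removable* in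 $T$ if replacing $y_{i-1}$ by $y_{i-1}+1$ (other entries unchanged) gives an element of $\mathrm{REYD}_{\mathrm A^{(2)},k}$. (A point may be both.) With $\equiv$ meaning congruence mod $2n-1$: an admissible $(i,y_i)$ is *double $1$-admissible* if $y_{i-1}<y_i=y_{i+1}$ and either ($i+k\equiv1$ and $i<0$) or ($i+k\equiv0$ and $i>0$); a removable $(i,y_{i-1})$ is *double $1$-removable* if $y_{i-2}=y_{i-1}<y_i$ and either ($i+k-1\equiv1$ and $i>1$) or ($i+k-1\equiv0$ and $i<1$). All other admissible (resp. removable) points are *single* ($\pi_1(i+k)$-admissible, resp. $\pi_1(i+k-1)$-removable). **Assignment for $k>1$.** $\pi_1:\mathbb Z\to I$ has period $2n-1$ with $\pi_1(l)=\pi_1(2n-l)=l$ for $1\le l\le n-1$, $\pi_1(n)=n$. $P^k(k)=0$, $P^k(t)=P^k(t-1)+p_{\pi_1(t),\pi_1(t-1)}$ for $t>k$, $P^k(t)=P^k(t+1)+p_{\pi_1(t),\pi_1(t+1)}$ for $t<k$. With $[i]_-=\min\{i,0\}$, $$L^1_{s,k,\mathrm{ad}}(i,j)=x_{s+P^k(i+k)+[i]_-+k-j,\ \pi_1(i+k)},\qquad L^1_{s,k,\mathrm{re}}(i,j)=x_{s+P^k(i+k-1)+[i-1]_-+k-j,\ \pi_1(i+k-1)}$$ (first indices are $\ge1$ for admissible, resp. removable, points). Then $$L^1_{s,k,\iota}(T)=\sum_{P\text{ single admissible}}L^1_{s,k,\mathrm{ad}}(P)-\sum_{P\text{ single removable}}L^1_{s,k,\mathrm{re}}(P)+\sum_{P\text{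 double }1\text{-admissible}}2L^1_{s,k,\mathrm{ad}}(P)-\sum_{P\text{ double }1\text{-removable}}2L^1_{s,k,\mathrm{re}}(P).$$ **Young walls.** Let $\pi':\mathbb Z_{\ge1}\to I$ have period $2n-2$ with $\pi'(1)=1$, $\pi'(n)=n$, $\pi'(l)=\pi'(2n-l)=l$ for $2\le l\le n-1$. Consider columns $[-i-1,-i]\times[1,\infty)$, $i\in\mathbb Z_{\ge0}$, in $\mathbb R_{\le0}\times\mathbb R_{\ge1}$. The cell $[-i-1,-i]\times[l,l+1]$ ($l\ge1$) is the place of one unit-height block colored $\pi'(l)$ if $\pi'(l)\ne1$; if $\pi'(l)=1$ it consists of two places $[-i-1,-i]\times[l,l+\frac12]$ and $[-i-1,-i]\times[l+\frac12,l+1]$ of half-unit-height blocks colored $1$. The ground state wall $Y_{\Lambda_1}$ has exactly the half-height $1$-block on $[1,\frac32]$ in every column. A *Young wall* of type $\mathrm A^{(2)}_{2n-2}$ of ground state $\Lambda_1$ is obtained from $Y_{\Lambda_1}$ by stacking finitely many blocks (in each column contiguously from the bottom, following this coloring pattern) such that the heights $h_j$ (of the $j$-th column from the right, measured from the bottom line) satisfy $h_j\ge h_{j+1}$ for all $j$. A column is *full* if its height is an integer. The wall is *proper* if no two full columns have the same height. $\mathrm{YW}_{\mathrm A^{(2)},1}$ is the set of proper Young walls of ground state $\Lambda_1$. A block of color $t$ in proper $Y$ is a *removable $t$-block* if removing it yields a proper Young wall; an empty place of color $t$ is a *$t$-admissible slot* if adding the block there yields a proper Young wall. If adding two half-height $1$-blocks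 to one column (filling both halves of one cell) yields a proper Young wall, the lower of the two slots is *double $1$-admissible*; if removing two half-height $1$-blocks (both halves of one cell) from one column yields a proper Young wall, the upper of these two blocks is *double removable*. All other admissible slots (removable blocks) are *single*. **Assignment for $k=1$.** $P^1(1)=0$, $P^1(l)=P^1(l-1)+p_{\pi'(l),\pi'(l-1)}$ for $l\ge2$. For a slot or block $S$ lying in the cell $[-i-1,-i]\times[l,l+1]$ (the whole cell, or either of its halves), of color $t=\pi'(l)$, put $L^1_{s,1,\mathrm{ad}}(S)=x_{s+P^1(l)+i,\,t}$, $L^1_{s,1,\mathrm{re}}(S)=x_{s+P^1(l)+i+1,\,t}$. Then $$L^1_{s,1,\iota}(Y)=\sum_{\text{single admissible slots }P}L^1_{s,1,\mathrm{ad}}(P)-\sum_{\text{single removable blocks }P}L^1_{s,1,\mathrm{re}}(P)+\sum_{\text{double }1\text{-admissible slots }P}2L^1_{s,1,\mathrm{ad}}(P)-\sum_{\text{double removable }1\text{-blocks }P}2L^1_{s,1,\mathrm{re}}(P).$$ *)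

theory Defs
  imports
    Complex_Main
    "HOL-Library.Poly_Mapping"
    "HOL-Library.Infinite_Set"
    "HOL-Computational_Algebra.Polynomial"
    "HOL-Computational_Algebra.Fraction_Field"
    "HOL-Algebra.QuotRing"
begin

section \<open>Cartan datum of type \<open>A_(2n-2)^(2)\<close>, index set \<open>{1..n}\<close>, \<open>n \<ge> 3\<close>\<close>

text \<open>\<open>cartan n i j\<close> is the pairing of the coroot \<open>h_i\<close> with the simple root \<open>\<alpha>_j\<close>.\<close>

definition cartan :: "nat \<Rightarrow> nat \<Rightarrow> nat \<Rightarrow> int" where
  "cartan n i j =
     (if i = j then 2
      else if (i = 2 \<and> j = 1) \<or> (i = n \<and> j = n - 1) then -2
      else if i = j + 1 \<or> j = i + 1 then -1
      else 0)"

text \<open>\<open>half_norm n i\<close> is \<open>(\<alpha>_i, \<alpha>_i) / 2\<close>, so that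
  \<open>half_norm n i * cartan n i j\<close> is symmetric in \<open>i, j\<close>.\<close>

definition half_norm :: "nat \<Rightarrow> nat \<Rightarrow> nat" where
  "half_norm n i = (if i = 1 then 4 else if i = n then 1 else 2)"

text \<open>All weights that occur lie in the root lattice. A weight is given by its coefficients with
  respect to the (linearly independent) simple roots.\<close>

type_synonym weight = "nat \<Rightarrow> int"

definition pairing :: "nat \<Rightarrow> nat \<Rightarrow> weight \<Rightarrow> int" where
  "pairing n i \<mu> = (\<Sum>j\<in>{1..n}. cartan n i j * \<mu> j)"


section \<open>Crystals and strict embeddings\<close>

text \<open>\<open>None\<close> plays the role of the additional element \<open>0\<close> of a crystal.\<close>

record 'b crystal =
  elems :: "'b set"
  wt :: "'b \<Rightarrow> weight"
  eps :: "nat \<Rightarrow> 'b \<Rightarrow> int"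
  phi :: "nat \<Rightarrow> 'b \<Rightarrow> int"
  et :: "nat \<Rightarrow> 'b \<Rightarrow> 'b option"
  ft :: "nat \<Rightarrow> 'b \<Rightarrow> 'b option"

definition strict_embedding :: "nat set \<Rightarrow> 'b crystal \<Rightarrow> 'c crystal \<Rightarrow> ('b \<Rightarrow> 'c) \<Rightarrow> bool" where
  "strict_embedding I B C \<Psi> \<longleftrightarrow>
     inj_on \<Psi> (elems B) \<and> \<Psi> ` elems B \<subseteq> elems C \<and>
     (\<forall>b\<in>elems B. wt C (\<Psi> b) = wt B b \<and>
        (\<forall>i\<in>I. eps C i (\<Psi> b) = eps B i b \<and> phi C i (\<Psi> b) = phi B i b \<and>
               et C i (\<Psi> b) = map_option \<Psi> (et B i b) \<and>
               ft C i (\<Psi> b) = map_option \<Psi> (ft B i b)))"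


section \<open>The algebra \<open>U\<^sub>q\<^sup>-\<close>\<close>

text \<open>The free algebra on \<open>f_1, f_2, \<dots>\<close> over \<open>\<rat>(q)\<close> is the monoid algebra of the free monoid.\<close>

datatype fmon = Mon (letters: "nat list")

instantiation fmon :: monoid_add
begin
definition zero_fmon :: fmon where "zero_fmon = Mon []"
definition plus_fmon :: "fmon \<Rightarrow> fmon \<Rightarrow> fmon" where
  "plus_fmon v w = Mon (letters v @ letters w)"
instance by standard (simp_all add: zero_fmon_def plus_fmon_def)
end

type_synonym scal = "rat poly fract"
type_synonym falg = "fmon \<Rightarrow>\<^sub>0 scal"

definition qq :: scal where "qq = Fract [:0, 1:] 1"

definition qi :: "nat \<Rightarrow> nat \<Rightarrow> scal" where "qi n i = qq ^ half_norm n i"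

definition qint :: "nat \<Rightarrow> nat \<Rightarrow> nat \<Rightarrow> scal" where
  "qint n i m = (qi n i ^ m - inverse (qi n i) ^ m) / (qi n i - inverse (qi n i))"

definition qfact :: "nat \<Rightarrow> nat \<Rightarrow> nat \<Rightarrow> scal" where
  "qfact n i m = (\<Prod>l\<in>{1..m}. qint n i l)"

definition const :: "scal \<Rightarrow> falg" where "const c = Poly_Mapping.single 0 c"

definition gen :: "nat \<Rightarrow> falg" where "gen i = Poly_Mapping.single (Mon [i]) 1"

definition divpow :: "nat \<Rightarrow> nat \<Rightarrow> nat \<Rightarrow> falg" where
  "divpow n i m = const (inverse (qfact n i m)) * gen i ^ m"

definition free_ring :: "nat \<Rightarrow> falg ring" where
  "free_ring n =
     \<lparr>carrier = {u. \<forall>w\<in>Poly_Mapping.keys u. set (letters w) \<subseteq> {1..n}},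
      mult = (*), one = 1, zero = 0, add = (+)\<rparr>"

definition serre :: "nat \<Rightarrow> nat \<Rightarrow> nat \<Rightarrow> falg" where
  "serre n i j =
     (\<Sum>m\<in>{0..nat (1 - cartan n i j)}.
        (- 1) ^ m * divpow n i m * gen j * divpow n i (nat (1 - cartan n i j) - m))"

definition serre_ideal :: "nat \<Rightarrow> falg set" where
  "serre_ideal n =
     genideal (free_ring n) {serre n i j | i j. i \<in> {1..n} \<and> j \<in> {1..n} \<and> i \<noteq> j}"

definition Uminus :: "nat \<Rightarrow> (falg set) ring" where
  "Uminus n = free_ring n Quot serre_ideal n"

definition cls :: "nat \<Rightarrow> falg \<Rightarrow> falg set" where
  "cls n u = serre_ideal n +>\<^bsub>free_ring n\<^esub> u"

definition smul :: "nat \<Rightarrow> scal \<Rightarrow> falg set \<Rightarrow> falg set" where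
  "smul n c X = cls n (const c) \<otimes>\<^bsub>Uminus n\<^esub> X"


section \<open>Kashiwara operators on \<open>U\<^sub>q\<^sup>-\<close>\<close>

text \<open>Kashiwara's operator \<open>e_i'\<close> is given by
  \<open>[e_i, P] = (t_i e_i''(P) - t_i\<^sup>-\<^sup>1 e_i'(P)) / (q_i - q_i\<^sup>-\<^sup>1)\<close> in \<open>U\<^sub>q\<close>. Moving \<open>f_j\<close> past
  \<open>t_i\<^sup>-\<^sup>1\<close> gives \<open>e_i'(f_j P) = q_i^(-a) f_j e_i'(P) + \<delta>_ij P\<close> with \<open>a = cartan n i j\<close>, and
  \<open>e_i'(1) = 0\<close>. This recursion is used on the free algebra; it induces \<open>e_i'\<close> on the quotient.\<close>

primrec eprime_word :: "nat \<Rightarrow> nat \<Rightarrow> nat list \<Rightarrow> falg" where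
  "eprime_word n i [] = 0"
| "eprime_word n i (j # w) =
     const (qi n i powi (- cartan n i j)) * gen j * eprime_word n i w
     + (if i = j then Poly_Mapping.single (Mon w) 1 else 0)"

definition eprime_free :: "nat \<Rightarrow> nat \<Rightarrow> falg \<Rightarrow> falg" where
  "eprime_free n i u =
     (\<Sum>w\<in>Poly_Mapping.keys u. const (Poly_Mapping.lookup u w) * eprime_word n i (letters w))"

definition eprime :: "nat \<Rightarrow> nat \<Rightarrow> falg set \<Rightarrow> falg set" where
  "eprime n i X = (\<Union>u\<in>X. cls n (eprime_free n i u))"

text \<open>\<open>string_sum n i s Y\<close> is the sum over \<open>m\<close> of \<open>f_i^(m+s) Y(m)\<close>, for \<open>m + s \<ge> 0\<close>.\<close>

definition string_sum :: "nat \<Rightarrow> nat \<Rightarrow> int \<Rightarrow> (nat \<Rightarrow> falg set) \<Rightarrow> falg set" where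
  "string_sum n i s Y =
     (\<Oplus>\<^bsub>Uminus n\<^esub>m\<in>{m. Y m \<noteq> \<zero>\<^bsub>Uminus n\<^esub> \<and> int m + s \<ge> 0}.
        cls n (divpow n i (nat (int m + s))) \<otimes>\<^bsub>Uminus n\<^esub> Y m)"

definition string_decomp :: "nat \<Rightarrow> nat \<Rightarrow> falg set \<Rightarrow> (nat \<Rightarrow> falg set) \<Rightarrow> bool" where
  "string_decomp n i X Y \<longleftrightarrow>
     (\<forall>m. Y m \<in> carrier (Uminus n) \<and> eprime n i (Y m) = \<zero>\<^bsub>Uminus n\<^esub>) \<and>
     finite {m. Y m \<noteq> \<zero>\<^bsub>Uminus n\<^esub>} \<and>
     X = string_sum n i 0 Y"

definition ftU :: "nat \<Rightarrow> nat \<Rightarrow> falg set \<Rightarrow> falg set" where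
  "ftU n i X = string_sum n i 1 (THE Y. string_decomp n i X Y)"

definition etU :: "nat \<Rightarrow> nat \<Rightarrow> falg set \<Rightarrow> falg set" where
  "etU n i X = string_sum n i (- 1) (THE Y. string_decomp n i X Y)"


section \<open>The crystal base \<open>(L(\<infinity>), B(\<infinity>))\<close>\<close>

definition regular_at_0 :: "scal set" where
  "regular_at_0 = {Fract a b | a b. poly b 0 \<noteq> 0}"

inductive_set ft_monomials :: "nat \<Rightarrow> falg set set" for n where
  one: "\<one>\<^bsub>Uminus n\<^esub> \<in> ft_monomials n"
| step: "X \<in> ft_monomials n \<Longrightarrow> i \<in> {1..n} \<Longrightarrow> ftU n i X \<in> ft_monomials n"

inductive_set Linf :: "nat \<Rightarrow> falg set set" for n where
  monomial: "X \<in> ft_monomials n \<Longrightarrow> X \<in> Linf n"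
| zero: "\<zero>\<^bsub>Uminus n\<^esub> \<in> Linf n"
| add: "X \<in> Linf n \<Longrightarrow> Y \<in> Linf n \<Longrightarrow> X \<oplus>\<^bsub>Uminus n\<^esub> Y \<in> Linf n"
| scale: "X \<in> Linf n \<Longrightarrow> c \<in> regular_at_0 \<Longrightarrow> smul n c X \<in> Linf n"

definition qLinf :: "nat \<Rightarrow> falg set set" where "qLinf n = smul n qq ` Linf n"

text \<open>Elements of \<open>L(\<infinity>)/qL(\<infinity>)\<close> are the cosets of \<open>qL(\<infinity>)\<close>; its zero is \<open>qL(\<infinity>)\<close> itself.\<close>

definition Bcls :: "nat \<Rightarrow> falg set \<Rightarrow> falg set set" where
  "Bcls n X = qLinf n +>\<^bsub>Uminus n\<^esub> X"

definition induced :: "nat \<Rightarrow> (falg set \<Rightarrow> falg set) \<Rightarrow> falg set set \<Rightarrow> falg set set" where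
  "induced n g b = (\<Union>X\<in>b. Bcls n (g X))"

definition nonzero :: "nat \<Rightarrow> falg set set \<Rightarrow> falg set set option" where
  "nonzero n b = (if b = qLinf n then None else Some b)"

definition has_weight :: "nat \<Rightarrow> falg set \<Rightarrow> weight \<Rightarrow> bool" where
  "has_weight n X \<mu> \<longleftrightarrow>
     (\<exists>u\<in>carrier (free_ring n). X = cls n u \<and>
        (\<forall>w\<in>Poly_Mapping.keys u. \<forall>i. \<mu> i = - int (count_list (letters w) i)))"

definition wt_Binf :: "nat \<Rightarrow> falg set set \<Rightarrow> weight" where
  "wt_Binf n b = (THE \<mu>. \<exists>X\<in>b. has_weight n X \<mu>)"

definition eps_Binf :: "nat \<Rightarrow> nat \<Rightarrow> falg set set \<Rightarrow> int" where
  "eps_Binf n i b = int (Max {k. (induced n (etU n i) ^^ k) b \<noteq> qLinf n})"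

definition Binf :: "nat \<Rightarrow> falg set set crystal" where
  "Binf n =
     \<lparr>elems = Bcls n ` ft_monomials n - {qLinf n},
      wt = wt_Binf n,
      eps = eps_Binf n,
      phi = (\<lambda>i b. eps_Binf n i b + pairing n i (wt_Binf n b)),
      et = (\<lambda>i b. nonzero n (induced n (etU n i) b)),
      ft = (\<lambda>i b. nonzero n (induced n (ftU n i) b))\<rparr>"

definition u_inf :: "nat \<Rightarrow> falg set set" where
  "u_inf n = Bcls n \<one>\<^bsub>Uminus n\<^esub>"


section \<open>Sequences\<close>

text \<open>A sequence \<open>(\<dots>, i_2, i_1)\<close> is a function on \<open>nat\<close> whose value at \<open>0\<close> is irrelevant.\<close>

definition index_seq :: "nat \<Rightarrow> (nat \<Rightarrow> nat) \<Rightarrow> bool" where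
  "index_seq n \<iota> \<longleftrightarrow>
     (\<forall>k\<ge>1. \<iota> k \<in> {1..n}) \<and> (\<forall>k\<ge>1. \<iota> k \<noteq> \<iota> (k + 1)) \<and>
     (\<forall>i\<in>{1..n}. infinite {k. k \<ge> 1 \<and> \<iota> k = i})"

text \<open>The subsequence of all \<open>i\<close> and \<open>j\<close>, read from right to left; its entry number \<open>0\<close> is the
  last (rightmost) one.\<close>

definition subsequence :: "(nat \<Rightarrow> nat) \<Rightarrow> nat \<Rightarrow> nat \<Rightarrow> nat \<Rightarrow> nat" where
  "subsequence \<iota> i j r = \<iota> (enumerate {k. k \<ge> 1 \<and> \<iota> k \<in> {i, j}} r)"

definition alternates :: "(nat \<Rightarrow> nat) \<Rightarrow> nat \<Rightarrow> nat \<Rightarrow> bool" where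
  "alternates \<iota> i j \<longleftrightarrow> (\<forall>r. subsequence \<iota> i j r = (if even r then i else j))"

definition adapted :: "nat \<Rightarrow> (nat \<Rightarrow> nat) \<Rightarrow> bool" where
  "adapted n \<iota> \<longleftrightarrow>
     (\<forall>i\<in>{1..n}. \<forall>j\<in>{1..n}. cartan n i j < 0 \<longrightarrow> alternates \<iota> i j \<or> alternates \<iota> j i)"

text \<open>Only used for \<open>i = j = 1\<close> and for \<open>i, j\<close> with \<open>cartan n i j < 0\<close>.\<close>

definition pp :: "(nat \<Rightarrow> nat) \<Rightarrow> nat \<Rightarrow> nat \<Rightarrow> int" where
  "pp \<iota> i j = (if i \<noteq> j \<and> alternates \<iota> i j then 1 else 0)"


section \<open>The crystal \<open>\<int>\<^sup>\<infinity>\<close> and the embedding of \<open>B(\<infinity>)\<close>\<close>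

definition Zinf :: "(nat \<Rightarrow> int) set" where
  "Zinf = {a. a 0 = 0 \<and> finite {k. a k \<noteq> 0}}"

definition sigma :: "nat \<Rightarrow> (nat \<Rightarrow> nat) \<Rightarrow> nat \<Rightarrow> (nat \<Rightarrow> int) \<Rightarrow> int" where
  "sigma n \<iota> k a = a k + (\<Sum>j | j > k \<and> a j \<noteq> 0. cartan n (\<iota> k) (\<iota> j) * a j)"

definition wt_Z :: "(nat \<Rightarrow> nat) \<Rightarrow> (nat \<Rightarrow> int) \<Rightarrow> weight" where
  "wt_Z \<iota> a i = - (\<Sum>j | j \<ge> 1 \<and> a j \<noteq> 0 \<and> \<iota> j = i. a j)"

definition eps_Z :: "nat \<Rightarrow> (nat \<Rightarrow> nat) \<Rightarrow> nat \<Rightarrow> (nat \<Rightarrow> int) \<Rightarrow> int" where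
  "eps_Z n \<iota> i a = Max {sigma n \<iota> k a | k. k \<ge> 1 \<and> \<iota> k = i}"

definition M_Z :: "nat \<Rightarrow> (nat \<Rightarrow> nat) \<Rightarrow> nat \<Rightarrow> (nat \<Rightarrow> int) \<Rightarrow> nat set" where
  "M_Z n \<iota> i a = {k. k \<ge> 1 \<and> \<iota> k = i \<and> sigma n \<iota> k a = eps_Z n \<iota> i a}"

text \<open>\<open>M_Z\<close> may be infinite, but not if \<open>eps_Z\<close> is positive; hence \<open>LEAST\<close> for its minimum.\<close>

definition Z_crystal :: "nat \<Rightarrow> (nat \<Rightarrow> nat) \<Rightarrow> (nat \<Rightarrow> int) crystal" where
  "Z_crystal n \<iota> =
     \<lparr>elems = Zinf,
      wt = wt_Z \<iota>,
      eps = eps_Z n \<iota>,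
      phi = (\<lambda>i a. pairing n i (wt_Z \<iota> a) + eps_Z n \<iota> i a),
      et = (\<lambda>i a. if eps_Z n \<iota> i a > 0
                  then Some (a(Max (M_Z n \<iota> i a) := a (Max (M_Z n \<iota> i a)) - 1)) else None),
      ft = (\<lambda>i a. Some (a((LEAST k. k \<in> M_Z n \<iota> i a) := a (LEAST k. k \<in> M_Z n \<iota> i a) + 1)))\<rparr>"

text \<open>\<open>is_Psi n \<iota> \<Psi>\<close>: \<open>\<Psi>\<close> is the Kashiwara embedding, which exists and is unique
  as a function on the elements of \<open>B(\<infinity>)\<close>.\<close>

definition is_Psi :: "nat \<Rightarrow> (nat \<Rightarrow> nat) \<Rightarrow> (falg set set \<Rightarrow> nat \<Rightarrow> int) \<Rightarrow> bool" where
  "is_Psi n \<iota> \<Psi> \<longleftrightarrow>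
     strict_embedding {1..n} (Binf n) (Z_crystal n \<iota>) \<Psi> \<and> \<Psi> (u_inf n) = (\<lambda>_. 0)"


section \<open>Linear forms, the operators \<open>S'\<close>, and positivity\<close>

text \<open>A linear form \<open>\<Sum>c_k x_k\<close> is given by its coefficients \<open>c_k\<close>, \<open>k \<ge> 1\<close>.\<close>

type_synonym form = "nat \<Rightarrow> rat"

definition xf :: "nat \<Rightarrow> form" where "xf k = (\<lambda>m. if m = k then 1 else 0)"

definition apply_form :: "form \<Rightarrow> (nat \<Rightarrow> int) \<Rightarrow> rat" where
  "apply_form c a = (\<Sum>k | a k \<noteq> 0. c k * of_int (a k))"

definition kplus :: "(nat \<Rightarrow> nat) \<Rightarrow> nat \<Rightarrow> nat" where
  "kplus \<iota> k = (LEAST l. l > k \<and> \<iota> l = \<iota> k)"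

definition kminus :: "(nat \<Rightarrow> nat) \<Rightarrow> nat \<Rightarrow> nat" where
  "kminus \<iota> k = Max ({l. 1 \<le> l \<and> l < k \<and> \<iota> l = \<iota> k} \<union> {0})"

definition beta :: "nat \<Rightarrow> (nat \<Rightarrow> nat) \<Rightarrow> nat \<Rightarrow> form" where
  "beta n \<iota> k = (\<lambda>m. if k = 0 then 0 else
     xf k m + (\<Sum>j\<in>{k<..<kplus \<iota> k}. of_int (cartan n (\<iota> k) (\<iota> j)) * xf j m) + xf (kplus \<iota> k) m)"

definition Sprime :: "nat \<Rightarrow> (nat \<Rightarrow> nat) \<Rightarrow> nat \<Rightarrow> form \<Rightarrow> form" where
  "Sprime n \<iota> k c =
     (if c k > 0 then (\<lambda>m. c m - beta n \<iota> k m)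
      else if c k < 0 then (\<lambda>m. c m + beta n \<iota> (kminus \<iota> k) m)
      else c)"

inductive_set Xi_prime :: "nat \<Rightarrow> (nat \<Rightarrow> nat) \<Rightarrow> form set" for n \<iota> where
  base: "j \<ge> 1 \<Longrightarrow> xf j \<in> Xi_prime n \<iota>"
| step: "c \<in> Xi_prime n \<iota> \<Longrightarrow> k \<ge> 1 \<Longrightarrow> Sprime n \<iota> k c \<in> Xi_prime n \<iota>"

definition Xi_prime_positive :: "nat \<Rightarrow> (nat \<Rightarrow> nat) \<Rightarrow> bool" where
  "Xi_prime_positive n \<iota> \<longleftrightarrow>
     (\<forall>c\<in>Xi_prime n \<iota>. \<forall>k\<ge>1. kminus \<iota> k = 0 \<longrightarrow> c k \<ge> 0)"

text \<open>The form \<open>x_(s,l)\<close> in double-index notation; only meaningful for \<open>s \<ge> 1\<close>.\<close>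

definition xx :: "(nat \<Rightarrow> nat) \<Rightarrow> int \<Rightarrow> nat \<Rightarrow> form" where
  "xx \<iota> s l = xf (THE j. j \<ge> 1 \<and> \<iota> j = l \<and> int (card {m. 1 \<le> m \<and> m \<le> j \<and> \<iota> m = l}) = s)"


section \<open>Revised extended Young diagrams\<close>

definition REYD :: "nat \<Rightarrow> nat \<Rightarrow> (int \<Rightarrow> int) set" where
  "REYD n k = {y.
     (\<exists>N. \<forall>t\<ge>N. y t = int k) \<and> (\<exists>N. \<forall>t\<le>N. y t = int k + t) \<and>
     (\<forall>t. (if (int k + t) mod (2 * int n - 1) \<noteq> 0 then y (t + 1) \<in> {y t, y t + 1}
           else (t > 0 \<longrightarrow> y (t + 1) \<ge> y t) \<and> (t < 0 \<longrightarrow> y (t + 1) \<le> y t + 1)))}"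

text \<open>A point \<open>(i, y_i)\<close>, resp. \<open>(i, y_(i-1))\<close>, is determined by its first coordinate \<open>i\<close>.\<close>

definition T_adm :: "nat \<Rightarrow> nat \<Rightarrow> (int \<Rightarrow> int) \<Rightarrow> int set" where
  "T_adm n k y = {i. y(i := y i - 1) \<in> REYD n k}"

definition T_rem :: "nat \<Rightarrow> nat \<Rightarrow> (int \<Rightarrow> int) \<Rightarrow> int set" where
  "T_rem n k y = {i. y(i - 1 := y (i - 1) + 1) \<in> REYD n k}"

definition T_dadm :: "nat \<Rightarrow> nat \<Rightarrow> (int \<Rightarrow> int) \<Rightarrow> int set" where
  "T_dadm n k y = {i \<in> T_adm n k y. y (i - 1) < y i \<and> y i = y (i + 1) \<and>
     (((i + int k) mod (2 * int n - 1) = 1 \<and> i < 0) \<or>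
      ((i + int k) mod (2 * int n - 1) = 0 \<and> i > 0))}"

definition T_drem :: "nat \<Rightarrow> nat \<Rightarrow> (int \<Rightarrow> int) \<Rightarrow> int set" where
  "T_drem n k y = {i \<in> T_rem n k y. y (i - 2) = y (i - 1) \<and> y (i - 1) < y i \<and>
     (((i + int k - 1) mod (2 * int n - 1) = 1 \<and> i > 1) \<or>
      ((i + int k - 1) mod (2 * int n - 1) = 0 \<and> i < 1))}"

text \<open>Period \<open>2n - 1\<close>: \<open>1, 2, \<dots>, n - 1, n, n - 1, \<dots>, 2, 1\<close> at \<open>t = 1, \<dots>, 2n - 1\<close>.\<close>

definition pi1 :: "nat \<Rightarrow> int \<Rightarrow> nat" where
  "pi1 n t = (let r = (t - 1) mod (2 * int n - 1) + 1
              in nat (if r \<le> int n then r else 2 * int n - r))"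

definition PT :: "nat \<Rightarrow> (nat \<Rightarrow> nat) \<Rightarrow> nat \<Rightarrow> int \<Rightarrow> int" where
  "PT n \<iota> k t =
     (if t \<ge> int k then (\<Sum>u\<in>{int k<..t}. pp \<iota> (pi1 n u) (pi1 n (u - 1)))
      else (\<Sum>u\<in>{t..<int k}. pp \<iota> (pi1 n u) (pi1 n (u + 1))))"

definition LT_ad :: "nat \<Rightarrow> (nat \<Rightarrow> nat) \<Rightarrow> nat \<Rightarrow> nat \<Rightarrow> int \<Rightarrow> int \<Rightarrow> form" where
  "LT_ad n \<iota> s k i j =
     xx \<iota> (int s + PT n \<iota> k (i + int k) + min i 0 + int k - j) (pi1 n (i + int k))"

definition LT_re :: "nat \<Rightarrow> (nat \<Rightarrow> nat) \<Rightarrow> nat \<Rightarrow> nat \<Rightarrow> int \<Rightarrow> int \<Rightarrow> form" where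
  "LT_re n \<iota> s k i j =
     xx \<iota> (int s + PT n \<iota> k (i + int k - 1) + min (i - 1) 0 + int k - j) (pi1 n (i + int k - 1))"

definition LT :: "nat \<Rightarrow> (nat \<Rightarrow> nat) \<Rightarrow> nat \<Rightarrow> nat \<Rightarrow> (int \<Rightarrow> int) \<Rightarrow> form" where
  "LT n \<iota> s k y = (\<lambda>m.
       (\<Sum>i\<in>T_adm n k y - T_dadm n k y. LT_ad n \<iota> s k i (y i) m)
     - (\<Sum>i\<in>T_rem n k y - T_drem n k y. LT_re n \<iota> s k i (y (i - 1)) m)
     + (\<Sum>i\<in>T_dadm n k y. 2 * LT_ad n \<iota> s k i (y i) m)
     - (\<Sum>i\<in>T_drem n k y. 2 * LT_re n \<iota> s k i (y (i - 1)) m))"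


section \<open>Young walls of ground state \<open>\<Lambda>\<^sub>1\<close>\<close>

text \<open>Period \<open>2n - 2\<close>: \<open>1, 2, \<dots>, n - 1, n, n - 1, \<dots>, 2\<close> at \<open>l = 1, \<dots>, 2n - 2\<close>.\<close>

definition pi' :: "nat \<Rightarrow> nat \<Rightarrow> nat" where
  "pi' n l = (let r = (l - 1) mod (2 * n - 2) + 1 in if r \<le> n then r else 2 * n - r)"

text \<open>A place \<open>(i, l, p)\<close> lies in the cell \<open>[-i-1, -i] \<times> [l, l+1]\<close> and is the whole cell or its
  lower or upper half. A wall is the set of the places filled by its blocks.\<close>

datatype part = Whole | Lower | Upper

type_synonym place = "nat \<times> nat \<times> part"

definition places :: "nat \<Rightarrow> place set" where
  "places n = {(i, l, p). l \<ge> 1 \<and> (if pi' n l = 1 then p \<in> {Lower, Upper} else p = Whole)}"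

definition bottom :: "place \<Rightarrow> rat" where
  "bottom = (\<lambda>(i, l, p). of_nat l + (if p = Upper then 1/2 else 0))"

definition block_height :: "place \<Rightarrow> rat" where
  "block_height = (\<lambda>(i, l, p). if p = Whole then 1 else 1/2)"

definition ground_wall :: "place set" where
  "ground_wall = {(i, l, p). l = 1 \<and> p = Lower}"

definition col_height :: "place set \<Rightarrow> nat \<Rightarrow> rat" where
  "col_height Y i = (\<Sum>P\<in>{P \<in> Y. fst P = i}. block_height P)"

definition young_wall :: "nat \<Rightarrow> place set \<Rightarrow> bool" where
  "young_wall n Y \<longleftrightarrow>
     ground_wall \<subseteq> Y \<and> Y \<subseteq> places n \<and> finite (Y - ground_wall) \<and>
     (\<forall>P\<in>Y. \<forall>Q\<in>places n. fst Q = fst P \<and> bottom Q < bottom P \<longrightarrow> Q \<in> Y) \<and>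
     (\<forall>i. col_height Y i \<ge> col_height Y (i + 1))"

definition full_col :: "place set \<Rightarrow> nat \<Rightarrow> bool" where
  "full_col Y i \<longleftrightarrow> col_height Y i \<in> \<int>"

definition YW :: "nat \<Rightarrow> place set set" where
  "YW n = {Y. young_wall n Y \<and>
     (\<forall>i j. i \<noteq> j \<and> full_col Y i \<and> full_col Y j \<longrightarrow> col_height Y i \<noteq> col_height Y j)}"

definition Y_adm :: "nat \<Rightarrow> place set \<Rightarrow> place set" where
  "Y_adm n Y = {P \<in> places n - Y. insert P Y \<in> YW n}"

definition Y_rem :: "nat \<Rightarrow> place set \<Rightarrow> place set" where
  "Y_rem n Y = {P \<in> Y. Y - {P} \<in> YW n}"

definition Y_dadm :: "nat \<Rightarrow> place set \<Rightarrow> place set" where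
  "Y_dadm n Y = {(i, l, p). p = Lower \<and> {(i, l, Lower), (i, l, Upper)} \<subseteq> places n - Y \<and>
     Y \<union> {(i, l, Lower), (i, l, Upper)} \<in> YW n}"

definition Y_drem :: "nat \<Rightarrow> place set \<Rightarrow> place set" where
  "Y_drem n Y = {(i, l, p). p = Upper \<and> {(i, l, Lower), (i, l, Upper)} \<subseteq> Y \<and>
     Y - {(i, l, Lower), (i, l, Upper)} \<in> YW n}"

definition PY :: "nat \<Rightarrow> (nat \<Rightarrow> nat) \<Rightarrow> nat \<Rightarrow> int" where
  "PY n \<iota> l = (\<Sum>u\<in>{2..l}. pp \<iota> (pi' n u) (pi' n (u - 1)))"

definition LY_ad :: "nat \<Rightarrow> (nat \<Rightarrow> nat) \<Rightarrow> nat \<Rightarrow> place \<Rightarrow> form" where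
  "LY_ad n \<iota> s = (\<lambda>(i, l, p). xx \<iota> (int s + PY n \<iota> l + int i) (pi' n l))"

definition LY_re :: "nat \<Rightarrow> (nat \<Rightarrow> nat) \<Rightarrow> nat \<Rightarrow> place \<Rightarrow> form" where
  "LY_re n \<iota> s = (\<lambda>(i, l, p). xx \<iota> (int s + PY n \<iota> l + int i + 1) (pi' n l))"

definition LY :: "nat \<Rightarrow> (nat \<Rightarrow> nat) \<Rightarrow> nat \<Rightarrow> place set \<Rightarrow> form" where
  "LY n \<iota> s Y = (\<lambda>m.
       (\<Sum>P\<in>Y_adm n Y - Y_dadm n Y. LY_ad n \<iota> s P m)
     - (\<Sum>P\<in>Y_rem n Y - Y_drem n Y. LY_re n \<iota> s P m)
     + (\<Sum>P\<in>Y_dadm n Y. 2 * LY_ad n \<iota> s P m)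
     - (\<Sum>P\<in>Y_drem n Y. 2 * LY_re n \<iota> s P m))"

end

theory Submission
  imports Defs
begin

text \<open>
  The algebra \<open>U\<^sub>q\<^sup>-\<close> enters only through the linearity of Kashiwara's operators \<open>f~\<^sub>i\<close>: the relation
  \<open>e\<^sub>i' f\<^sub>i = q\<^sub>i\<^sup>-\<^sup>2 f\<^sub>i e\<^sub>i' + 1\<close> and the nilpotency of \<open>e\<^sub>i'\<close> give existence and uniqueness of string
  decompositions, and a counit shows that \<open>u\<^sub>\<infinity>\<close> is not zero. Hence the image of any strict
  embedding is the closure of \<open>0\<close> under the operators \<open>f~\<^sub>i\<close> of \<open>\<int>\<^sup>\<infinity>\<close>, and nothing else about \<open>B(\<infinity>)\<close>
  is needed.

  By the argument of Nakashima and Zelevinsky this closure is cut out by any set of integral forms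
  that contains the coordinates, is closed under the operators \<open>S'\<^sub>k\<close> and is nonnegative at every
  \<open>k\<close> with \<open>k\<^sup>(\<^sup>-\<^sup>) = 0\<close>; such a set also contains \<open>\<Xi>'\<close>. It remains to see that the forms of the
  diagrams and walls are such a set.

  Both kinds of objects are profiles of column (for walls: row) lengths that decrease away from a
  centre, in steps of at most one except across the edges joining two columns of colour 1. The form of
  a profile is a sum over its edges, so the effect of adding a box is local to two edges; it is the
  subtraction of \<open>\<beta>\<^sub>k\<close>. The first index of a removable place is at least 2, which is positivity.
\<close>

section \<open>The Kashiwara operators on the free algebra\<close>

text \<open>The two kinds of edges explain the constants. Along an ordinary edge the colours are
  adjacent and the drop is 0 or 1, so a new box switches the edge term on or off, which produces one
  neighbour term of \<open>beta\<close>. Between two columns of colour 1 the drop is unbounded;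
  counting it as at most 1 is right because for drop 0 both ends carry the same variable. At such a
  column that edge contributes \<open>x_(sigma+1) - x_sigma\<close> or its negative, which the
  factor 2 on the ordinary edge corrects; seen from colour 2, the same factor is
  \<open>- a_(2,1)\<close>. For walls the central variable replaces the missing edge left of the
  centre.

  On the algebraic side the obstacle is that \<open>e_i'\<close> lives on the free algebra and acts
  on the quotient only once the Serre ideal is known to be stable. As \<open>e_i'\<close> is a skew
  derivation, its twist has to be controlled along with it. That no \<open>f~_i b\<close> is 0 is
  not derived from the algebra: it follows from strictness, since \<open>f~_i\<close> is never 0 on
  integer sequences.\<close>

lemma poly_mapping_induct:
  fixes u :: "'a \<Rightarrow>\<^sub>0 'b::comm_monoid_add"
  assumes single: "\<And>w c. P (Poly_Mapping.single w c)"
    and add: "\<And>u v. P u \<Longrightarrow> P v \<Longrightarrow> P (u + v)" and zero: "P 0"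
  shows "P u"
proof (induction u rule: update_induct)
  case const
  show ?case by (rule zero)
next
  case (update f a b)
  have eq: "Poly_Mapping.update a b f = f + Poly_Mapping.single a b"
    using update.hyps
    by (intro poly_mapping_eqI) (auto simp: lookup_update lookup_add lookup_single in_keys_iff)
  show ?case unfolding eq by (intro add single update.IH)
qed

lemma const_0 [simp]: "const 0 = 0"
  and const_1 [simp]: "const 1 = 1"
  and const_add: "const (c + d) = const c + const d"
  and const_mult: "const (c * d) = const c * const d"
  and const_uminus: "const (- c) = - const c"
  by (simp_all add: const_def single_add mult_single single_uminus)

lemma const_times_single: "const c * Poly_Mapping.single w d = Poly_Mapping.single w (c * d)"
  by (simp add: const_def mult_single)

lemma const_commute: "u * const c = const c * u"
  by (induction u rule: poly_mapping_induct)
    (simp_all add: const_def mult_single algebra_simps)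

lemma const_left_commute: "u * (const c * v) = const c * (u * v)"
  by (metis const_commute mult.assoc)

lemma gen_const_times: "gen j * (const c * v) = const c * (gen j * v)"
  by (rule const_left_commute)

lemma const_const_times: "const c * (const d * u) = const (c * d) * u"
  by (simp add: const_mult mult.assoc)

lemma const_sum: "const (\<Sum>x\<in>A. f x) = (\<Sum>x\<in>A. const (f x))"
  by (induction A rule: infinite_finite_induct) (simp_all add: const_add)

lemma single_Cons: "Poly_Mapping.single (Mon (j # w)) 1 = gen j * Poly_Mapping.single (Mon w) 1"
  by (simp add: gen_def mult_single plus_fmon_def)

text \<open>Linear extension to the free algebra of a map given on words; \<open>eprime_free\<close>
  and \<open>twist\<close> are both instances.\<close>

definition lin :: "(fmon \<Rightarrow> falg) \<Rightarrow> falg \<Rightarrow> falg" where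
  "lin g u = (\<Sum>w\<in>Poly_Mapping.keys u. const (Poly_Mapping.lookup u w) * g w)"

lemma lin_superset:
  assumes "finite S" "Poly_Mapping.keys u \<subseteq> S"
  shows "lin g u = (\<Sum>w\<in>S. const (Poly_Mapping.lookup u w) * g w)"
  unfolding lin_def using assms
  by (intro sum.mono_neutral_left) (auto simp: in_keys_iff)

lemma lin_add: "lin g (u + v) = lin g u + lin g v"
proof -
  let ?S = "Poly_Mapping.keys u \<union> Poly_Mapping.keys v"
  have "Poly_Mapping.keys (u + v) \<subseteq> ?S" by (rule keys_add)
  then show ?thesis
    by (simp add: lin_superset[of ?S] lookup_add const_add algebra_simps sum.distrib)
qed

lemma lin_single: "lin g (Poly_Mapping.single w c) = const c * g w"
  by (simp add: lin_def)

lemma lin_0 [simp]: "lin g 0 = 0"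
  by (simp add: lin_def)

lemma lin_const_times: "lin g (const c * u) = const c * lin g u"
  by (induction u rule: poly_mapping_induct)
    (simp_all add: const_times_single lin_single const_const_times lin_add distrib_left)

lemma lin_uminus: "lin g (- u) = - lin g u"
  using lin_const_times[of g "-1" u] by (simp add: const_uminus)

lemma lin_diff: "lin g (u - v) = lin g u - lin g v"
  using lin_add[of g u "- v"] by (simp add: lin_uminus)

lemma lin_sum: "lin g (\<Sum>x\<in>A. f x) = (\<Sum>x\<in>A. lin g (f x))"
  by (induction A rule: infinite_finite_induct) (simp_all add: lin_add)

lemma eprime_free_lin: "eprime_free n i = lin (\<lambda>w. eprime_word n i (letters w))"
  by (simp add: fun_eq_iff eprime_free_def lin_def)

lemmas eprime_free_add = lin_add[where g = "\<lambda>w. eprime_word n i (letters w)" for n i, folded eprime_free_lin]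
  and eprime_free_const_times = lin_const_times[where g = "\<lambda>w. eprime_word n i (letters w)" for n i, folded eprime_free_lin]
  and eprime_free_0 [simp] = lin_0[where g = "\<lambda>w. eprime_word n i (letters w)" for n i, folded eprime_free_lin]
  and eprime_free_diff = lin_diff[where g = "\<lambda>w. eprime_word n i (letters w)" for n i, folded eprime_free_lin]
  and eprime_free_sum = lin_sum[where g = "\<lambda>w. eprime_word n i (letters w)" for n i, folded eprime_free_lin]

lemma eprime_free_gen_times:
  "eprime_free n i (gen j * u) =
     const (qi n i powi (- cartan n i j)) * gen j * eprime_free n i u + (if i = j then u else 0)"
proof (induction u rule: poly_mapping_induct)
  case (1 w c)
  have "gen j * Poly_Mapping.single w c = Poly_Mapping.single (Mon (j # letters w)) c"
    by (simp add: gen_def mult_single plus_fmon_def)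
  moreover have "const c * Poly_Mapping.single w 1 = Poly_Mapping.single w c"
    by (simp add: const_times_single)
  ultimately show ?case
    by (simp add: eprime_free_lin lin_single distrib_left const_const_times gen_const_times mult.assoc
        mult.commute[of c])
next
  case (2 u v)
  then show ?case by (simp add: eprime_free_add algebra_simps)
qed simp

section \<open>Kashiwara's operator as a skew derivation\<close>

definition qchar :: "nat \<Rightarrow> nat \<Rightarrow> nat list \<Rightarrow> scal" where
  "qchar n i w = (\<Prod>j\<leftarrow>w. qi n i powi (- cartan n i j))"

text \<open>The algebra automorphism sending \<open>f_j\<close> to \<open>q_i^(-a_ij) f_j\<close>,
  that is, conjugation by \<open>t_i\<close>. It measures how far \<open>e_i'\<close> is from being
  a derivation.\<close>

definition twist :: "nat \<Rightarrow> nat \<Rightarrow> falg \<Rightarrow> falg" where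
  "twist n i = lin (\<lambda>w. const (qchar n i (letters w)) * Poly_Mapping.single w 1)"

lemma twist_add: "twist n i (u + v) = twist n i u + twist n i v"
  and twist_0 [simp]: "twist n i 0 = 0"
  and twist_const_times: "twist n i (const c * u) = const c * twist n i u"
  and twist_sum: "twist n i (\<Sum>x\<in>A. f x) = (\<Sum>x\<in>A. twist n i (f x))"
  by (simp_all add: twist_def lin_add lin_const_times lin_sum)

lemma twist_single: "twist n i (Poly_Mapping.single w c) = const (qchar n i (letters w)) * Poly_Mapping.single w c"
  by (simp add: twist_def lin_single const_times_single mult.commute)

lemma twist_gen_times: "twist n i (gen j * u) = const (qi n i powi (- cartan n i j)) * gen j * twist n i u"
proof (induction u rule: poly_mapping_induct)
  case (1 w c)
  then show ?case
    by (simp add: gen_def mult_single plus_fmon_def twist_single qchar_def const_times_single mult.assoc mult.left_commute)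
qed (simp_all add: twist_add algebra_simps)

lemma twist_mult: "twist n i (u * v) = twist n i u * twist n i v"
proof (induction u rule: poly_mapping_induct)
  case (1 w c)
  show ?case
  proof (induction v rule: poly_mapping_induct)
    case (1 x d)
    then show ?case
      by (simp add: mult_single twist_single plus_fmon_def qchar_def const_times_single algebra_simps)
  qed (simp_all add: twist_add algebra_simps)
qed (simp_all add: twist_add algebra_simps)

lemma single_Nil: "Poly_Mapping.single (Mon []) c = const c"
  by (simp add: const_def zero_fmon_def)

lemma twist_1 [simp]: "twist n i 1 = 1"
  using twist_single[of n i "Mon []" 1] by (simp add: qchar_def single_Nil)

lemma eprime_free_1 [simp]: "eprime_free n i 1 = 0"
  using lin_single[of "\<lambda>w. eprime_word n i (letters w)" "Mon []" 1]
  by (simp add: eprime_free_lin single_Nil)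

text \<open>The skew Leibniz rule: the recursion for one letter on the left extends to all words by
  induction. It reduces the stability of the Serre ideal to its generators.\<close>

lemma eprime_free_mult:
  "eprime_free n i (u * v) = eprime_free n i u * v + twist n i u * eprime_free n i v"
proof (induction u rule: poly_mapping_induct)
  case (1 w c)
  have "eprime_free n i (Poly_Mapping.single (Mon w) 1 * v) =
      eprime_free n i (Poly_Mapping.single (Mon w) 1) * v
      + twist n i (Poly_Mapping.single (Mon w) 1) * eprime_free n i v" for w
  proof (induction w)
    case Nil
    show ?case by (simp add: single_Nil)
  next
    case (Cons j w)
    then show ?case
      by (simp add: single_Cons mult.assoc eprime_free_gen_times twist_gen_times distrib_left distrib_right)
  qed
  moreover have "Poly_Mapping.single w c = const c * Poly_Mapping.single (Mon (letters w)) 1"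
    by (simp add: const_times_single)
  ultimately show ?case
    by (simp only: mult.assoc eprime_free_const_times twist_const_times distrib_left)
qed (simp_all add: eprime_free_add twist_add algebra_simps)

section \<open>q-integers and q-factorials\<close>

lemma Fract_power: "Fract p 1 ^ k = Fract (p ^ k) 1"
  by (induction k) (simp_all add: One_fract_def)

text \<open>\<open>q\<close> is an indeterminate, so its positive powers have positive degree. For
  this reason the q-integers are invertible.\<close>

lemma qq_power_neq_1: "k > 0 \<Longrightarrow> qq ^ k \<noteq> 1"
proof
  assume "k > 0" and "qq ^ k = 1"
  then have "[:0, 1 :: rat:] ^ k = 1"
    by (simp add: qq_def Fract_power One_fract_def eq_fract)
  then have "degree ([:0, 1 :: rat:] ^ k) = 0" by simp
  then show False using \<open>k > 0\<close> by (simp add: degree_power_eq)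
qed

lemma qq_nonzero [simp]: "qq \<noteq> 0"
  by (simp add: qq_def Zero_fract_def eq_fract)

lemma qi_nonzero [simp]: "qi n i \<noteq> 0"
  by (simp add: qi_def)

lemma qi_power_neq_1: "k > 0 \<Longrightarrow> qi n i ^ k \<noteq> 1"
  unfolding qi_def power_mult[symmetric] by (rule qq_power_neq_1) (simp add: half_norm_def)

lemma qi_diff_nonzero: "qi n i - inverse (qi n i) \<noteq> 0"
proof
  assume "qi n i - inverse (qi n i) = 0"
  then have "qi n i ^ 2 = 1" by (simp add: field_simps power2_eq_square)
  then show False using qi_power_neq_1[of 2 n i] by simp
qed

lemma qint_nonzero: "m > 0 \<Longrightarrow> qint n i m \<noteq> 0"
proof -
  assume "m > 0"
  have "qi n i ^ m - inverse (qi n i) ^ m \<noteq> 0"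
  proof
    assume "qi n i ^ m - inverse (qi n i) ^ m = 0"
    then have "qi n i ^ m * qi n i ^ m = 1" by (simp add: field_simps)
    then have "qi n i ^ (m + m) = 1" by (simp add: power_add)
    then show False using qi_power_neq_1[of "m + m" n i] \<open>m > 0\<close> by simp
  qed
  then show ?thesis using qi_diff_nonzero[of n i] by (simp add: qint_def)
qed

lemma qfact_nonzero [simp]: "qfact n i m \<noteq> 0"
  by (auto simp: qfact_def intro!: qint_nonzero)

lemma qfact_Suc: "qfact n i (Suc m) = qfact n i m * qint n i (Suc m)"
  by (simp add: qfact_def)

text \<open>The unsymmetric q-integer \<open>(1 - q_i^(-2m)) / (1 - q_i^(-2))\<close>: the factor
  with which \<open>e_i'\<close> turns \<open>f_i^m\<close> into \<open>f_i^(m-1)\<close>.\<close>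

definition qgeom :: "nat \<Rightarrow> nat \<Rightarrow> nat \<Rightarrow> scal" where
  "qgeom n i m = (\<Sum>l<m. (inverse (qi n i) ^ 2) ^ l)"

lemma qgeom_0 [simp]: "qgeom n i 0 = 0"
  and qgeom_Suc: "qgeom n i (Suc m) = inverse (qi n i) ^ 2 * qgeom n i m + 1"
  unfolding qgeom_def
  by (simp, subst sum.lessThan_Suc_shift, simp add: sum_distrib_left)

lemma qgeom_qint: "qgeom n i (Suc m) = inverse (qi n i) ^ m * qint n i (Suc m)"
proof -
  define a where "a = qi n i"
  have a: "a \<noteq> 0" "a - inverse a \<noteq> 0" using qi_diff_nonzero[of n i] by (simp_all add: a_def)
  \<comment> \<open>The denominator \<open>a - inverse a\<close> is cleared first, so that the
    induction needs only ring identities and \<open>a\<close> nonzero.\<close>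
  have "qgeom n i m * (a - inverse a) = inverse a ^ m * (a ^ m - inverse a ^ m) * a" for m
  proof (induction m)
    case (Suc m)
    have "qgeom n i (Suc m) * (a - inverse a) = inverse a ^ 2 * (qgeom n i m * (a - inverse a)) + (a - inverse a)"
      by (simp add: qgeom_Suc a_def algebra_simps)
    also have "\<dots> = inverse a ^ Suc m * (a ^ Suc m - inverse a ^ Suc m) * a"
      unfolding Suc using a(1) by (simp add: field_simps power2_eq_square)
    finally show ?case .
  qed simp
  from this[of "Suc m"] have "qgeom n i (Suc m) * (a - inverse a) = inverse a ^ m * (a ^ Suc m - inverse a ^ Suc m)"
    using a(1) by (simp add: mult.commute)
  then have "qgeom n i (Suc m) = inverse a ^ m * (a ^ Suc m - inverse a ^ Suc m) / (a - inverse a)"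
    using a(2) by (simp only: nonzero_eq_divide_eq[OF a(2)])
  then show ?thesis
    by (simp add: qint_def a_def)
qed

lemma qgeom_nonzero: "m > 0 \<Longrightarrow> qgeom n i m \<noteq> 0"
  by (cases m) (auto simp: qgeom_qint qint_nonzero)

text \<open>Iterates \<open>e_i' f_i = q_i^(-2) f_i e_i' + 1\<close>.\<close>

lemma eprime_free_pow_times:
  "eprime_free n i (gen i ^ m * u) =
     const (qgeom n i m) * (gen i ^ (m - 1) * u)
     + const ((inverse (qi n i) ^ 2) ^ m) * (gen i ^ m * eprime_free n i u)"
proof (induction m)
  case (Suc m)
  have c: "qi n i powi (- cartan n i i) = inverse (qi n i) ^ 2"
    by (simp add: cartan_def power_int_minus power_inverse)
  \<comment> \<open>For \<open>m = 0\<close> the exponent \<open>m - 1\<close> is truncated, but its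
    coefficient \<open>qgeom n i 0\<close> is 0.\<close>
  have *: "const (qgeom n i m) * (gen i * (gen i ^ (m - 1) * u)) = const (qgeom n i m) * (gen i ^ m * u)"
    by (cases m) (simp_all add: mult.assoc)
  have "eprime_free n i (gen i ^ Suc m * u) = eprime_free n i (gen i * (gen i ^ m * u))"
    by (simp add: mult.assoc)
  also have "\<dots> = const (inverse (qi n i) ^ 2) * (gen i * eprime_free n i (gen i ^ m * u)) + gen i ^ m * u"
    by (simp add: eprime_free_gen_times c mult.assoc)
  also have "\<dots> = const (inverse (qi n i) ^ 2) * (const (qgeom n i m) * (gen i ^ m * u)) + gen i ^ m * u
     + const (inverse (qi n i) ^ 2) * (const ((inverse (qi n i) ^ 2) ^ m) * (gen i ^ Suc m * eprime_free n i u))"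
    unfolding Suc.IH distrib_left gen_const_times * by (simp add: mult.assoc)
  finally show ?case
    by (simp add: qgeom_Suc const_add const_const_times distrib_right)
qed simp

lemma eprime_free_pow_times_other:
  assumes "i \<noteq> k"
  shows "eprime_free n k (gen i ^ m * u) = const ((qi n k powi (- cartan n k i)) ^ m) * (gen i ^ m * eprime_free n k u)"
proof (induction m)
  case (Suc m)
  then show ?case using assms
    by (simp add: mult.assoc eprime_free_gen_times gen_const_times const_const_times)
qed simp

lemma eprime_free_pow: "eprime_free n i (gen i ^ m) = const (qgeom n i m) * gen i ^ (m - 1)"
  using eprime_free_pow_times[of n i m 1] by simp

lemma eprime_free_pow_other: "i \<noteq> k \<Longrightarrow> eprime_free n k (gen i ^ m) = 0"
  using eprime_free_pow_times_other[of i k n m 1] by simp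

lemma twist_gen_pow: "twist n k (gen i ^ m * u) = const ((qi n k powi (- cartan n k i)) ^ m) * (gen i ^ m * twist n k u)"
  by (induction m) (simp_all add: mult.assoc twist_gen_times gen_const_times const_const_times)

section \<open>The Serre elements are killed by all \<open>e_k'\<close>\<close>

lemma const_minus_one_power: "(- 1) ^ m = const ((- 1) ^ m)"
  by (induction m) (simp_all add: const_uminus)

text \<open>Up to the factor \<open>[b]!\<close> this is the signed q-binomial coefficient
  \<open>(-1)^m [b choose m]\<close>; \<open>b\<close> stands for \<open>1 - a_ij\<close>.\<close>

definition serre_coeff :: "nat \<Rightarrow> nat \<Rightarrow> nat \<Rightarrow> nat \<Rightarrow> scal" where
  "serre_coeff n i b m = (- 1) ^ m / (qfact n i m * qfact n i (b - m))"

lemma serre_alt: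
  "serre n i j = (\<Sum>m\<le>nat (1 - cartan n i j). const (serre_coeff n i (nat (1 - cartan n i j)) m)
      * (gen i ^ m * (gen j * gen i ^ (nat (1 - cartan n i j) - m))))"
  unfolding serre_def atLeast0AtMost[symmetric]
proof (rule sum.cong[OF refl])
  fix m
  let ?r = "nat (1 - cartan n i j) - m"
  have "(- 1) ^ m * divpow n i m * gen j * divpow n i ?r
      = const ((- 1) ^ m) * (const (inverse (qfact n i m)) * (gen i ^ m * (gen j * (const (inverse (qfact n i ?r)) * gen i ^ ?r))))"
    by (simp only: divpow_def const_minus_one_power mult.assoc)
  also have "\<dots> = const ((- 1) ^ m * (inverse (qfact n i m) * inverse (qfact n i ?r))) * (gen i ^ m * (gen j * gen i ^ ?r))"
    by (simp only: gen_const_times const_left_commute[of "gen i ^ m"] const_const_times)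
  finally show "(- 1) ^ m * divpow n i m * gen j * divpow n i ?r = const (serre_coeff n i (nat (1 - cartan n i j)) m)
      * (gen i ^ m * (gen j * gen i ^ ?r))"
    by (simp add: serre_coeff_def field_simps)
qed

text \<open>All terms contain \<open>1 - a_ij\<close> letters \<open>i\<close> and one letter
  \<open>j\<close>, and the automorphism is a scalar on words of given content.\<close>

lemma twist_serre:
  "twist n k (serre n i j) = const ((qi n k powi (- cartan n k i)) ^ nat (1 - cartan n i j) * qi n k powi (- cartan n k j)) * serre n i j"
  unfolding serre_alt twist_sum sum_distrib_left
proof (rule sum.cong[OF refl])
  fix m assume "m \<in> {..nat (1 - cartan n i j)}"
  then obtain r where r: "nat (1 - cartan n i j) = m + r" using le_Suc_ex by auto
  show "twist n k (const (serre_coeff n i (nat (1 - cartan n i j)) m) * (gen i ^ m * (gen j * gen i ^ (nat (1 - cartan n i j) - m)))) =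
     const ((qi n k powi (- cartan n k i)) ^ nat (1 - cartan n i j) * qi n k powi (- cartan n k j)) *
     (const (serre_coeff n i (nat (1 - cartan n i j)) m) * (gen i ^ m * (gen j * gen i ^ (nat (1 - cartan n i j) - m))))"
    using twist_gen_pow[of n k i r 1]
    by (simp add: r twist_const_times twist_gen_pow twist_gen_times mult.assoc const_const_times gen_const_times
        const_left_commute[of "gen i ^ m"] power_add ac_simps)
qed

text \<open>In \<open>e_i'\<close> of a Serre element the word \<open>f_i^m f_j f_i^(b-m-1)\<close>
  arises twice: from the left power in term \<open>m + 1\<close>, and from the right power in term
  \<open>m\<close>, after \<open>e_i'\<close> has passed \<open>f_i^m f_j\<close>. With
  \<open>b - 1 = - a_ij\<close> the two coefficients cancel.\<close>

lemma serre_coeff_Suc: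
  assumes "m < b"
  shows "serre_coeff n i b (Suc m) * qgeom n i (Suc m)
       + serre_coeff n i b m * (inverse (qi n i) ^ 2) ^ m * qi n i ^ (b - 1) * qgeom n i (b - m) = 0"
proof -
  obtain r where r: "b = Suc (m + r)" using assms less_iff_Suc_add by auto
  show ?thesis
    using qint_nonzero[of "Suc m" n i] qint_nonzero[of "Suc r" n i]
    by (simp add: r serre_coeff_def qfact_Suc qgeom_qint Suc_diff_le field_simps power_add power2_eq_square
        flip: power_mult_distrib)
qed

text \<open>A case of the q-binomial theorem; the sum is the coefficient of \<open>f_i^b\<close> in
  \<open>e_j'\<close> of a Serre element. As \<open>b = 1 - a_ij\<close> is at most 3, the three
  cases are computed directly.\<close>

lemma qbinomial_alternating:
  assumes "b \<in> {1, 2, 3}"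
  shows "(\<Sum>m\<le>b. serre_coeff n i b m * (qi n i ^ (b - 1)) ^ m) = 0"
proof -
  define a where "a = qi n i"
  have a: "a \<noteq> 0" "a - inverse a \<noteq> 0" using qi_diff_nonzero[of n i] by (simp_all add: a_def)
  have f: "qfact n i 0 = 1" "qfact n i 1 = 1" "qfact n i 2 = qint n i 2" "qfact n i 3 = qint n i 2 * qint n i 3"
    using a by (simp_all add: qfact_def qint_def a_def[symmetric] eval_nat_numeral)
  have q2: "qint n i 2 = a + inverse a" using a
    by (simp add: qint_def a_def[symmetric] field_simps power2_eq_square)
  have q3: "qint n i 3 = a ^ 2 + 1 + inverse a ^ 2" using a
    by (simp add: qint_def a_def[symmetric] field_simps eval_nat_numeral)
  have nz: "qint n i 2 \<noteq> 0" "qint n i 3 \<noteq> 0" by (simp_all add: qint_nonzero)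
  \<comment> \<open>The numerators that occur below, factored so that the q-integers 2 and 3 in the
    denominators cancel.\<close>
  have e2: "1 + a ^ 2 = a * qint n i 2" "(1 - a ^ 6) = (1 - a^2) * a^2 * qint n i 3"
    unfolding q2 q3 using a by (simp_all add: field_simps eval_nat_numeral)
  consider "b = 1" | "b = 2" | "b = 3" using assms by auto
  then show ?thesis
  proof cases
    case 1
    then show ?thesis using f by (simp add: serre_coeff_def)
  next
    case 2
    have "(\<Sum>m\<le>b. serre_coeff n i b m * (qi n i ^ (b - 1)) ^ m) = (1 + a^2) / qint n i 2 - a"
      using f nz unfolding 2 by (simp add: serre_coeff_def eval_nat_numeral a_def field_simps)
    then show ?thesis using e2 nz by simp
  next
    case 3
    have "(\<Sum>m\<le>b. serre_coeff n i b m * (qi n i ^ (b - 1)) ^ m) 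
       = (1 - a^6) / (qint n i 2 * qint n i 3) - (1 - a^2) * a^2 / qint n i 2"
      using f nz unfolding 3 by (simp add: serre_coeff_def eval_nat_numeral a_def field_simps)
    then show ?thesis using e2 nz by simp
  qed
qed

lemma cartan_cases: "i \<noteq> j \<Longrightarrow> cartan n i j \<in> {0, -1, -2}"
  by (simp add: cartan_def)

lemma cartan_symmetrizable:
  assumes "n \<ge> 3" "i \<in> {1..n}" "j \<in> {1..n}"
  shows "int (half_norm n i) * cartan n i j = int (half_norm n j) * cartan n j i"
  using assms by (auto simp: half_norm_def cartan_def)

text \<open>The form \<open>(alpha_i, alpha_j)\<close> is symmetric. Thus \<open>e_j'\<close>, which
  produces powers of \<open>q_j\<close>, can be evaluated on a Serre element written in
  \<open>q_i\<close>.\<close>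

lemma qi_powi_symmetric:
  assumes "n \<ge> 3" "i \<in> {1..n}" "j \<in> {1..n}"
  shows "qi n i powi (- cartan n i j) = qi n j powi (- cartan n j i)"
proof -
  have "qi n i powi a = qq powi (int (half_norm n i) * a)" for i a
    by (simp add: qi_def power_int_mult)
  then show ?thesis using cartan_symmetrizable[OF assms] by simp
qed

text \<open>An index \<open>k\<close> other than \<open>i\<close> and \<open>j\<close> kills every
  term, \<open>k = i\<close> cancels neighbouring terms in pairs, and \<open>k = j\<close> collects
  an alternating q-binomial sum in front of \<open>f_i^b\<close>.\<close>

lemma eprime_free_serre:
  assumes "n \<ge> 3" "i \<in> {1..n}" "j \<in> {1..n}" "i \<noteq> j"
  shows "eprime_free n k (serre n i j) = 0"
proof -
  define b where "b = nat (1 - cartan n i j)"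
  have b: "b \<in> {1, 2, 3}" using cartan_cases[OF assms(4), of n] by (auto simp: b_def)
  have cb: "- cartan n i j = int (b - 1)" using cartan_cases[OF assms(4), of n] by (auto simp: b_def)
  note s = serre_alt[of n i j, folded b_def]
  have e: "eprime_free n k (serre n i j)
     = (\<Sum>m\<le>b. const (serre_coeff n i b m) * eprime_free n k (gen i ^ m * (gen j * gen i ^ (b - m))))"
    unfolding s by (simp add: eprime_free_sum eprime_free_const_times)
  consider "k = i" | "k = j" | "k \<noteq> i" "k \<noteq> j" by auto
  then show ?thesis
  proof cases
    case 1
    have c: "qi n i powi (- cartan n i j) = qi n i ^ (b - 1)" by (simp add: cb)
    define A where "A m = const (serre_coeff n i b m * qgeom n i m) * (gen i ^ (m - 1) * (gen j * gen i ^ (b - m)))" for m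
    define B where "B m = const (serre_coeff n i b m * (inverse (qi n i) ^ 2) ^ m * qi n i ^ (b - 1) * qgeom n i (b - m))
       * (gen i ^ m * (gen j * gen i ^ (b - m - 1)))" for m
    have "eprime_free n k (serre n i j) = (\<Sum>m\<le>b. A m + B m)"
      unfolding e[unfolded 1] 1 A_def B_def
      using assms(4)
      by (intro sum.cong refl)
        (simp add: eprime_free_pow_times eprime_free_gen_times eprime_free_pow c distrib_left gen_const_times
          const_left_commute[of "gen i ^ _"] const_const_times mult.assoc)
    also have "\<dots> = (\<Sum>m\<le>b. A m) + (\<Sum>m\<le>b. B m)" by (rule sum.distrib)
    \<comment> \<open>The shift aligns the two sources of one word. The terms \<open>A 0\<close> and
      \<open>B b\<close>, which drop out here and in the next step, contain
      \<open>qgeom n i 0 = 0\<close>.\<close>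
    also have "(\<Sum>m\<le>b. A m) = (\<Sum>m<b. A (Suc m))"
      unfolding lessThan_Suc_atMost[symmetric] sum.lessThan_Suc_shift by (simp add: A_def)
    also have "(\<Sum>m\<le>b. B m) = (\<Sum>m<b. B m)"
      unfolding lessThan_Suc_atMost[symmetric] by (simp add: B_def)
    also have "(\<Sum>m<b. A (Suc m)) + (\<Sum>m<b. B m) = (\<Sum>m<b. A (Suc m) + B m)"
      by (rule sum.distrib[symmetric])
    also have "\<dots> = 0"
    proof (intro sum.neutral ballI)
      fix m assume "m \<in> {..<b}"
      then have "A (Suc m) + B m = const (serre_coeff n i b (Suc m) * qgeom n i (Suc m)
       + serre_coeff n i b m * (inverse (qi n i) ^ 2) ^ m * qi n i ^ (b - 1) * qgeom n i (b - m))
        * (gen i ^ m * (gen j * gen i ^ (b - m - 1)))"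
        by (simp add: A_def B_def const_add distrib_right)
      also have "\<dots> = 0" using serre_coeff_Suc[of m b n i] \<open>m \<in> {..<b}\<close> by simp
      finally show "A (Suc m) + B m = 0" .
    qed
    finally show ?thesis .
  next
    case 2
    have c: "qi n j powi (- cartan n j i) = qi n i ^ (b - 1)"
      using qi_powi_symmetric[OF assms(1-3)] by (simp add: cb)
    have "eprime_free n k (serre n i j)
      = (\<Sum>m\<le>b. const (serre_coeff n i b m * (qi n i ^ (b - 1)) ^ m) * gen i ^ b)"
      unfolding e[unfolded 2] 2 using assms(4)
      by (intro sum.cong refl)
        (simp add: eprime_free_pow_times_other eprime_free_gen_times eprime_free_pow_other c
         const_const_times flip: power_add)
    also have "\<dots> = const (\<Sum>m\<le>b. serre_coeff n i b m * (qi n i ^ (b - 1)) ^ m) * gen i ^ b"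
      by (simp only: const_sum sum_distrib_right)
    finally show ?thesis using qbinomial_alternating[OF b] by simp
  next
    case 3
    then show ?thesis unfolding e
      by (simp add: eprime_free_pow_times_other eprime_free_gen_times eprime_free_pow_other)
  qed
qed

section \<open>The quotient by the Serre relations\<close>

lemma carrier_free_ring: "u \<in> carrier (free_ring n) \<longleftrightarrow> (\<forall>w\<in>Poly_Mapping.keys u. set (letters w) \<subseteq> {1..n})"
  and free_ring_simps [simp]: "mult (free_ring n) = (*)" "one (free_ring n) = 1"
    "zero (free_ring n) = 0" "add (free_ring n) = (+)"
  by (simp_all add: free_ring_def)

lemma free_carrier_0 [simp]: "0 \<in> carrier (free_ring n)"
  and free_carrier_1 [simp]: "1 \<in> carrier (free_ring n)"
  by (simp_all add: carrier_free_ring zero_fmon_def)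

lemma free_carrier_add [simp]:
  "u \<in> carrier (free_ring n) \<Longrightarrow> v \<in> carrier (free_ring n) \<Longrightarrow> u + v \<in> carrier (free_ring n)"
  using keys_add[of u v] by (auto simp: carrier_free_ring)

lemma free_carrier_mult [simp]:
  "u \<in> carrier (free_ring n) \<Longrightarrow> v \<in> carrier (free_ring n) \<Longrightarrow> u * v \<in> carrier (free_ring n)"
  using keys_mult[of u v] by (fastforce simp: carrier_free_ring plus_fmon_def)

lemma free_carrier_const [simp]: "const c \<in> carrier (free_ring n)"
  by (simp add: carrier_free_ring const_def zero_fmon_def)

lemma free_carrier_gen [simp]: "i \<in> {1..n} \<Longrightarrow> gen i \<in> carrier (free_ring n)"
  by (simp add: carrier_free_ring gen_def)

lemma free_carrier_uminus [simp]: "u \<in> carrier (free_ring n) \<Longrightarrow> - u \<in> carrier (free_ring n)"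
  using free_carrier_mult[OF free_carrier_const[of "-1"], of u n] by (simp del: free_carrier_mult add: const_uminus)

lemma free_carrier_diff [simp]:
  "u \<in> carrier (free_ring n) \<Longrightarrow> v \<in> carrier (free_ring n) \<Longrightarrow> u - v \<in> carrier (free_ring n)"
  using free_carrier_add[of u n "- v"] by simp

lemma free_carrier_pow [simp]: "u \<in> carrier (free_ring n) \<Longrightarrow> u ^ m \<in> carrier (free_ring n)"
  by (induction m) auto

lemma free_carrier_sum [intro]: "(\<And>x. x \<in> A \<Longrightarrow> f x \<in> carrier (free_ring n)) \<Longrightarrow> (\<Sum>x\<in>A. f x) \<in> carrier (free_ring n)"
  by (induction A rule: infinite_finite_induct) auto

lemma free_carrier_divpow [simp]: "i \<in> {1..n} \<Longrightarrow> divpow n i m \<in> carrier (free_ring n)"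
  by (simp add: divpow_def)

lemma free_carrier_single: "set (letters w) \<subseteq> {1..n} \<Longrightarrow> Poly_Mapping.single w c \<in> carrier (free_ring n)"
  by (simp add: carrier_free_ring)

lemma free_carrier_lin:
  assumes "u \<in> carrier (free_ring n)" "\<And>w. set (letters w) \<subseteq> {1..n} \<Longrightarrow> g w \<in> carrier (free_ring n)"
  shows "lin g u \<in> carrier (free_ring n)"
  unfolding lin_def using assms by (intro free_carrier_sum free_carrier_mult) (auto simp: carrier_free_ring[of u])

lemma free_carrier_eprime [simp]:
  assumes "u \<in> carrier (free_ring n)"
  shows "eprime_free n i u \<in> carrier (free_ring n)"
proof -
  have "set w \<subseteq> {1..n} \<Longrightarrow> eprime_word n i w \<in> carrier (free_ring n)" for w
    by (induction w) (auto intro!: free_carrier_add free_carrier_mult free_carrier_single)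
  with assms show ?thesis unfolding eprime_free_lin by (intro free_carrier_lin) auto
qed

lemma free_carrier_twist [simp]: "u \<in> carrier (free_ring n) \<Longrightarrow> twist n i u \<in> carrier (free_ring n)"
  unfolding twist_def
  by (intro free_carrier_lin free_carrier_mult free_carrier_const free_carrier_single)

lemma free_carrier_serre: "i \<in> {1..n} \<Longrightarrow> j \<in> {1..n} \<Longrightarrow> serre n i j \<in> carrier (free_ring n)"
  unfolding serre_alt by (intro free_carrier_sum free_carrier_mult free_carrier_pow) auto

lemma ring_free: "ring (free_ring n)"
proof (intro ringI abelian_groupI monoidI)
  fix x assume "x \<in> carrier (free_ring n)"
  then show "\<exists>y\<in>carrier (free_ring n). y \<oplus>\<^bsub>free_ring n\<^esub> x = \<zero>\<^bsub>free_ring n\<^esub>"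
    by (intro bexI[of _ "- x"]) auto
qed (auto simp: algebra_simps)

lemma a_inv_free: "x \<in> carrier (free_ring n) \<Longrightarrow> \<ominus>\<^bsub>free_ring n\<^esub> x = - x"
proof -
  interpret ring "free_ring n" by (rule ring_free)
  assume x: "x \<in> carrier (free_ring n)"
  show ?thesis using minus_equality[of "- x" x] x by simp
qed

lemma a_minus_free: "x \<in> carrier (free_ring n) \<Longrightarrow> y \<in> carrier (free_ring n) \<Longrightarrow> x \<ominus>\<^bsub>free_ring n\<^esub> y = x - y"
  by (simp add: a_minus_def a_inv_free)

text \<open>Additive inverses come from multiplication by the scalar -1.\<close>

lemma ideal_freeI:
  assumes "J \<subseteq> carrier (free_ring n)" "0 \<in> J"
    and "\<And>u v. u \<in> J \<Longrightarrow> v \<in> J \<Longrightarrow> u + v \<in> J"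
    and "\<And>u v. u \<in> J \<Longrightarrow> v \<in> carrier (free_ring n) \<Longrightarrow> v * u \<in> J"
    and "\<And>u v. u \<in> J \<Longrightarrow> v \<in> carrier (free_ring n) \<Longrightarrow> u * v \<in> J"
  shows "ideal J (free_ring n)"
proof (rule idealI[OF ring_free])
  interpret ring "free_ring n" by (rule ring_free)
  show "subgroup J (add_monoid (free_ring n))"
  proof
    fix x assume x: "x \<in> J"
    then have "const (-1) * x \<in> J" using assms(4)[of x "const (-1)"] by simp
    then show "inv\<^bsub>add_monoid (free_ring n)\<^esub> x \<in> J"
      using x assms(1) a_inv_free[of x n] by (auto simp: a_inv_def const_uminus)
  qed (use assms in auto)
qed (use assms in auto)

lemma serre_gens_carrier: "{serre n i j | i j. i \<in> {1..n} \<and> j \<in> {1..n} \<and> i \<noteq> j} \<subseteq> carrier (free_ring n)"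
  using free_carrier_serre by auto

lemma ideal_serre: "ideal (serre_ideal n) (free_ring n)"
  unfolding serre_ideal_def by (rule ring.genideal_ideal[OF ring_free serre_gens_carrier])

lemma serre_mem: "i \<in> {1..n} \<Longrightarrow> j \<in> {1..n} \<Longrightarrow> i \<noteq> j \<Longrightarrow> serre n i j \<in> serre_ideal n"
  unfolding serre_ideal_def using ring.genideal_self[OF ring_free serre_gens_carrier, of n] by auto

lemma serre_ideal_minimal:
  assumes "ideal J (free_ring n)" "\<And>i j. i \<in> {1..n} \<Longrightarrow> j \<in> {1..n} \<Longrightarrow> i \<noteq> j \<Longrightarrow> serre n i j \<in> J"
  shows "serre_ideal n \<subseteq> J"
  unfolding serre_ideal_def by (rule ring.genideal_minimal[OF ring_free assms(1)]) (use assms(2) in auto)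

lemma serre_ideal_carrier: "u \<in> serre_ideal n \<Longrightarrow> u \<in> carrier (free_ring n)"
  by (rule ideal.Icarr[OF ideal_serre])

lemma serre_ideal_0 [simp]: "0 \<in> serre_ideal n"
  using additive_subgroup.zero_closed[OF ideal.axioms(1)[OF ideal_serre]] by simp

lemma serre_ideal_add: "u \<in> serre_ideal n \<Longrightarrow> v \<in> serre_ideal n \<Longrightarrow> u + v \<in> serre_ideal n"
  using additive_subgroup.a_closed[OF ideal.axioms(1)[OF ideal_serre]] by simp

lemma serre_ideal_left: "u \<in> serre_ideal n \<Longrightarrow> v \<in> carrier (free_ring n) \<Longrightarrow> v * u \<in> serre_ideal n"
  using ideal.I_l_closed[OF ideal_serre] by simp

lemma serre_ideal_right: "u \<in> serre_ideal n \<Longrightarrow> v \<in> carrier (free_ring n) \<Longrightarrow> u * v \<in> serre_ideal n"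
  using ideal.I_r_closed[OF ideal_serre] by simp

lemma serre_ideal_const: "u \<in> serre_ideal n \<Longrightarrow> const c * u \<in> serre_ideal n"
  by (simp add: serre_ideal_left)

lemma serre_ideal_uminus: "u \<in> serre_ideal n \<Longrightarrow> - u \<in> serre_ideal n"
  using serre_ideal_const[of u n "-1"] by (simp add: const_uminus)

lemma serre_ideal_diff: "u \<in> serre_ideal n \<Longrightarrow> v \<in> serre_ideal n \<Longrightarrow> u - v \<in> serre_ideal n"
  using serre_ideal_add[of u n "- v"] serre_ideal_uminus by simp

lemma serre_ideal_sum: "(\<And>x. x \<in> A \<Longrightarrow> f x \<in> serre_ideal n) \<Longrightarrow> (\<Sum>x\<in>A. f x) \<in> serre_ideal n"
  by (induction A rule: infinite_finite_induct) (auto intro: serre_ideal_add)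

lemma serre_ideal_const_cancel: "c \<noteq> 0 \<Longrightarrow> const c * u \<in> serre_ideal n \<Longrightarrow> u \<in> serre_ideal n"
  using serre_ideal_const[of "const c * u" n "inverse c"] by (simp add: const_const_times)

lemma eprime_serre_ideal:
  assumes "n \<ge> 3" "u \<in> serre_ideal n"
  shows "eprime_free n k u \<in> serre_ideal n"
proof -
  \<comment> \<open>The Leibniz rule for \<open>e_k'\<close> of a product involves the twist, so
    only with the condition on \<open>twist\<close> is \<open>J\<close> closed under multiplication
    from both sides.\<close>
  define J where "J = {u \<in> serre_ideal n. twist n k u \<in> serre_ideal n \<and> eprime_free n k u \<in> serre_ideal n}"
  have "ideal J (free_ring n)"
  proof (rule ideal_freeI)
    fix u v assume u: "u \<in> J" and v: "v \<in> carrier (free_ring n)"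
    show "v * u \<in> J"
      using u v by (auto simp: J_def twist_mult eprime_free_mult intro!: serre_ideal_add intro: serre_ideal_left)
    show "u * v \<in> J"
      using u v by (auto simp: J_def twist_mult eprime_free_mult intro!: serre_ideal_add intro: serre_ideal_right)
  qed (auto simp: J_def serre_ideal_carrier twist_add eprime_free_add intro: serre_ideal_add)
  moreover have "serre n i j \<in> J" if "i \<in> {1..n}" "j \<in> {1..n}" "i \<noteq> j" for i j
    using that assms(1) unfolding J_def
    by (simp add: serre_mem twist_serre eprime_free_serre serre_ideal_const)
  ultimately have "serre_ideal n \<subseteq> J" by (rule serre_ideal_minimal)
  then show ?thesis using assms(2) by (auto simp: J_def)
qed

section \<open>Computing in the quotient algebra with representatives\<close>

lemma ring_Uminus: "ring (Uminus n)"
  unfolding Uminus_def by (rule ideal.quotient_is_ring[OF ideal_serre])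

lemma cls_eq_iff:
  "u \<in> carrier (free_ring n) \<Longrightarrow> v \<in> carrier (free_ring n) \<Longrightarrow> cls n u = cls n v \<longleftrightarrow> u - v \<in> serre_ideal n"
  unfolding cls_def
  using ring.quotient_eq_iff_same_a_r_cos[OF ring_free ideal_serre, of u n v] by (simp add: a_minus_free)

lemma mem_cls_iff: "u \<in> cls n v \<longleftrightarrow> u - v \<in> serre_ideal n"
  unfolding cls_def a_r_coset_def' by (auto simp: diff_eq_eq) (metis diff_add_cancel)

lemma carrier_Uminus: "carrier (Uminus n) = cls n ` carrier (free_ring n)"
  by (auto simp: Uminus_def FactRing_def A_RCOSETS_defs cls_def a_r_coset_def)

lemma cls_hom: "ring_hom_ring (free_ring n) (Uminus n) (cls n)"
  using ideal.rcos_ring_hom_ring[OF ideal_serre, of n] unfolding Uminus_def cls_def[abs_def] .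

lemma cls_add: "u \<in> carrier (free_ring n) \<Longrightarrow> v \<in> carrier (free_ring n) \<Longrightarrow>
    cls n u \<oplus>\<^bsub>Uminus n\<^esub> cls n v = cls n (u + v)"
  and cls_mult: "u \<in> carrier (free_ring n) \<Longrightarrow> v \<in> carrier (free_ring n) \<Longrightarrow>
    cls n u \<otimes>\<^bsub>Uminus n\<^esub> cls n v = cls n (u * v)"
  and cls_one: "cls n 1 = \<one>\<^bsub>Uminus n\<^esub>"
  and cls_zero: "cls n 0 = \<zero>\<^bsub>Uminus n\<^esub>"
  subgoal using ring_hom_add[OF ring_hom_ring.homh[OF cls_hom], of u n v] by simp
  subgoal using ring_hom_mult[OF ring_hom_ring.homh[OF cls_hom], of u n v] by simp
  subgoal using ring_hom_one[OF ring_hom_ring.homh[OF cls_hom], of n] by simp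
  subgoal using ring.a_rcos_zero[OF ring_free ideal_serre, of 0 n] by (simp add: cls_def Uminus_def FactRing_def)
  done

lemma cls_carrier [simp]: "u \<in> carrier (free_ring n) \<Longrightarrow> cls n u \<in> carrier (Uminus n)"
  by (simp add: carrier_Uminus)

lemma cls_eq_zero_iff: "u \<in> carrier (free_ring n) \<Longrightarrow> cls n u = \<zero>\<^bsub>Uminus n\<^esub> \<longleftrightarrow> u \<in> serre_ideal n"
  unfolding cls_zero[symmetric] by (simp add: cls_eq_iff)

lemma cls_finsum:
  assumes "finite A" "\<And>x. x \<in> A \<Longrightarrow> f x \<in> carrier (free_ring n)"
  shows "(\<Oplus>\<^bsub>Uminus n\<^esub>x\<in>A. cls n (f x)) = cls n (\<Sum>x\<in>A. f x)"
  using assms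
proof (induction A rule: finite_induct)
  interpret U: ring "Uminus n" by (rule ring_Uminus)
  case empty
  then show ?case by (simp add: cls_zero)
next
  interpret U: ring "Uminus n" by (rule ring_Uminus)
  case (insert x F)
  then show ?case by (subst U.finsum_insert) (auto simp: cls_add free_carrier_sum)
qed

text \<open>All representatives give the same class, so the union in the definition of
  \<open>eprime\<close> is a single coset.\<close>

lemma eprime_cls:
  assumes "n \<ge> 3" "u \<in> carrier (free_ring n)"
  shows "eprime n i (cls n u) = cls n (eprime_free n i u)"
proof -
  have "cls n (eprime_free n i v) = cls n (eprime_free n i u)" if "v \<in> cls n u" for v
  proof -
    have v: "v - u \<in> serre_ideal n" using that by (simp add: mem_cls_iff)
    then have "v - u \<in> carrier (free_ring n)" by (rule serre_ideal_carrier)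
    from free_carrier_add[OF this assms(2)] have "v \<in> carrier (free_ring n)" by simp
    then show ?thesis
      using assms v eprime_serre_ideal[OF assms(1) v, of i] by (simp add: cls_eq_iff eprime_free_diff)
  qed
  moreover have "u \<in> cls n u" by (simp add: mem_cls_iff)
  ultimately show ?thesis unfolding eprime_def by blast
qed

section \<open>String decompositions and the image of the Kashiwara embedding\<close>

text \<open>\<open>e_i'\<close> turns a word into a combination of words with one letter
  fewer.\<close>

lemma nilpotent_eprime:
  obtains N where "(eprime_free n i ^^ N) u = 0"
proof -
  \<comment> \<open>\<open>D N\<close> is spanned by the words of length less than \<open>N\<close>;
    in particular \<open>D 0\<close> contains only 0.\<close>
  define D where "D N = {u :: falg. \<forall>w\<in>Poly_Mapping.keys u. length (letters w) < N}" for N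
  have D_add: "u + v \<in> D N" if "u \<in> D N" "v \<in> D N" for u v N
    using that keys_add[of u v] unfolding D_def by blast
  have D_0: "0 \<in> D N" for N by (simp add: D_def)
  have D_mono: "u \<in> D N'" if "u \<in> D N" "N \<le> N'" for u N N'
    using that by (fastforce simp: D_def)
  have D_gen: "gen j * u \<in> D (Suc N)" if "u \<in> D N" for j u N
    using that keys_mult[of "gen j" u] by (fastforce simp: D_def gen_def plus_fmon_def)
  have D_const: "const c * u \<in> D N" if "u \<in> D N" for c u N
    using that keys_mult[of "const c" u] by (cases "c = 0") (fastforce simp: D_def const_def plus_fmon_def zero_fmon_def)+
  have D_sum: "(\<Sum>x\<in>A. f x) \<in> D N" if "\<And>x. x \<in> A \<Longrightarrow> f x \<in> D N" for A :: "fmon set" and f and N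
    using that by (induction A rule: infinite_finite_induct) (auto simp: D_0 D_add)
  have word: "eprime_word n i w \<in> D (length w)" for w
  proof (induction w)
    case (Cons j w)
    then show ?case
      by (auto simp: mult.assoc intro!: D_add D_const D_gen D_0) (simp add: D_def)
  qed (simp add: D_0)
  have step: "eprime_free n i u \<in> D N" if "u \<in> D (Suc N)" for u N
    unfolding eprime_free_def
    using that by (intro D_sum D_const D_mono[OF word]) (auto simp: D_def)
  have "(eprime_free n i ^^ N) u = 0" if "u \<in> D N" for N u
    using that
  proof (induction N arbitrary: u)
    case 0
    then have "Poly_Mapping.keys u = {}" by (auto simp: D_def)
    then show ?case by simp
  next
    case (Suc N)
    then show ?case by (simp add: funpow_Suc_right step del: funpow.simps)
  qed
  moreover have "u \<in> D (Suc (Max ((length \<circ> letters) ` Poly_Mapping.keys u)))"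
    by (auto simp: D_def less_Suc_eq_le)
  ultimately show ?thesis using that by blast
qed

section \<open>Powers of \<open>e_i'\<close>; existence and uniqueness of string
  decompositions\<close>

lemma eprime_pow_add: "(eprime_free n i ^^ k) (u + v) = (eprime_free n i ^^ k) u + (eprime_free n i ^^ k) v"
  and eprime_pow_const_times: "(eprime_free n i ^^ k) (const c * u) = const c * (eprime_free n i ^^ k) u"
  and eprime_pow_0 [simp]: "(eprime_free n i ^^ k) 0 = 0"
  by (induction k) (simp_all add: eprime_free_add eprime_free_const_times)

lemma eprime_pow_diff: "(eprime_free n i ^^ k) (u - v) = (eprime_free n i ^^ k) u - (eprime_free n i ^^ k) v"
  by (induction k) (simp_all add: eprime_free_diff)

lemma eprime_pow_sum: "(eprime_free n i ^^ k) (\<Sum>x\<in>A. f x) = (\<Sum>x\<in>A. (eprime_free n i ^^ k) (f x))"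
  by (induction A rule: infinite_finite_induct) (simp_all add: eprime_pow_add)

lemma eprime_pow_carrier: "u \<in> carrier (free_ring n) \<Longrightarrow> (eprime_free n i ^^ k) u \<in> carrier (free_ring n)"
  by (induction k) simp_all

lemma eprime_pow_serre_ideal: "n \<ge> 3 \<Longrightarrow> u \<in> serre_ideal n \<Longrightarrow> (eprime_free n i ^^ k) u \<in> serre_ideal n"
  by (induction k) (simp_all add: eprime_serre_ideal)

text \<open>A q-analogue of the falling factorial: the coefficient of \<open>f_i^(m-k) y\<close> in
  \<open>e_i'^k (f_i^m y)\<close> when \<open>e_i' y = 0\<close>.\<close>

definition qfall :: "nat \<Rightarrow> nat \<Rightarrow> nat \<Rightarrow> nat \<Rightarrow> scal" where
  "qfall n i m k = (\<Prod>l<k. qgeom n i (m - l))"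

lemma qfall_less: "m < k \<Longrightarrow> qfall n i m k = 0"
  unfolding qfall_def by (rule prod_zero) (auto intro!: bexI[of _ m])

lemma qfall_self: "qfall n i m m \<noteq> 0"
  by (auto simp: qfall_def qgeom_nonzero)

lemma qfall_Suc: "qfall n i m (Suc k) = qfall n i m k * qgeom n i (m - k)"
  by (simp add: qfall_def)

lemma eprime_pow_string:
  assumes "eprime_free n i y = 0"
  shows "(eprime_free n i ^^ k) (gen i ^ m * y) = const (qfall n i m k) * (gen i ^ (m - k) * y)"
proof (induction k)
  case (Suc k)
  then show ?case
    using assms by (simp add: eprime_free_const_times eprime_free_pow_times const_const_times qfall_Suc)
qed (simp add: qfall_def)

text \<open>A representative of a kernel element of the quotient is killed by \<open>e_i'\<close>
  only modulo the Serre ideal, so uniqueness requires this weaker form.\<close>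

lemma eprime_pow_string_mod:
  assumes "n \<ge> 3" "i \<in> {1..n}" "eprime_free n i y \<in> serre_ideal n"
  shows "(eprime_free n i ^^ k) (gen i ^ m * y) - const (qfall n i m k) * (gen i ^ (m - k) * y) \<in> serre_ideal n"
proof (induction k)
  case (Suc k)
  let ?E = "eprime_free n i"
  have "?E ((?E ^^ k) (gen i ^ m * y) - const (qfall n i m k) * (gen i ^ (m - k) * y)) \<in> serre_ideal n"
    using eprime_serre_ideal[OF assms(1) Suc] .
  moreover have "const (qfall n i m k) * (?E (gen i ^ (m - k) * y) - const (qgeom n i (m - k)) * (gen i ^ (m - k - 1) * y)) \<in> serre_ideal n"
    using assms by (simp add: eprime_free_pow_times serre_ideal_const serre_ideal_left)
  ultimately have "?E ((?E ^^ k) (gen i ^ m * y) - const (qfall n i m k) * (gen i ^ (m - k) * y))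
     + const (qfall n i m k) * (?E (gen i ^ (m - k) * y) - const (qgeom n i (m - k)) * (gen i ^ (m - k - 1) * y)) \<in> serre_ideal n"
    by (rule serre_ideal_add)
  then show ?case
    by (simp add: eprime_free_diff eprime_free_const_times right_diff_distrib const_const_times qfall_Suc)
qed (simp add: qfall_def)

text \<open>String decompositions by representatives in the free algebra and with an explicit bound
  \<open>N\<close>, so that the sums are ordinary sums; the kernel condition and the equality hold
  modulo the Serre ideal.\<close>

definition strdec :: "nat \<Rightarrow> nat \<Rightarrow> falg \<Rightarrow> nat \<Rightarrow> (nat \<Rightarrow> falg) \<Rightarrow> bool" where
  "strdec n i u N y \<longleftrightarrow> (\<forall>m. y m \<in> carrier (free_ring n) \<and> eprime_free n i (y m) \<in> serre_ideal n) \<and>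
     (\<forall>m\<ge>N. y m = 0) \<and> u - (\<Sum>m<N. divpow n i m * y m) \<in> serre_ideal n"

lemma divpow_times: "divpow n i m * y = const (inverse (qfact n i m)) * (gen i ^ m * y)"
  by (simp add: divpow_def mult.assoc)

text \<open>Induction on the nilpotency order. If \<open>e_i'^(N+1) u = 0\<close>, then
  \<open>v = e_i'^N u\<close> is in the kernel, and a multiple of \<open>f_i^N v\<close> can be
  subtracted from \<open>u\<close> so that \<open>e_i'^N\<close> kills the rest. The decomposition
  obtained is exact in the free algebra.\<close>

lemma strdec_exists:
  assumes "i \<in> {1..n}" "u \<in> carrier (free_ring n)"
  obtains N y where "strdec n i u N y"
proof -
  let ?E = "eprime_free n i"
  have "\<exists>y. (\<forall>m. y m \<in> carrier (free_ring n) \<and> ?E (y m) = 0) \<and> (\<forall>m\<ge>N. y m = 0) \<and> u = (\<Sum>m<N. divpow n i m * y m)"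
    if "(?E ^^ N) u = 0" "u \<in> carrier (free_ring n)" for N u
    using that
  proof (induction N arbitrary: u)
    case 0
    then show ?case by (intro exI[of _ "\<lambda>_. 0"]) auto
  next
    case (Suc N)
    define v where "v = (?E ^^ N) u"
    have v: "v \<in> carrier (free_ring n)" "?E v = 0"
      using Suc.prems by (auto simp: v_def eprime_pow_carrier)
    define w where "w = gen i ^ N * v"
    have w: "w \<in> carrier (free_ring n)" using v assms(1) by (simp add: w_def)
    have "(?E ^^ N) w = const (qfall n i N N) * v"
      using eprime_pow_string[OF v(2), of N N] by (simp add: w_def)
    then have "(?E ^^ N) (u - const (inverse (qfall n i N N)) * w) = 0"
      using qfall_self[of n i N]
      by (simp add: eprime_pow_diff eprime_pow_const_times const_const_times flip: v_def)
    then obtain y where y: "\<And>m. y m \<in> carrier (free_ring n)" "\<And>m. ?E (y m) = 0" "\<And>m. m \<ge> N \<Longrightarrow> y m = 0"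
      "u - const (inverse (qfall n i N N)) * w = (\<Sum>m<N. divpow n i m * y m)"
      using Suc.IH[of "u - const (inverse (qfall n i N N)) * w"] Suc.prems w by auto
    \<comment> \<open>The factor \<open>qfact\<close> undoes the divided power in
      \<open>divpow\<close>.\<close>
    define y' where "y' = y(N := const (qfact n i N * inverse (qfall n i N N)) * v)"
    have cc: "inverse (qfact n i N) * (qfact n i N * c) = c" for c
      by (simp add: mult.assoc[symmetric])
    have "divpow n i N * y' N = const (inverse (qfall n i N N)) * w"
      by (simp add: divpow_times y'_def w_def const_left_commute[of "gen i ^ N"] const_const_times cc)
    then have "u = (\<Sum>m<Suc N. divpow n i m * y' m)"
      using y(4) by (simp add: y'_def algebra_simps)
    then show ?case
      using y v by (intro exI[of _ y']) (auto simp: y'_def eprime_free_const_times)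
  qed
  moreover obtain N where "(?E ^^ N) u = 0" by (rule nilpotent_eprime)
  ultimately obtain y where "\<And>m. y m \<in> carrier (free_ring n)" "\<And>m. ?E (y m) = 0" "\<And>m. m \<ge> N \<Longrightarrow> y m = 0"
     "u = (\<Sum>m<N. divpow n i m * y m)" using assms(2) by blast
  then have "strdec n i u N y" by (auto simp: strdec_def)
  then show ?thesis by (rule that)
qed

text \<open>Apply \<open>e_i'^N\<close> to a vanishing sum of \<open>N + 1\<close> strings: the
  lower ones die because \<open>qfall n i m N = 0\<close> for \<open>m < N\<close>, and the top one
  leaves a nonzero multiple of \<open>y N\<close>. Then descend.\<close>

lemma strdec_unique:
  assumes "n \<ge> 3" "i \<in> {1..n}" "strdec n i 0 N y"
  shows "y m \<in> serre_ideal n"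
proof (cases "m < N")
  case False
  then show ?thesis using assms(3) by (auto simp: strdec_def)
next
  case True
  let ?E = "eprime_free n i"
  have y: "\<And>m. y m \<in> carrier (free_ring n)" "\<And>m. ?E (y m) \<in> serre_ideal n"
    and s: "(\<Sum>m<N. divpow n i m * y m) \<in> serre_ideal n"
    using assms(3) serre_ideal_uminus unfolding strdec_def by (force, force, force)
  have "\<forall>m<N. y m \<in> serre_ideal n" using s
  proof (induction N)
    case (Suc N)
    have tm: "(?E ^^ N) (divpow n i m * y m) - const (inverse (qfact n i m) * qfall n i m N) * (gen i ^ (m - N) * y m) \<in> serre_ideal n" for m
      using serre_ideal_const[OF eprime_pow_string_mod[OF assms(1,2) y(2)[of m], of N m], of "inverse (qfact n i m)"]
      by (simp add: divpow_times eprime_pow_const_times right_diff_distrib const_const_times)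
    have "(?E ^^ N) (\<Sum>m<Suc N. divpow n i m * y m) \<in> serre_ideal n"
      by (rule eprime_pow_serre_ideal[OF assms(1) Suc.prems])
    then have 1: "(\<Sum>m<N. (?E ^^ N) (divpow n i m * y m)) + (?E ^^ N) (divpow n i N * y N) \<in> serre_ideal n"
      by (simp add: eprime_pow_add eprime_pow_sum)
    have 2: "(\<Sum>m<N. (?E ^^ N) (divpow n i m * y m)) \<in> serre_ideal n"
    proof (intro serre_ideal_sum)
      fix m assume "m \<in> {..<N}"
      then show "(?E ^^ N) (divpow n i m * y m) \<in> serre_ideal n"
        using tm[of m] by (simp add: qfall_less)
    qed
    from serre_ideal_diff[OF serre_ideal_diff[OF 1 2] tm[of N]]
    have "const (inverse (qfact n i N) * qfall n i N N) * y N \<in> serre_ideal n"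
      by simp
    then have yN: "y N \<in> serre_ideal n"
      by (rule serre_ideal_const_cancel[rotated]) (simp add: qfall_self)
    then have "divpow n i N * y N \<in> serre_ideal n" using assms(2) by (simp add: serre_ideal_left)
    from serre_ideal_diff[OF Suc.prems this] have "(\<Sum>m<N. divpow n i m * y m) \<in> serre_ideal n" by simp
    from Suc.IH[OF this] yN show ?case by (auto simp: less_Suc_eq)
  qed simp
  then show ?thesis using True by simp
qed

text \<open>\<open>string_sum\<close> runs only over indices with nonzero class; the further indices
  on the right contribute elements of the Serre ideal.\<close>

lemma string_sum_cls:
  assumes "i \<in> {1..n}" "\<And>m. y m \<in> carrier (free_ring n)" "\<And>m. m \<ge> N \<Longrightarrow> y m = 0"
  shows "string_sum n i s (\<lambda>m. cls n (y m)) =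
     cls n (\<Sum>m<N. if int m + s \<ge> 0 then divpow n i (nat (int m + s)) * y m else 0)"
proof -
  let ?B = "{m. cls n (y m) \<noteq> \<zero>\<^bsub>Uminus n\<^esub> \<and> int m + s \<ge> 0}"
  let ?g = "\<lambda>m. if int m + s \<ge> 0 then divpow n i (nat (int m + s)) * y m else 0"
  have B: "?B \<subseteq> {..<N}" using assms(3) by (force simp: cls_zero not_less[symmetric])
  then have fB: "finite ?B" by (rule finite_subset) simp
  have g: "?g m \<in> carrier (free_ring n)" for m using assms by auto
  interpret U: ring "Uminus n" by (rule ring_Uminus)
  have "string_sum n i s (\<lambda>m. cls n (y m)) = (\<Oplus>\<^bsub>Uminus n\<^esub>m\<in>?B. cls n (?g m))"
    unfolding string_sum_def using assms g
    by (intro U.finsum_cong') (auto simp: cls_mult)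
  also have "\<dots> = cls n (\<Sum>m\<in>?B. ?g m)" using fB g by (rule cls_finsum)
  also have "\<dots> = cls n (\<Sum>m<N. ?g m)"
  proof -
    have "(\<Sum>m<N. ?g m) = (\<Sum>m\<in>{..<N} - ?B. ?g m) + (\<Sum>m\<in>?B. ?g m)"
      by (rule sum.subset_diff[OF B]) simp
    moreover have "(\<Sum>m\<in>{..<N} - ?B. ?g m) \<in> serre_ideal n"
      using assms by (intro serre_ideal_sum) (auto simp: cls_eq_zero_iff intro!: serre_ideal_left)
    ultimately have "(\<Sum>m<N. ?g m) - (\<Sum>m\<in>?B. ?g m) \<in> serre_ideal n" by simp
    moreover have "(\<Sum>m\<in>A. ?g m) \<in> carrier (free_ring n)" for A
      by (rule free_carrier_sum[OF g])
    ultimately have "cls n (\<Sum>m<N. ?g m) = cls n (\<Sum>m\<in>?B. ?g m)"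
      by (simp only: cls_eq_iff)
    then show ?thesis ..
  qed
  finally show ?thesis .
qed

text \<open>Resolves the definite description in \<open>ftU\<close>: by uniqueness, every
  decomposition yields the same classes, so any one of them computes \<open>f~_i\<close>.\<close>

lemma ftU_strdec:
  assumes "n \<ge> 3" "i \<in> {1..n}" "u \<in> carrier (free_ring n)" "strdec n i u N y"
  shows "ftU n i (cls n u) = cls n (\<Sum>m<N. divpow n i (Suc m) * y m)"
proof -
  have y: "y m \<in> carrier (free_ring n)" "eprime_free n i (y m) \<in> serre_ideal n" for m
    using assms(4) by (auto simp: strdec_def)
  have y0: "m \<ge> N \<Longrightarrow> y m = 0" for m using assms(4) by (auto simp: strdec_def)
  have car: "(\<Sum>m<N. divpow n i (f m) * y m) \<in> carrier (free_ring n)" for f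
    using assms(2) y by (intro free_carrier_sum) auto
  have sum_y: "string_sum n i s (\<lambda>m. cls n (y m)) =
     cls n (\<Sum>m<N. if int m + s \<ge> 0 then divpow n i (nat (int m + s)) * y m else 0)" for s
    using assms(2) y(1) y0 by (rule string_sum_cls)
  have "(THE Y. string_decomp n i (cls n u) Y) = (\<lambda>m. cls n (y m))"
  proof (rule the_equality)
    have "{m. cls n (y m) \<noteq> \<zero>\<^bsub>Uminus n\<^esub>} \<subseteq> {..<N}"
      using y0 by (force simp: cls_zero not_less[symmetric])
    then have "finite {m. cls n (y m) \<noteq> \<zero>\<^bsub>Uminus n\<^esub>}"
      by (rule finite_subset) simp
    moreover have "cls n u = cls n (\<Sum>m<N. divpow n i m * y m)"
      using assms(3,4) car[of "\<lambda>m. m"] by (simp add: cls_eq_iff strdec_def)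
    ultimately show "string_decomp n i (cls n u) (\<lambda>m. cls n (y m))"
      unfolding string_decomp_def sum_y
      using assms(1) y by (simp add: eprime_cls cls_eq_zero_iff)
  next
    fix Y assume Y: "string_decomp n i (cls n u) Y"
    \<comment> \<open>The zero class gets the representative 0, so that the finite support of
      \<open>Y\<close> carries over to \<open>z\<close>.\<close>
    have "\<exists>z\<in>carrier (free_ring n). Y m = cls n z \<and> (Y m = \<zero>\<^bsub>Uminus n\<^esub> \<longrightarrow> z = 0)" for m
      proof (cases "Y m = \<zero>\<^bsub>Uminus n\<^esub>")
      case True
      then show ?thesis by (intro bexI[of _ 0]) (simp_all add: cls_zero)
    next
      case False
      moreover have "Y m \<in> cls n ` carrier (free_ring n)"
        using Y by (simp add: string_decomp_def carrier_Uminus)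
      ultimately show ?thesis by blast
    qed
    then obtain z where z: "\<And>m. z m \<in> carrier (free_ring n)" "\<And>m. Y m = cls n (z m)"
      "\<And>m. Y m = \<zero>\<^bsub>Uminus n\<^esub> \<Longrightarrow> z m = 0" by metis
    have Yeq: "Y = (\<lambda>m. cls n (z m))" using z(2) by auto
    have "finite {m. Y m \<noteq> \<zero>\<^bsub>Uminus n\<^esub>}" using Y by (simp add: string_decomp_def)
    then obtain N' where "{m. Y m \<noteq> \<zero>\<^bsub>Uminus n\<^esub>} \<subseteq> {..<N'}"
      using finite_nat_bounded by blast
    then have N': "m \<ge> N' \<Longrightarrow> z m = 0" for m
      using z(3)[of m] by (auto simp: subset_eq not_less[symmetric])
    have ez: "eprime_free n i (z m) \<in> serre_ideal n" for m
      using Y z(1) assms(1) by (simp add: Yeq string_decomp_def eprime_cls cls_eq_zero_iff)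
    define M where "M = max N N'"
    have "string_sum n i 0 Y = cls n (\<Sum>m<M. if int m + 0 \<ge> 0 then divpow n i (nat (int m + 0)) * z m else 0)"
      unfolding Yeq by (rule string_sum_cls) (use assms(2) z(1) N' in \<open>auto simp: M_def\<close>)
    then have "cls n u = cls n (\<Sum>m<M. divpow n i m * z m)"
      using Y by (simp add: string_decomp_def)
    then have 1: "u - (\<Sum>m<M. divpow n i m * z m) \<in> serre_ideal n"
      using assms(2,3) z(1) by (subst (asm) cls_eq_iff) (auto intro!: free_carrier_sum)
    have "(\<Sum>m<N. divpow n i m * y m) = (\<Sum>m<M. divpow n i m * y m)"
      using y0 by (intro sum.mono_neutral_left) (auto simp: M_def)
    then have 2: "u - (\<Sum>m<M. divpow n i m * y m) \<in> serre_ideal n"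
      using assms(4) by (simp add: strdec_def)
    have "strdec n i 0 M (\<lambda>m. z m - y m)"
      unfolding strdec_def using y z(1) ez serre_ideal_diff[OF 1 2] N' y0
      by (auto simp: eprime_free_diff serre_ideal_diff right_diff_distrib sum_subtractf M_def)
    then have "z m - y m \<in> serre_ideal n" for m
      by (rule strdec_unique[OF assms(1,2)])
    then show "Y = (\<lambda>m. cls n (y m))"
      unfolding Yeq using z(1) y(1) by (intro ext) (simp add: cls_eq_iff)
  qed
  then show ?thesis
    by (simp add: ftU_def sum_y nat_add_distrib)
qed

section \<open>Linearity of \<open>f~_i\<close>\<close>

lemma ftU_carrier:
  assumes "n \<ge> 3" "i \<in> {1..n}" "X \<in> carrier (Uminus n)"
  shows "ftU n i X \<in> carrier (Uminus n)"
proof -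
  obtain u where u: "u \<in> carrier (free_ring n)" "X = cls n u" using assms(3) by (auto simp: carrier_Uminus)
  obtain N y where y: "strdec n i u N y" using strdec_exists[OF assms(2) u(1)] .
  then show ?thesis unfolding u(2) ftU_strdec[OF assms(1,2) u(1) y]
    using assms(2) by (intro cls_carrier free_carrier_sum free_carrier_mult) (auto simp: strdec_def)
qed

lemma ftU_add:
  assumes "n \<ge> 3" "i \<in> {1..n}" "X \<in> carrier (Uminus n)" "X' \<in> carrier (Uminus n)"
  shows "ftU n i (X \<oplus>\<^bsub>Uminus n\<^esub> X') = ftU n i X \<oplus>\<^bsub>Uminus n\<^esub> ftU n i X'"
proof -
  obtain u v where u: "u \<in> carrier (free_ring n)" "X = cls n u" and v: "v \<in> carrier (free_ring n)" "X' = cls n v"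
    using assms(3,4) by (auto simp: carrier_Uminus)
  obtain N y where y: "strdec n i u N y" using strdec_exists[OF assms(2) u(1)] .
  obtain M z where z: "strdec n i v M z" using strdec_exists[OF assms(2) v(1)] .
  define K where "K = max N M"
  \<comment> \<open>Padding by zeros brings both decompositions to the common length
    \<open>K\<close>.\<close>
  have ext: "strdec n i u K y" if "strdec n i u N y" "N \<le> K" for u N y
  proof -
    have "(\<Sum>m<N. divpow n i m * y m) = (\<Sum>m<K. divpow n i m * y m)"
      using that by (intro sum.mono_neutral_left) (auto simp: strdec_def)
    then show ?thesis using that by (auto simp: strdec_def)
  qed
  have y: "strdec n i u K y" and z: "strdec n i v K z" using ext y z by (auto simp: K_def)
  have "(u - (\<Sum>m<K. divpow n i m * y m)) + (v - (\<Sum>m<K. divpow n i m * z m)) \<in> serre_ideal n"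
    using y z by (intro serre_ideal_add) (auto simp: strdec_def)
  then have "strdec n i (u + v) K (\<lambda>m. y m + z m)"
    using y z by (auto simp: strdec_def eprime_free_add serre_ideal_add distrib_left sum.distrib algebra_simps)
  from ftU_strdec[OF assms(1,2) _ this] u v
  have "ftU n i (cls n (u + v)) = cls n ((\<Sum>m<K. divpow n i (Suc m) * y m) + (\<Sum>m<K. divpow n i (Suc m) * z m))"
    by (simp add: distrib_left sum.distrib)
  moreover have "(\<Sum>m<K. divpow n i (Suc m) * y m) \<in> carrier (free_ring n)"
    "(\<Sum>m<K. divpow n i (Suc m) * z m) \<in> carrier (free_ring n)"
    using y z assms(2) by (auto simp: strdec_def intro!: free_carrier_sum)
  ultimately show ?thesis
    using u v by (simp add: cls_add ftU_strdec[OF assms(1,2) _ y] ftU_strdec[OF assms(1,2) _ z])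
qed

lemma smul_cls: "u \<in> carrier (free_ring n) \<Longrightarrow> smul n c (cls n u) = cls n (const c * u)"
  by (simp add: smul_def cls_mult)

lemma smul_carrier: "X \<in> carrier (Uminus n) \<Longrightarrow> smul n c X \<in> carrier (Uminus n)"
  by (auto simp: carrier_Uminus smul_cls)

lemma ftU_smul:
  assumes "n \<ge> 3" "i \<in> {1..n}" "X \<in> carrier (Uminus n)"
  shows "ftU n i (smul n c X) = smul n c (ftU n i X)"
proof -
  obtain u where u: "u \<in> carrier (free_ring n)" "X = cls n u"
    using assms(3) by (auto simp: carrier_Uminus)
  obtain N y where y: "strdec n i u N y" using strdec_exists[OF assms(2) u(1)] .
  have pull: "(\<Sum>m<N. divpow n i (f m) * (const c * y m)) = const c * (\<Sum>m<N. divpow n i (f m) * y m)" for f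
    unfolding sum_distrib_left by (intro sum.cong refl const_left_commute)
  have "const c * (u - (\<Sum>m<N. divpow n i m * y m)) \<in> serre_ideal n"
    using y by (intro serre_ideal_const) (auto simp: strdec_def)
  then have "strdec n i (const c * u) N (\<lambda>m. const c * y m)"
    using y unfolding strdec_def pull
    by (simp add: eprime_free_const_times serre_ideal_const right_diff_distrib)
  from ftU_strdec[OF assms(1,2) _ this, unfolded pull] u
  have "ftU n i (cls n (const c * u)) = cls n (const c * (\<Sum>m<N. divpow n i (Suc m) * y m))"
    by simp
  moreover have "(\<Sum>m<N. divpow n i (Suc m) * y m) \<in> carrier (free_ring n)"
    using y assms(2) by (auto simp: strdec_def intro!: free_carrier_sum)
  ultimately show ?thesis
    using u by (simp add: smul_cls ftU_strdec[OF assms(1,2) _ y])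
qed

section \<open>Regularity at \<open>q = 0\<close> and the counit\<close>

lemma regular_at_0_fract: "Fract a b \<in> regular_at_0" if "poly b 0 \<noteq> 0"
  using that by (auto simp: regular_at_0_def)

lemma regular_at_0_0: "0 \<in> regular_at_0"
  and regular_at_0_1: "1 \<in> regular_at_0"
  and regular_at_0_minus_1: "- 1 \<in> regular_at_0"
  using regular_at_0_fract[of 1 0] regular_at_0_fract[of 1 1] regular_at_0_fract[of 1 "-1"]
  by (simp_all add: Zero_fract_def One_fract_def)

lemma regular_at_0_add_mult:
  assumes "c \<in> regular_at_0" "d \<in> regular_at_0"
  shows "c + d \<in> regular_at_0" "c * d \<in> regular_at_0"
proof -
  obtain a b a' b' where 1: "c = Fract a b" "poly b 0 \<noteq> 0" "d = Fract a' b'" "poly b' 0 \<noteq> 0"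
    using assms by (auto simp: regular_at_0_def)
  then have "b \<noteq> 0" "b' \<noteq> 0" by auto
  then show "c + d \<in> regular_at_0" "c * d \<in> regular_at_0"
    using 1 by (auto intro!: regular_at_0_fract)
qed

text \<open>Evaluation at \<open>q = 0\<close>: the left side vanishes there.\<close>

lemma qq_times_regular_neq_1: "c \<in> regular_at_0 \<Longrightarrow> qq * c \<noteq> 1"
proof
  assume "c \<in> regular_at_0" and *: "qq * c = 1"
  then obtain a b where 1: "c = Fract a b" "poly b 0 \<noteq> 0" by (auto simp: regular_at_0_def)
  then have "b \<noteq> 0" by auto
  with * have "[:0, 1:] * a = b"
    by (simp add: qq_def 1 One_fract_def eq_fract)
  then have "poly b 0 = 0" by (metis mult_zero_left poly_0 poly_mult poly_pCons add_0)
  with 1 show False by simp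
qed

text \<open>The constant term, an algebra homomorphism that kills all generators and hence all Serre
  elements.\<close>

definition counit :: "falg \<Rightarrow> scal" where "counit u = Poly_Mapping.lookup u 0"

lemma counit_simps [simp]: "counit 0 = 0" "counit 1 = 1" "counit (u + v) = counit u + counit v"
  "counit (const c) = c" "counit (gen i) = 0"
  by (simp_all add: counit_def lookup_add const_def gen_def lookup_single)
    (simp add: zero_fmon_def)

lemma counit_diff [simp]: "counit (u - v) = counit u - counit v"
  by (simp add: counit_def lookup_minus)

lemma counit_mult [simp]: "counit (u * v) = counit u * counit v"
proof (induction u rule: poly_mapping_induct)
  case (1 w c)
  show ?case
  proof (induction v rule: poly_mapping_induct)
    case (1 x d)
    show ?case
      by (cases w; cases x) (auto simp: mult_single counit_def lookup_single when_def plus_fmon_def zero_fmon_def)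
  qed (simp_all add: algebra_simps)
qed (simp_all add: algebra_simps)

lemma counit_pow [simp]: "counit (u ^ m) = counit u ^ m"
  by (induction m) simp_all

lemma counit_sum: "counit (\<Sum>x\<in>A. f x) = (\<Sum>x\<in>A. counit (f x))"
  by (induction A rule: infinite_finite_induct) simp_all

lemma counit_serre_ideal: "u \<in> serre_ideal n \<Longrightarrow> counit u = 0"
proof -
  have "ideal {u \<in> carrier (free_ring n). counit u = 0} (free_ring n)"
    by (rule ideal_freeI) auto
  then have "serre_ideal n \<subseteq> {u \<in> carrier (free_ring n). counit u = 0}"
    by (rule serre_ideal_minimal) (auto simp: free_carrier_serre serre_alt counit_sum)
  then show "u \<in> serre_ideal n \<Longrightarrow> counit u = 0" by auto
qed

section \<open>The lattice \<open>L(infinity)\<close> and its quotient by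
  \<open>q L(infinity)\<close>\<close>

lemma ft_monomials_carrier: "n \<ge> 3 \<Longrightarrow> X \<in> ft_monomials n \<Longrightarrow> X \<in> carrier (Uminus n)"
  by (erule ft_monomials.induct) (auto simp: ftU_carrier simp flip: cls_one)

lemma Linf_carrier:
  assumes "n \<ge> 3" "X \<in> Linf n" shows "X \<in> carrier (Uminus n)"
proof -
  interpret U: ring "Uminus n" by (rule ring_Uminus)
  show ?thesis using assms(2)
    by (induction rule: Linf.induct) (auto simp: ft_monomials_carrier[OF assms(1)] smul_carrier)
qed

lemma ftU_zero: "n \<ge> 3 \<Longrightarrow> i \<in> {1..n} \<Longrightarrow> ftU n i \<zero>\<^bsub>Uminus n\<^esub> = \<zero>\<^bsub>Uminus n\<^esub>"
  using ftU_strdec[of n i 0 0 "\<lambda>_. 0"] by (simp add: strdec_def cls_zero)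

lemma ftU_Linf:
  assumes "n \<ge> 3" "i \<in> {1..n}" "X \<in> Linf n"
  shows "ftU n i X \<in> Linf n"
  using assms(3)
proof (induction rule: Linf.induct)
  case (monomial X)
  then show ?case using assms by (intro Linf.monomial ft_monomials.step)
next
  case (add X Y)
  then show ?case using assms(1,2) by (simp add: ftU_add Linf_carrier Linf.add)
next
  case (scale X c)
  then show ?case using assms(1,2) by (simp add: ftU_smul Linf_carrier Linf.scale)
qed (use assms in \<open>simp add: ftU_zero Linf.zero\<close>)

lemma qLinf_carrier: "n \<ge> 3 \<Longrightarrow> X \<in> qLinf n \<Longrightarrow> X \<in> carrier (Uminus n)"
  by (auto simp: qLinf_def intro: smul_carrier Linf_carrier)

lemma ftU_qLinf: "n \<ge> 3 \<Longrightarrow> i \<in> {1..n} \<Longrightarrow> X \<in> qLinf n \<Longrightarrow> ftU n i X \<in> qLinf n"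
  by (auto simp: qLinf_def ftU_smul Linf_carrier intro!: imageI ftU_Linf)

lemma subgroup_qLinf:
  assumes "n \<ge> 3"
  shows "subgroup (qLinf n) (add_monoid (Uminus n))"
proof -
  interpret U: ring "Uminus n" by (rule ring_Uminus)
  show ?thesis
  proof
    show "qLinf n \<subseteq> carrier (add_monoid (Uminus n))" using qLinf_carrier[OF assms] by auto
    show "\<one>\<^bsub>add_monoid (Uminus n)\<^esub> \<in> qLinf n"
      using imageI[OF Linf.zero, of "smul n qq" n] by (simp add: qLinf_def smul_cls flip: cls_zero)
  next
    fix X Y assume "X \<in> qLinf n" "Y \<in> qLinf n"
    then obtain X' Y' where *: "X = smul n qq X'" "X' \<in> Linf n" "Y = smul n qq Y'" "Y' \<in> Linf n"
      by (auto simp: qLinf_def)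
    obtain u v where uv: "u \<in> carrier (free_ring n)" "X' = cls n u" "v \<in> carrier (free_ring n)" "Y' = cls n v"
      using Linf_carrier[OF assms *(2)] Linf_carrier[OF assms *(4)] by (auto simp: carrier_Uminus)
    have "X \<oplus>\<^bsub>Uminus n\<^esub> Y = smul n qq (X' \<oplus>\<^bsub>Uminus n\<^esub> Y')"
      using uv * by (simp add: smul_cls cls_add distrib_left)
    then show "X \<otimes>\<^bsub>add_monoid (Uminus n)\<^esub> Y \<in> qLinf n" 
      using Linf.add[OF *(2,4)] by (auto simp: qLinf_def)
  next
    fix X assume "X \<in> qLinf n"
    then obtain X' where *: "X = smul n qq X'" "X' \<in> Linf n" by (auto simp: qLinf_def)
    obtain u where u: "u \<in> carrier (free_ring n)" "X' = cls n u"
      using Linf_carrier[OF assms *(2)] by (auto simp: carrier_Uminus)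
    have "smul n qq (smul n (-1) X') \<oplus>\<^bsub>Uminus n\<^esub> X = \<zero>\<^bsub>Uminus n\<^esub>"
      using u * by (simp add: smul_cls cls_add const_const_times const_uminus flip: cls_zero)
    moreover have "smul n qq (smul n (-1) X') \<in> carrier (Uminus n)" "X \<in> carrier (Uminus n)"
      using u * by (auto simp: smul_carrier)
    ultimately have "inv\<^bsub>add_monoid (Uminus n)\<^esub> X = smul n qq (smul n (-1) X')"
      using U.minus_equality by (simp add: a_inv_def)
    then show "inv\<^bsub>add_monoid (Uminus n)\<^esub> X \<in> qLinf n"
      using Linf.scale[OF *(2) regular_at_0_minus_1] by (auto simp: qLinf_def)
  qed
qed

lemma Bcls_eq_qLinf_iff:
  assumes "n \<ge> 3" "X \<in> carrier (Uminus n)"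
  shows "Bcls n X = qLinf n \<longleftrightarrow> X \<in> qLinf n"
proof -
  interpret U: ring "Uminus n" by (rule ring_Uminus)
  show ?thesis
    unfolding Bcls_def using U.a_coset_join1 U.a_coset_join2 subgroup_qLinf[OF assms(1)] assms(2)
      subgroup.subset[OF subgroup_qLinf[OF assms(1)]] by auto
qed

text \<open>Another representative differs from \<open>X\<close> by an element of
  \<open>qLinf\<close>, and \<open>f~_i\<close> is additive and preserves
  \<open>qLinf\<close>.\<close>

lemma induced_ftU:
  assumes "n \<ge> 3" "i \<in> {1..n}" "X \<in> carrier (Uminus n)"
  shows "induced n (ftU n i) (Bcls n X) = Bcls n (ftU n i X)"
proof -
  interpret U: ring "Uminus n" by (rule ring_Uminus)
  have sub: "qLinf n \<subseteq> carrier (Uminus n)" using qLinf_carrier[OF assms(1)] by auto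
  have "Bcls n (ftU n i Y) = Bcls n (ftU n i X)" if Y: "Y \<in> Bcls n X" for Y
  proof -
    obtain h where h: "h \<in> qLinf n" "Y = h \<oplus>\<^bsub>Uminus n\<^esub> X"
      using Y unfolding Bcls_def a_r_coset_def' by blast
    have fh: "ftU n i h \<in> qLinf n" using h assms by (simp add: ftU_qLinf)
    have "Bcls n (ftU n i Y) = qLinf n +>\<^bsub>Uminus n\<^esub> (ftU n i h \<oplus>\<^bsub>Uminus n\<^esub> ftU n i X)"
      using assms qLinf_carrier[OF assms(1) h(1)] by (simp add: h(2) Bcls_def ftU_add)
    also have "\<dots> = (qLinf n +>\<^bsub>Uminus n\<^esub> ftU n i h) +>\<^bsub>Uminus n\<^esub> ftU n i X"
      using sub fh assms by (intro U.a_coset_add_assoc[symmetric]) (auto simp: ftU_carrier)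
    also have "qLinf n +>\<^bsub>Uminus n\<^esub> ftU n i h = qLinf n"
      using fh sub subgroup_qLinf[OF assms(1)] by (intro U.a_coset_join2) auto
    finally show ?thesis by (simp add: Bcls_def)
  qed
  moreover have "X \<in> Bcls n X"
  proof -
    have "\<zero>\<^bsub>Uminus n\<^esub> \<in> qLinf n"
      using subgroup.one_closed[OF subgroup_qLinf[OF assms(1)]] by simp
    moreover have "X = \<zero>\<^bsub>Uminus n\<^esub> \<oplus>\<^bsub>Uminus n\<^esub> X" using assms(3) by simp
    ultimately show ?thesis unfolding Bcls_def a_r_coset_def' by blast
  qed
  ultimately show ?thesis unfolding induced_def by blast
qed

text \<open>Every term of \<open>f~_i Y\<close> begins with a positive power of \<open>f_i\<close>,
  so such a monomial has constant term 0, and the monomial 1 has constant term 1. Sums and regular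
  multiples stay regular.\<close>

lemma counit_Linf:
  assumes "n \<ge> 3" "X \<in> Linf n"
  shows "\<exists>u\<in>carrier (free_ring n). X = cls n u \<and> counit u \<in> regular_at_0"
  using assms(2)
proof (induction rule: Linf.induct)
  case (monomial X)
  then show ?case
  proof cases
    case one
    then show ?thesis by (intro bexI[of _ 1]) (auto simp: cls_one regular_at_0_1)
  next
    case (step Y i)
    obtain u where u: "u \<in> carrier (free_ring n)" "Y = cls n u"
      using ft_monomials_carrier[OF assms(1) step(2)] by (auto simp: carrier_Uminus)
    obtain N y where y: "strdec n i u N y" using strdec_exists[OF step(3) u(1)] .
    have "(\<Sum>m<N. divpow n i (Suc m) * y m) \<in> carrier (free_ring n)"
      using y step(3) by (auto simp: strdec_def intro!: free_carrier_sum)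
    moreover have "X = cls n (\<Sum>m<N. divpow n i (Suc m) * y m)"
      using ftU_strdec[OF assms(1) step(3) u(1) y] step(1) u(2) by simp
    moreover have "counit (\<Sum>m<N. divpow n i (Suc m) * y m) \<in> regular_at_0"
      by (simp add: counit_sum divpow_def regular_at_0_0)
    ultimately show ?thesis by blast
  qed
next
  case zero
  then show ?case by (intro bexI[of _ 0]) (auto simp: cls_zero regular_at_0_0)
next
  case (add X Y)
  then obtain u v where "u \<in> carrier (free_ring n)" "X = cls n u" "counit u \<in> regular_at_0"
    "v \<in> carrier (free_ring n)" "Y = cls n v" "counit v \<in> regular_at_0" by auto
  then show ?case
    by (intro bexI[of _ "u + v"]) (auto simp: cls_add regular_at_0_add_mult)
next
  case (scale X c)
  then obtain u where "u \<in> carrier (free_ring n)" "X = cls n u" "counit u \<in> regular_at_0" by auto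
  then show ?case using scale(2)
    by (intro bexI[of _ "const c * u"]) (auto simp: smul_cls regular_at_0_add_mult)
qed

text \<open>Comparison of constant terms would give \<open>1 = q c\<close> with \<open>c\<close>
  regular at 0.\<close>

lemma one_notin_qLinf:
  assumes "n \<ge> 3"
  shows "\<one>\<^bsub>Uminus n\<^esub> \<notin> qLinf n"
proof
  assume "\<one>\<^bsub>Uminus n\<^esub> \<in> qLinf n"
  then obtain X where X: "X \<in> Linf n" "cls n 1 = smul n qq X" by (auto simp: qLinf_def cls_one)
  obtain u where u: "u \<in> carrier (free_ring n)" "X = cls n u" "counit u \<in> regular_at_0"
    using counit_Linf[OF assms X(1)] by auto
  have "1 - const qq * u \<in> serre_ideal n" using X(2) u by (simp add: smul_cls cls_eq_iff)
  from counit_serre_ideal[OF this] qq_times_regular_neq_1[OF u(3)] show False by simp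
qed

text \<open>\<open>ft\<close> of the crystal of integer sequences is never \<open>None\<close>, so
  \<open>the\<close> always has a value here.\<close>

inductive_set zero_component :: "nat \<Rightarrow> (nat \<Rightarrow> nat) \<Rightarrow> (nat \<Rightarrow> int) set" for n \<iota> where
  zero: "(\<lambda>_. 0) \<in> zero_component n \<iota>"
| step: "a \<in> zero_component n \<iota> \<Longrightarrow> i \<in> {1..n} \<Longrightarrow> the (ft (Z_crystal n \<iota>) i a) \<in> zero_component n \<iota>"

lemma mem_elems_Binf:
  "b \<in> elems (Binf n) \<longleftrightarrow> (\<exists>X\<in>ft_monomials n. b = Bcls n X \<and> Bcls n X \<noteq> qLinf n)"
  unfolding Binf_def by auto

text \<open>Elements of \<open>Binf\<close> are nonzero classes. If \<open>f~_i X\<close> has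
  nonzero class, so has \<open>X\<close>, since \<open>f~_i\<close> preserves \<open>qLinf\<close>;
  this gives one inclusion by induction on monomials. For the other, \<open>ft\<close> on sequences
  is never \<open>None\<close>, so strictness forbids that \<open>f~_i\<close> sends an element of
  \<open>Binf\<close> to 0.\<close>

lemma image_Psi:
  assumes n: "n \<ge> 3" and Psi: "is_Psi n \<iota> \<Psi>"
  shows "\<Psi> ` elems (Binf n) = zero_component n \<iota>"
proof -
  have emb: "strict_embedding {1..n} (Binf n) (Z_crystal n \<iota>) \<Psi>" and Psi_u: "\<Psi> (u_inf n) = (\<lambda>_. 0)"
    using Psi by (simp_all add: is_Psi_def)
  have ft_Psi: "ft (Z_crystal n \<iota>) i (\<Psi> b) = map_option \<Psi> (ft (Binf n) i b)"
    if "i \<in> {1..n}" "b \<in> elems (Binf n)" for i b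
    using emb that unfolding strict_embedding_def by blast
  have ft_Some: "ft (Z_crystal n \<iota>) i a = Some (the (ft (Z_crystal n \<iota>) i a))" for i a
    by (simp add: Z_crystal_def)
  have ftB: "ft (Binf n) i (Bcls n X) = nonzero n (Bcls n (ftU n i X))"
    if "X \<in> ft_monomials n" "i \<in> {1..n}" for i X
    using induced_ftU[OF n that(2) ft_monomials_carrier[OF n that(1)]] by (simp add: Binf_def)
  show ?thesis
  proof (intro equalityI subsetI)
    fix a assume "a \<in> \<Psi> ` elems (Binf n)"
    then obtain X where X: "X \<in> ft_monomials n" "Bcls n X \<noteq> qLinf n" "a = \<Psi> (Bcls n X)"
      unfolding image_iff Bex_def mem_elems_Binf by blast
    from X(1,2) have "\<Psi> (Bcls n X) \<in> zero_component n \<iota>"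
    proof (induction rule: ft_monomials.induct)
      case one
      then show ?case using Psi_u zero_component.zero by (simp add: u_inf_def)
    next
      case (step X i)
      note car = ft_monomials_carrier[OF n step.hyps(1)]
      have nz: "Bcls n X \<noteq> qLinf n"
        using step.prems ftU_qLinf[OF n step.hyps(2), of X]
        unfolding Bcls_eq_qLinf_iff[OF n car] Bcls_eq_qLinf_iff[OF n ftU_carrier[OF n step.hyps(2) car]]
        by blast
      then have "Bcls n X \<in> elems (Binf n)" using step.hyps(1) unfolding mem_elems_Binf by blast
      from ft_Psi[OF step.hyps(2) this]
      have "ft (Z_crystal n \<iota>) i (\<Psi> (Bcls n X)) = Some (\<Psi> (Bcls n (ftU n i X)))"
        using step.prems by (simp add: ftB[OF step.hyps] nonzero_def)
      then show ?case using zero_component.step[OF step.IH[OF nz] step.hyps(2)] by simp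
    qed
    then show "a \<in> zero_component n \<iota>" using X by simp
  next
    fix a assume "a \<in> zero_component n \<iota>"
    then show "a \<in> \<Psi> ` elems (Binf n)"
    proof (induction rule: zero_component.induct)
      case zero
      have "Bcls n \<one>\<^bsub>Uminus n\<^esub> \<noteq> qLinf n"
        using one_notin_qLinf[OF n] Bcls_eq_qLinf_iff[OF n ft_monomials_carrier[OF n ft_monomials.one]] by blast
      then have "u_inf n \<in> elems (Binf n)"
        using ft_monomials.one[of n] unfolding u_inf_def mem_elems_Binf by blast
      then show ?case using Psi_u by (metis imageI)
    next
      case (step a i)
      then obtain X where X: "X \<in> ft_monomials n" "Bcls n X \<in> elems (Binf n)" "a = \<Psi> (Bcls n X)"
        unfolding image_iff Bex_def mem_elems_Binf by blast
      have "Some (the (ft (Z_crystal n \<iota>) i a)) = map_option \<Psi> (nonzero n (Bcls n (ftU n i X)))"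
        unfolding ft_Some[of i a, symmetric] unfolding X(3) ft_Psi[OF step.hyps(2) X(2)] ftB[OF X(1) step.hyps(2)] ..
      then have *: "Bcls n (ftU n i X) \<noteq> qLinf n" "the (ft (Z_crystal n \<iota>) i a) = \<Psi> (Bcls n (ftU n i X))"
        by (simp_all add: nonzero_def split: if_splits)
      have "Bcls n (ftU n i X) \<in> elems (Binf n)"
        unfolding mem_elems_Binf using ft_monomials.step[OF X(1) step.hyps(2)] *(1) by blast
      then show ?case unfolding *(2) by (rule imageI)
    qed
  qed
qed

section \<open>The polyhedral realization for a family of forms closed under the operators\<close>

lemma kplus_works:
  assumes "index_seq n \<iota>" "k \<ge> 1"
  shows "kplus \<iota> k > k" "\<iota> (kplus \<iota> k) = \<iota> k" "k < j \<Longrightarrow> j < kplus \<iota> k \<Longrightarrow> \<iota> j \<noteq> \<iota> k"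
proof -
  have "infinite {j. j \<ge> 1 \<and> \<iota> j = \<iota> k}" using assms by (auto simp: index_seq_def)
  then obtain l where "l > k \<and> \<iota> l = \<iota> k" unfolding infinite_nat_iff_unbounded by auto
  from LeastI[of "\<lambda>l. l > k \<and> \<iota> l = \<iota> k", OF this]
  show "kplus \<iota> k > k" "\<iota> (kplus \<iota> k) = \<iota> k" by (auto simp: kplus_def)
  show "k < j \<Longrightarrow> j < kplus \<iota> k \<Longrightarrow> \<iota> j \<noteq> \<iota> k" unfolding kplus_def by (auto dest: not_less_Least)
qed

lemma kminus_works:
  assumes "kminus \<iota> k \<noteq> 0"
  shows "kminus \<iota> k < k" "kminus \<iota> k \<ge> 1" "\<iota> (kminus \<iota> k) = \<iota> k" "kplus \<iota> (kminus \<iota> k) = k"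
proof -
  have "finite ({l. 1 \<le> l \<and> l < k \<and> \<iota> l = \<iota> k} \<union> {0})" by simp
  note Max_in[OF this] and max = Max_ge[OF this]
  then have *: "kminus \<iota> k \<in> {l. 1 \<le> l \<and> l < k \<and> \<iota> l = \<iota> k}"
    using assms unfolding kminus_def by blast
  then show "kminus \<iota> k < k" "kminus \<iota> k \<ge> 1" "\<iota> (kminus \<iota> k) = \<iota> k" by auto
  show "kplus \<iota> (kminus \<iota> k) = k" unfolding kplus_def
  proof (rule Least_equality)
    fix y assume y: "kminus \<iota> k < y \<and> \<iota> y = \<iota> (kminus \<iota> k)"
    show "k \<le> y"
    proof (rule ccontr)
      assume "\<not> k \<le> y"
      then have "y \<le> kminus \<iota> k" using y * max[of y] by (auto simp: kminus_def)
      then show False using y by simp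
    qed
  qed (use * in auto)
qed

lemma beta_apply:
  assumes "index_seq n \<iota>" "k \<ge> 1"
  shows "beta n \<iota> k m = (if m = k \<or> m = kplus \<iota> k then 1
     else if k < m \<and> m < kplus \<iota> k then of_int (cartan n (\<iota> k) (\<iota> m)) else 0)"
proof -
  have *: "(\<Sum>j\<in>{k<..<kplus \<iota> k}. of_int (cartan n (\<iota> k) (\<iota> j)) * xf j m)
     = (\<Sum>j\<in>{k<..<kplus \<iota> k}. if j = m then of_int (cartan n (\<iota> k) (\<iota> j)) else 0)"
    by (intro sum.cong) (auto simp: xf_def)
  show ?thesis
    using assms kplus_works(1)[OF assms] unfolding beta_def * by (auto simp: xf_def)
qed

lemma apply_form_superset:
  assumes "finite S" "{k. a k \<noteq> 0} \<subseteq> S"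
  shows "apply_form c a = (\<Sum>k\<in>S. c k * of_int (a k))"
  unfolding apply_form_def using assms by (intro sum.mono_neutral_left) auto

lemma apply_form_diff: "apply_form (\<lambda>m. c m - d m) a = apply_form c a - apply_form d a"
  and apply_form_cmult: "apply_form (\<lambda>m. r * c m) a = r * apply_form c a"
  by (simp_all add: apply_form_def algebra_simps sum_subtractf sum_distrib_left)

lemma apply_form_upd:
  assumes "finite {k. a k \<noteq> 0}"
  shows "apply_form c (a(k := a k + d)) = apply_form c a + c k * of_int d"
proof -
  let ?S = "insert k {k. a k \<noteq> 0}"
  have "apply_form c (a(k := a k + d)) = (\<Sum>j\<in>?S. c j * of_int ((a(k := a k + d)) j))"
    using assms by (intro apply_form_superset) auto
  also have "\<dots> = (\<Sum>j\<in>?S. c j * of_int (a j) + (if j = k then c k * of_int d else 0))"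
    by (intro sum.cong) (auto simp: algebra_simps)
  also have "\<dots> = (\<Sum>j\<in>?S. c j * of_int (a j)) + c k * of_int d"
    using assms by (simp add: sum.distrib)
  also have "(\<Sum>j\<in>?S. c j * of_int (a j)) = apply_form c a"
    using assms by (intro apply_form_superset[symmetric]) auto
  finally show ?thesis .
qed

lemma sigma_superset:
  assumes "finite S" "{j. j > k \<and> a j \<noteq> 0} \<subseteq> S"
  shows "sigma n \<iota> k a = a k + (\<Sum>j\<in>S. if j > k then cartan n (\<iota> k) (\<iota> j) * a j else 0)"
proof -
  have "(\<Sum>j | j > k \<and> a j \<noteq> 0. cartan n (\<iota> k) (\<iota> j) * a j) = (\<Sum>j\<in>S. if j > k then cartan n (\<iota> k) (\<iota> j) * a j else 0)"
    using assms by (intro sum.mono_neutral_cong_left) auto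
  then show ?thesis by (simp add: sigma_def)
qed

text \<open>Links \<open>S'_k\<close> with the crystal structure: beyond \<open>k^(+)\<close> the
  contributions to \<open>sigma\<close> at \<open>k\<close> and at \<open>k^(+)\<close> cancel, and
  at \<open>k^(+)\<close> itself they leave \<open>2 - 1 = 1\<close>.\<close>

lemma apply_beta:
  assumes \<iota>: "index_seq n \<iota>" "k \<ge> 1" and a: "a \<in> Zinf"
  shows "apply_form (beta n \<iota> k) a = of_int (sigma n \<iota> k a - sigma n \<iota> (kplus \<iota> k) a)"
proof -
  let ?p = "kplus \<iota> k"
  define S where "S = {j. a j \<noteq> 0} \<union> {k, ?p}"
  have S: "finite S" "k \<in> S" "?p \<in> S" using a by (auto simp: S_def Zinf_def)
  note kp = kplus_works[OF \<iota>]
  have c2: "cartan n x x = 2" for x by (simp add: cartan_def)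
  have "sigma n \<iota> k a - sigma n \<iota> ?p a = a k - a ?p + (\<Sum>j\<in>S. (if j > k then cartan n (\<iota> k) (\<iota> j) * a j else 0)
     - (if j > ?p then cartan n (\<iota> ?p) (\<iota> j) * a j else 0))"
    using S(1) by (subst (1 2) sigma_superset[of S]) (auto simp: S_def sum_subtractf)
  also have "\<dots> = (\<Sum>j\<in>S. (if j = k then a j else 0) - (if j = ?p then a j else 0) + ((if j > k then cartan n (\<iota> k) (\<iota> j) * a j else 0)
     - (if j > ?p then cartan n (\<iota> ?p) (\<iota> j) * a j else 0)))"
    using S by (simp add: sum.distrib sum_subtractf)
  finally have e: "sigma n \<iota> k a - sigma n \<iota> ?p a = \<dots>" .
  have "apply_form (beta n \<iota> k) a = (\<Sum>j\<in>S. beta n \<iota> k j * of_int (a j))"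
    using S by (intro apply_form_superset) (auto simp: S_def)
  also have "\<dots> = of_int (sigma n \<iota> k a - sigma n \<iota> ?p a)"
    unfolding e of_int_sum using kp(1,2)
    by (intro sum.cong refl) (auto simp: beta_apply[OF \<iota>] c2)
  finally show ?thesis .
qed

lemma Zinf_bounded:
  assumes "a \<in> Zinf"
  obtains N where "\<And>k. k \<ge> N \<Longrightarrow> a k = 0"
proof -
  obtain N where "{k. a k \<noteq> 0} \<subseteq> {..<N}"
    using assms finite_nat_bounded unfolding Zinf_def by blast
  then have "\<And>k. k \<ge> N \<Longrightarrow> a k = 0" by (auto simp: subset_eq not_less[symmetric])
  then show ?thesis by (rule that)
qed

text \<open>\<open>sigma\<close> vanishes beyond the support of \<open>a\<close>, so the
  \<open>Max\<close> in \<open>eps_Z\<close> is a true maximum.\<close>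

lemma finite_sigma_values:
  assumes "a \<in> Zinf"
  shows "finite {sigma n \<iota> k a | k. k \<ge> 1 \<and> \<iota> k = i}"
proof -
  obtain N where N: "\<And>k. k \<ge> N \<Longrightarrow> a k = 0"
    using Zinf_bounded[OF assms] by blast
  have "sigma n \<iota> k a = 0" if "k \<ge> N" for k
  proof -
    have "{j. j > k \<and> a j \<noteq> 0} = {}" using N that by auto
    then show ?thesis using N[OF that] unfolding sigma_def by simp
  qed
  then have "{sigma n \<iota> k a | k. k \<ge> 1 \<and> \<iota> k = i} \<subseteq> insert 0 ((\<lambda>k. sigma n \<iota> k a) ` {..<N})"
  proof (intro subsetI)
    fix x assume "x \<in> {sigma n \<iota> k a | k. k \<ge> 1 \<and> \<iota> k = i}"
    then obtain k where "x = sigma n \<iota> k a" by blast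
    then show "x \<in> insert 0 ((\<lambda>k. sigma n \<iota> k a) ` {..<N})"
      using \<open>\<And>k. k \<ge> N \<Longrightarrow> sigma n \<iota> k a = 0\<close>[of k] by (cases "k \<ge> N") auto
  qed
  then show ?thesis by (rule finite_subset) simp
qed

lemma sigma_le_eps:
  "a \<in> Zinf \<Longrightarrow> k \<ge> 1 \<Longrightarrow> sigma n \<iota> k a \<le> eps_Z n \<iota> (\<iota> k) a"
  unfolding eps_Z_def by (intro Max_ge finite_sigma_values) auto

lemma M_Z_nonempty:
  assumes "index_seq n \<iota>" "a \<in> Zinf" "i \<in> {1..n}"
  shows "M_Z n \<iota> i a \<noteq> {}"
proof -
  have "infinite {k. k \<ge> 1 \<and> \<iota> k = i}" using assms by (auto simp: index_seq_def)
  then have "{k. k \<ge> 1 \<and> \<iota> k = i} \<noteq> {}" by (metis finite.emptyI)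
  then obtain k where "k \<ge> 1" "\<iota> k = i" by blast
  then have "{sigma n \<iota> k a | k. k \<ge> 1 \<and> \<iota> k = i} \<noteq> {}" by auto
  from Max_in[OF finite_sigma_values[OF assms(2)] this] show ?thesis
    by (auto simp: M_Z_def eps_Z_def)
qed

text \<open>A positive maximum excludes the infinitely many indices with value 0.\<close>

lemma M_Z_finite:
  assumes "a \<in> Zinf" "eps_Z n \<iota> i a > 0"
  shows "finite (M_Z n \<iota> i a)"
proof -
  obtain N where N: "\<And>k. k \<ge> N \<Longrightarrow> a k = 0"
    using Zinf_bounded[OF assms(1)] by blast
  have "sigma n \<iota> k a = 0" if "k \<ge> N" for k
  proof -
    have "{j. j > k \<and> a j \<noteq> 0} = {}" using N that by auto
    then show ?thesis using N[OF that] unfolding sigma_def by simp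
  qed
  then have "M_Z n \<iota> i a \<subseteq> {..<N}" using assms(2) by (force simp: M_Z_def not_less[symmetric])
  then show ?thesis by (rule finite_subset) simp
qed

text \<open>Integrality matters: each \<open>S'_k\<close> moves the coefficient at \<open>k\<close>
  by 1 towards 0, so finitely many applications bring it exactly to 0.\<close>

locale Sprime_closed =
  fixes n :: nat and \<iota> :: "nat \<Rightarrow> nat" and \<Omega> :: "form set"
  assumes seq: "index_seq n \<iota>"
    and coordinates: "j \<ge> 1 \<Longrightarrow> xf j \<in> \<Omega>"
    and integral: "c \<in> \<Omega> \<Longrightarrow> c m \<in> \<int>"
    and Sprime: "c \<in> \<Omega> \<Longrightarrow> k \<ge> 1 \<Longrightarrow> Sprime n \<iota> k c \<in> \<Omega>"
    and positive: "c \<in> \<Omega> \<Longrightarrow> k \<ge> 1 \<Longrightarrow> kminus \<iota> k = 0 \<Longrightarrow> c k \<ge> 0"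
begin

lemma Xi_prime_subset: "Xi_prime n \<iota> \<subseteq> \<Omega>"
proof
  fix c assume "c \<in> Xi_prime n \<iota>"
  then show "c \<in> \<Omega>" by induction (auto intro: coordinates Sprime)
qed

lemma Xi_prime_positive: "Xi_prime_positive n \<iota>"
  using Xi_prime_subset positive by (auto simp: Xi_prime_positive_def)

definition cone :: "(nat \<Rightarrow> int) set" where
  "cone = {a \<in> Zinf. \<forall>c\<in>\<Omega>. apply_form c a \<ge> 0}"

text \<open>Iterating \<open>S'\<^sub>k\<close> until the coefficient at \<open>k\<close> vanishes.\<close>

lemma subtract_beta:
  assumes "c \<in> \<Omega>" "k \<ge> 1" "c k \<ge> 0"
  shows "(\<lambda>m. c m - c k * beta n \<iota> k m) \<in> \<Omega>"
proof -
  obtain l where l: "c k = of_nat l"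
    using integral[OF assms(1), of k] assms(3) by (elim Ints_cases) (auto elim!: nonneg_int_cases)
  have bk: "beta n \<iota> k k = 1" using seq assms(2) by (simp add: beta_apply)
  show ?thesis using assms(1) l
  proof (induction l arbitrary: c)
    case (Suc l)
    have mem: "(\<lambda>m. c m - beta n \<iota> k m) \<in> \<Omega>"
      using Sprime[OF Suc.prems(1) assms(2)] Suc.prems(2) by (simp add: Sprime_def)
    have eq: "(\<lambda>m. c m - c k * beta n \<iota> k m) = (\<lambda>m. (c m - beta n \<iota> k m) - (c k - beta n \<iota> k k) * beta n \<iota> k m)"
      by (simp add: bk algebra_simps)
    have IH: "(\<lambda>m. (c m - beta n \<iota> k m) - (c k - beta n \<iota> k k) * beta n \<iota> k m) \<in> \<Omega>"
      by (rule Suc.IH[OF mem]) (simp add: bk Suc.prems(2))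
    show ?case by (subst eq) (rule IH)
  qed simp
qed

text \<open>As long as the coefficient is negative, \<open>positive\<close> guarantees that
  \<open>k^(-)\<close> is not 0, so \<open>beta\<close> at \<open>k^(-)\<close> is a genuine form
  with coefficient 1 at \<open>k\<close>.\<close>

lemma add_beta:
  assumes "c \<in> \<Omega>" "k \<ge> 1" "c k \<le> 0"
  shows "(\<lambda>m. c m - c k * beta n \<iota> (kminus \<iota> k) m) \<in> \<Omega>"
proof -
  obtain l where l: "c k = - of_nat l"
  proof -
    obtain z where z: "c k = of_int z" using integral[OF assms(1), of k] by (elim Ints_cases)
    with assms(3) have "z \<le> 0" by simp
    then have "c k = - of_nat (nat (- z))" by (simp add: z)
    then show ?thesis by (rule that)
  qed
  show ?thesis using assms(1) l
  proof (induction l arbitrary: c)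
    case (Suc l)
    have "kminus \<iota> k \<noteq> 0" using positive[OF Suc.prems(1) assms(2)] Suc.prems(2) by auto
    then have bk: "beta n \<iota> (kminus \<iota> k) k = 1"
      using seq kminus_works[of \<iota> k] by (simp add: beta_apply)
    have mem: "(\<lambda>m. c m + beta n \<iota> (kminus \<iota> k) m) \<in> \<Omega>"
      using Sprime[OF Suc.prems(1) assms(2)] Suc.prems(2) by (simp add: Sprime_def)
    have eq: "(\<lambda>m. c m - c k * beta n \<iota> (kminus \<iota> k) m)
       = (\<lambda>m. (c m + beta n \<iota> (kminus \<iota> k) m) - (c k + beta n \<iota> (kminus \<iota> k) k) * beta n \<iota> (kminus \<iota> k) m)"
      by (simp add: bk algebra_simps)
    have IH: "(\<lambda>m. (c m + beta n \<iota> (kminus \<iota> k) m) - (c k + beta n \<iota> (kminus \<iota> k) k) * beta n \<iota> (kminus \<iota> k) m) \<in> \<Omega>"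
      by (rule Suc.IH[OF mem]) (simp add: bk Suc.prems(2))
    show ?case by (subst eq) (rule IH)
  qed simp
qed

text \<open>Only forms with \<open>c k < 0\<close> are at risk. As \<open>k\<close> is the least
  maximiser, \<open>sigma\<close> is strictly smaller at \<open>k^(-)\<close>, so
  \<open>beta\<close> at \<open>k^(-)\<close> is at most -1 on \<open>a\<close>. Nonnegativity of
  \<open>c - c_k beta\<close> then gives \<open>c(a) + c_k \<ge> 0\<close>.\<close>

lemma ft_cone:
  assumes a: "a \<in> cone" and i: "i \<in> {1..n}"
  shows "the (ft (Z_crystal n \<iota>) i a) \<in> cone"
proof -
  define k where "k = (LEAST k. k \<in> M_Z n \<iota> i a)"
  have aZ: "a \<in> Zinf" and fin: "finite {k. a k \<noteq> 0}" using a by (auto simp: cone_def Zinf_def)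
  have kM: "k \<in> M_Z n \<iota> i a" unfolding k_def using M_Z_nonempty[OF seq aZ i] by (metis LeastI ex_in_conv)
  then have k: "k \<ge> 1" "\<iota> k = i" "sigma n \<iota> k a = eps_Z n \<iota> i a" by (auto simp: M_Z_def)
  have eq: "the (ft (Z_crystal n \<iota>) i a) = a(k := a k + 1)"
    by (simp add: Z_crystal_def k_def)
  have "a(k := a k + 1) \<in> Zinf"
    using aZ k(1) by (auto simp: Zinf_def intro: rev_finite_subset[of "insert k {k. a k \<noteq> 0}"])
  moreover have "apply_form c (a(k := a k + 1)) \<ge> 0" if c: "c \<in> \<Omega>" for c
  proof (cases "c k \<ge> 0")
    case True
    then show ?thesis using a c by (simp add: apply_form_upd[OF fin] cone_def)
  next
    case False
    then have km: "kminus \<iota> k \<noteq> 0" using positive[OF c k(1)] by auto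
    note kw = kminus_works[OF km]
    have "kminus \<iota> k \<notin> M_Z n \<iota> i a" using kw(1) unfolding k_def by (metis not_less_Least)
    moreover have "sigma n \<iota> (kminus \<iota> k) a \<le> eps_Z n \<iota> i a" using sigma_le_eps[OF aZ kw(2), of n \<iota>] kw(3) k(2) by simp
    ultimately have "sigma n \<iota> (kminus \<iota> k) a - sigma n \<iota> k a \<le> - 1"
      using kw k by (auto simp: M_Z_def)
    then have b: "apply_form (beta n \<iota> (kminus \<iota> k)) a \<le> - 1"
      using kw apply_beta[OF seq kw(2) aZ] by simp
    have "0 \<le> apply_form (\<lambda>m. c m - c k * beta n \<iota> (kminus \<iota> k) m) a"
      using add_beta[OF c k(1)] False a by (auto simp: cone_def)
    also have "\<dots> = apply_form c a - c k * apply_form (beta n \<iota> (kminus \<iota> k)) a"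
      by (simp add: apply_form_diff apply_form_cmult)
    also have "\<dots> \<le> apply_form c a + c k"
      using mult_left_mono_neg[OF b, of "c k"] False by simp
    finally show ?thesis by (simp add: apply_form_upd[OF fin])
  qed
  ultimately show ?thesis by (simp add: eq cone_def)
qed

lemma zero_component_subset: "zero_component n \<iota> \<subseteq> cone"
proof
  fix a assume "a \<in> zero_component n \<iota>"
  then show "a \<in> cone"
  proof induction
    case zero
    then show ?case by (simp add: cone_def Zinf_def apply_form_def)
  qed (rule ft_cone)
qed

lemma cone_nonneg: "a \<in> cone \<Longrightarrow> a j \<ge> 0"
proof (cases "j \<ge> 1")
  case True
  assume "a \<in> cone"
  then have "apply_form (xf j) a \<ge> 0" and fin: "finite {k. a k \<noteq> 0}" using coordinates[OF True] by (auto simp: cone_def Zinf_def)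
  moreover have "apply_form (xf j) a = of_int (a j)"
  proof -
    have "apply_form (xf j) a = (\<Sum>k\<in>insert j {k. a k \<noteq> 0}. xf j k * of_int (a k))"
      using fin by (intro apply_form_superset) auto
    also have "\<dots> = (\<Sum>k\<in>insert j {k. a k \<noteq> 0}. if k = j then of_int (a j) else 0)"
      by (intro sum.cong refl) (simp add: xf_def)
    also have "\<dots> = of_int (a j)" using fin by simp
    finally show ?thesis .
  qed
  ultimately show ?thesis by simp
qed (simp add: cone_def Zinf_def not_le)

text \<open>The mirror image of \<open>ft_cone\<close> for \<open>e~_i\<close>, where
  \<open>i\<close> is the colour of the last nonzero entry \<open>j\<close> of \<open>a\<close>:
  there \<open>sigma\<close> equals \<open>a j > 0\<close>, so \<open>eps_Z\<close> is positive and
  there is a greatest maximiser \<open>k\<close>.\<close>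

lemma lower_cone:
  assumes a: "a \<in> cone" and nz: "a \<noteq> (\<lambda>_. 0)"
  obtains i k where "i \<in> {1..n}" "a(k := a k - 1) \<in> cone" "a k > 0"
    "the (ft (Z_crystal n \<iota>) i (a(k := a k - 1))) = a"
proof -
  have aZ: "a \<in> Zinf" and fin: "finite {k. a k \<noteq> 0}" using a by (auto simp: cone_def Zinf_def)
  define j where "j = Max {k. a k \<noteq> 0}"
  have "{k. a k \<noteq> 0} \<noteq> {}" using nz by auto
  from Max_in[OF fin this] have aj: "a j \<noteq> 0" by (simp add: j_def)
  have jmax: "a k = 0" if "k > j" for k
    using Max_ge[OF fin, of k] that unfolding j_def[symmetric] by (cases "a k = 0") auto
  have j1: "j \<ge> 1" using aj aZ by (cases j) (auto simp: Zinf_def)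
  have "{l. l > j \<and> a l \<noteq> 0} = {}" using jmax by auto
  then have "sigma n \<iota> j a = a j" unfolding sigma_def by simp
  then have sj: "sigma n \<iota> j a > 0" using aj cone_nonneg[OF a, of j] by simp
  define i where "i = \<iota> j"
  have i: "i \<in> {1..n}" using seq j1 by (auto simp: index_seq_def i_def)
  have eps: "eps_Z n \<iota> i a > 0" using sj sigma_le_eps[OF aZ j1, of n \<iota>] by (simp add: i_def)
  define k where "k = Max (M_Z n \<iota> i a)"
  note Mfin = M_Z_finite[OF aZ eps] and Mne = M_Z_nonempty[OF seq aZ i]
  have kM: "k \<in> M_Z n \<iota> i a" unfolding k_def by (rule Max_in[OF Mfin Mne])
  then have k: "k \<ge> 1" "\<iota> k = i" "sigma n \<iota> k a = eps_Z n \<iota> i a" by (auto simp: M_Z_def)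
  note kp = kplus_works[OF seq k(1)]
  have "kplus \<iota> k \<notin> M_Z n \<iota> i a" using kp(1) Max_ge[OF Mfin, of "kplus \<iota> k"] by (auto simp: k_def)
  moreover have "sigma n \<iota> (kplus \<iota> k) a \<le> eps_Z n \<iota> i a"
    using sigma_le_eps[OF aZ, of "kplus \<iota> k" n \<iota>] kp k by simp
  ultimately have "sigma n \<iota> k a - sigma n \<iota> (kplus \<iota> k) a \<ge> 1"
    using kp k by (auto simp: M_Z_def)
  then have b: "1 \<le> apply_form (beta n \<iota> k) a"
    using apply_beta[OF seq k(1) aZ] by simp
  define a' where "a' = a(k := a k - 1)"
  have upd: "apply_form c a' = apply_form c a - c k" for c
    using apply_form_upd[OF fin, of c k "-1"] by (simp add: a'_def)
  have a'Z: "a' \<in> Zinf"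
    using aZ k(1) by (auto simp: a'_def Zinf_def intro: rev_finite_subset[of "insert k {k. a k \<noteq> 0}"])
  have "apply_form c a' \<ge> 0" if c: "c \<in> \<Omega>" for c
  proof (cases "c k \<le> 0")
    case True
    have "apply_form c a \<ge> 0" using a c by (simp add: cone_def)
    then show ?thesis using True by (simp add: upd)
  next
    case False
    have "0 \<le> apply_form (\<lambda>m. c m - c k * beta n \<iota> k m) a"
      using subtract_beta[OF c k(1)] False a by (auto simp: cone_def)
    also have "\<dots> = apply_form c a - c k * apply_form (beta n \<iota> k) a"
      by (simp add: apply_form_diff apply_form_cmult)
    also have "\<dots> \<le> apply_form c a - c k"
      using mult_left_mono[OF b, of "c k"] False by simp
    finally show ?thesis by (simp add: upd)
  qed
  then have a'c: "a' \<in> cone" using a'Z by (simp add: cone_def)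
  have "a k > 0" using cone_nonneg[OF a'c, of k] by (simp add: a'_def)
  \<comment> \<open>Lowering \<open>a\<close> at \<open>k\<close> subtracts 1 from
    \<open>sigma\<close> at \<open>k\<close> and \<open>a_ii = 2\<close> at earlier indices of
    colour \<open>i\<close>. Hence \<open>k\<close> becomes the least maximiser, and
    \<open>f~_i\<close> restores \<open>a\<close>.\<close>
  have sig: "sigma n \<iota> m a' = sigma n \<iota> m a - (if m = k then 1 else if m < k then cartan n (\<iota> m) i else 0)" for m
  proof -
    define S where "S = insert k {k. a k \<noteq> 0}"
    have S: "finite S" "k \<in> S" using fin by (auto simp: S_def)
    have "sigma n \<iota> m a' = a' m + (\<Sum>j\<in>S. if j > m then cartan n (\<iota> m) (\<iota> j) * a' j else 0)"
      using S by (intro sigma_superset) (auto simp: S_def a'_def)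
    also have "(\<Sum>j\<in>S. if j > m then cartan n (\<iota> m) (\<iota> j) * a' j else 0)
       = (\<Sum>j\<in>S. (if j > m then cartan n (\<iota> m) (\<iota> j) * a j else 0) - (if j = k then if m < k then cartan n (\<iota> m) i else 0 else 0))"
      using k by (intro sum.cong refl) (auto simp: a'_def algebra_simps)
    also have "\<dots> = (\<Sum>j\<in>S. if j > m then cartan n (\<iota> m) (\<iota> j) * a j else 0) - (if m < k then cartan n (\<iota> m) i else 0)"
      using S by (simp add: sum_subtractf)
    finally have "sigma n \<iota> m a' = a' m + ((\<Sum>j\<in>S. if j > m then cartan n (\<iota> m) (\<iota> j) * a j else 0)
       - (if m < k then cartan n (\<iota> m) i else 0))" .
    moreover have "sigma n \<iota> m a = a m + (\<Sum>j\<in>S. if j > m then cartan n (\<iota> m) (\<iota> j) * a j else 0)"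
      using S(1) by (rule sigma_superset) (auto simp: S_def)
    ultimately show ?thesis by (simp add: a'_def)
  qed
  have c2: "cartan n i i = 2" by (simp add: cartan_def)
  have le: "sigma n \<iota> m a' \<le> eps_Z n \<iota> i a - 1 \<and> (m < k \<longrightarrow> sigma n \<iota> m a' < eps_Z n \<iota> i a - 1)" if "m \<ge> 1" "\<iota> m = i" for m
  proof -
    have "sigma n \<iota> m a \<le> eps_Z n \<iota> i a" using sigma_le_eps[OF aZ that(1), of n \<iota>] that by simp
    moreover have "sigma n \<iota> m a \<noteq> eps_Z n \<iota> i a" if "m > k"
      using Max_ge[OF Mfin, of m] that \<open>m \<ge> 1\<close> \<open>\<iota> m = i\<close> by (auto simp: k_def M_Z_def)
    ultimately show ?thesis using that k by (auto simp: sig c2)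
  qed
  have "eps_Z n \<iota> i a' = eps_Z n \<iota> i a - 1"
    unfolding eps_Z_def[of n \<iota> i a']
  proof (rule Max_eqI[OF finite_sigma_values[OF a'Z]])
    have "eps_Z n \<iota> i a - 1 = sigma n \<iota> k a'" using k sig[of k] by simp
    then show "eps_Z n \<iota> i a - 1 \<in> {sigma n \<iota> k a' |k. 1 \<le> k \<and> \<iota> k = i}"
      using k(1,2) by blast
    fix y assume "y \<in> {sigma n \<iota> k a' |k. 1 \<le> k \<and> \<iota> k = i}"
    then obtain m where "y = sigma n \<iota> m a'" "1 \<le> m" "\<iota> m = i" by blast
    then show "y \<le> eps_Z n \<iota> i a - 1" using le[of m] by simp
  qed
  then have mem: "m \<in> M_Z n \<iota> i a' \<longleftrightarrow> m \<ge> 1 \<and> \<iota> m = i \<and> sigma n \<iota> m a' = eps_Z n \<iota> i a - 1" for m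
    by (simp add: M_Z_def)
  have "(LEAST m. m \<in> M_Z n \<iota> i a') = k"
  proof (rule Least_equality)
    show "k \<in> M_Z n \<iota> i a'" using k sig[of k] by (simp add: mem)
    fix m assume "m \<in> M_Z n \<iota> i a'"
    then show "k \<le> m" using le[of m] by (cases "m < k") (auto simp: mem)
  qed
  then have "the (ft (Z_crystal n \<iota>) i a') = a"
    by (simp add: Z_crystal_def a'_def)
  then show ?thesis using that[OF i, of k] a'c \<open>a k > 0\<close> by (simp add: a'_def)
qed

text \<open>Entries are nonnegative on the cone, and \<open>lower_cone\<close> decreases their sum
  by one.\<close>

lemma cone_subset: "cone \<subseteq> zero_component n \<iota>"
proof
  fix a assume "a \<in> cone"
  then show "a \<in> zero_component n \<iota>"
  proof (induction "nat (\<Sum>k | a k \<noteq> 0. a k)" arbitrary: a rule: less_induct)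
    case less
    show ?case
    proof (cases "a = (\<lambda>_. 0)")
      case True
      then show ?thesis by (simp add: zero_component.zero)
    next
      case False
      obtain i k where ik: "i \<in> {1..n}" "a(k := a k - 1) \<in> cone" "a k > 0"
        "the (ft (Z_crystal n \<iota>) i (a(k := a k - 1))) = a"
        using lower_cone[OF less.prems False] .
      define S where "S = {k. a k \<noteq> 0}"
      have S: "finite S" "k \<in> S" using less.prems ik(3) by (auto simp: S_def cone_def Zinf_def)
      have "(\<Sum>j | (a(k := a k - 1)) j \<noteq> 0. (a(k := a k - 1)) j) = (\<Sum>j\<in>S. (a(k := a k - 1)) j)"
        using S by (intro sum.mono_neutral_left) (auto simp: S_def)
      also have "\<dots> = (\<Sum>j\<in>S. a j - (if j = k then 1 else 0))"
        by (intro sum.cong) auto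
      also have "\<dots> = (\<Sum>j\<in>S. a j) - 1" using S by (simp add: sum_subtractf)
      finally have e: "(\<Sum>j | (a(k := a k - 1)) j \<noteq> 0. (a(k := a k - 1)) j) = (\<Sum>j\<in>S. a j) - 1" .
      have "a k \<le> (\<Sum>j\<in>S. a j)"
        using S cone_nonneg[OF less.prems] by (intro member_le_sum) auto
      then have "nat (\<Sum>j | (a(k := a k - 1)) j \<noteq> 0. (a(k := a k - 1)) j) < nat (\<Sum>j | a j \<noteq> 0. a j)"
        unfolding e unfolding S_def[symmetric] using ik(3) by simp
      then have "a(k := a k - 1) \<in> zero_component n \<iota>"
        using ik(2) by (rule less.hyps)
      from zero_component.step[OF this ik(1)] show ?thesis by (simp add: ik(4))
    qed
  qed
qed

lemma zero_component_eq_cone: "zero_component n \<iota> = cone"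
  using zero_component_subset cone_subset by blast

end

section \<open>Double indices of an adapted sequence\<close>

lemma enumerate_eqI:
  fixes f :: "nat \<Rightarrow> nat"
  assumes "strict_mono f" "range f = T"
  shows "enumerate T r = f r"
proof (induction r)
  case 0
  show ?case unfolding enumerate_0
    using assms by (intro Least_equality) (auto simp: strict_mono_less_eq)
next
  case (Suc r)
  have "infinite T" using assms finite_imageD[of f UNIV] strict_mono_imp_inj_on[OF assms(1)] by auto
  then have "enumerate T (Suc r) = (LEAST s. s \<in> T \<and> enumerate T r < s)"
    by (rule enumerate_Suc'')
  also have "\<dots> = f (Suc r)" unfolding Suc
    using assms by (intro Least_equality) (auto simp: strict_mono_less strict_mono_less_eq Suc_le_eq)
  finally show ?case .
qed

locale adapted_A2 =
  fixes n :: nat and \<iota> :: "nat \<Rightarrow> nat"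
  assumes n3: "n \<ge> 3" and seq: "index_seq n \<iota>" and adap: "adapted n \<iota>"
begin

text \<open>\<open>pos l r\<close> is counted from \<open>r = 0\<close>: the form \<open>x\<^sub>s\<^sub>,\<^sub>l\<close> belongs to \<open>pos l (s - 1)\<close>.\<close>

definition pos :: "nat \<Rightarrow> nat \<Rightarrow> nat" where
  "pos l r = enumerate {k. k \<ge> 1 \<and> \<iota> k = l} r"

lemma infinite_occ: "l \<in> {1..n} \<Longrightarrow> infinite {k. k \<ge> 1 \<and> \<iota> k = l}"
  using seq by (auto simp: index_seq_def)

lemma iota_range: "k \<ge> 1 \<Longrightarrow> \<iota> k \<in> {1..n}"
  using seq by (auto simp: index_seq_def)

lemma pos_props: 
  assumes "l \<in> {1..n}" shows "pos l r \<ge> 1" "\<iota> (pos l r) = l"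
  using enumerate_in_set[OF infinite_occ[OF assms], of r] by (auto simp: pos_def)

lemma pos_mono: "l \<in> {1..n} \<Longrightarrow> pos l r < pos l r' \<longleftrightarrow> r < r'"
  and pos_le: "l \<in> {1..n} \<Longrightarrow> pos l r \<le> pos l r' \<longleftrightarrow> r \<le> r'"
  and pos_eq: "l \<in> {1..n} \<Longrightarrow> pos l r = pos l r' \<longleftrightarrow> r = r'"
  using strict_mono_enumerate[OF infinite_occ]
  by (auto simp: pos_def strict_mono_less strict_mono_less_eq strict_mono_eq)

lemma ex_pos:
  assumes "k \<ge> 1"
  shows "\<exists>r. k = pos (\<iota> k) r"
proof -
  have "k \<in> {j. j \<ge> 1 \<and> \<iota> j = \<iota> k}" using assms by simp
  from enumerate_Ex[OF infinite_occ[OF iota_range[OF assms]] this]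
  obtain r where "enumerate {j. j \<ge> 1 \<and> \<iota> j = \<iota> k} r = k" by blast
  then show ?thesis unfolding pos_def by (intro exI[of _ r]) (rule sym)
qed

lemma kplus_pos: "l \<in> {1..n} \<Longrightarrow> kplus \<iota> (pos l r) = pos l (Suc r)"
proof -
  assume l: "l \<in> {1..n}"
  have "(\<lambda>x. x > pos l r \<and> \<iota> x = l) = (\<lambda>s. s \<in> {k. k \<ge> 1 \<and> \<iota> k = l} \<and> enumerate {k. k \<ge> 1 \<and> \<iota> k = l} r < s)"
    using pos_props[OF l, of r] by (auto simp: pos_def fun_eq_iff)
  then have "kplus \<iota> (pos l r) = (LEAST s. s \<in> {k. k \<ge> 1 \<and> \<iota> k = l} \<and> enumerate {k. k \<ge> 1 \<and> \<iota> k = l} r < s)"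
    unfolding kplus_def pos_props(2)[OF l] by (rule arg_cong)
  also have "\<dots> = pos l (Suc r)"
    unfolding pos_def by (rule enumerate_Suc''[OF infinite_occ[OF l], symmetric])
  finally show ?thesis .
qed

lemma kminus_pos:
  assumes l: "l \<in> {1..n}"
  shows "kminus \<iota> (pos l 0) = 0" "kminus \<iota> (pos l (Suc r)) = pos l r"
proof -
  have "\<not> (1 \<le> x \<and> x < pos l 0 \<and> \<iota> x = l)" for x
  proof
    assume *: "1 \<le> x \<and> x < pos l 0 \<and> \<iota> x = l"
    then obtain r where "x = pos l r" using ex_pos[of x] by auto
    with * show False using pos_mono[OF l, of r 0] by simp
  qed
  then have "{x. 1 \<le> x \<and> x < pos l 0 \<and> \<iota> x = \<iota> (pos l 0)} \<union> {0} = {0}"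
    using pos_props[OF l] by auto
  then show "kminus \<iota> (pos l 0) = 0" by (simp only: kminus_def Max_singleton)
  show "kminus \<iota> (pos l (Suc r)) = pos l r" unfolding kminus_def
  proof (rule Max_eqI)
    fix y assume "y \<in> {x. 1 \<le> x \<and> x < pos l (Suc r) \<and> \<iota> x = \<iota> (pos l (Suc r))} \<union> {0}"
    then consider "y = 0" | "1 \<le> y" "y < pos l (Suc r)" "\<iota> y = l" using pos_props[OF l] by auto
    then show "y \<le> pos l r"
    proof cases
      case 2
      then obtain q where "y = pos l q" using ex_pos[of y] by auto
      with 2 show ?thesis using pos_mono[OF l, of q "Suc r"] pos_le[OF l, of q r] by simp
    qed simp
  qed (use pos_props[OF l] pos_mono[OF l] in auto)
qed

text \<open>Up to \<open>pos l r\<close> there are exactly \<open>r + 1\<close> occurrences of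
  \<open>l\<close>, whence the shift from \<open>s\<close> to \<open>s - 1\<close>.\<close>

lemma xx_pos:
  assumes l: "l \<in> {1..n}" and s: "s \<ge> 1"
  shows "xx \<iota> s l = xf (pos l (nat (s - 1)))"
proof -
  have count: "card {m. 1 \<le> m \<and> m \<le> pos l r \<and> \<iota> m = l} = Suc r" for r
  proof -
    have "{m. 1 \<le> m \<and> m \<le> pos l r \<and> \<iota> m = l} = pos l ` {..r}"
    proof (intro equalityI subsetI)
      fix x assume x: "x \<in> {m. 1 \<le> m \<and> m \<le> pos l r \<and> \<iota> m = l}"
      then obtain q where q: "x = pos l q" using ex_pos[of x] by auto
      with x have "q \<le> r" using pos_le[OF l, of q r] by simp
      with q show "x \<in> pos l ` {..r}" by simp
    qed (use pos_props[OF l] pos_le[OF l] in auto)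
    moreover have "inj_on (pos l) {..r}" by (auto simp: inj_on_def pos_eq[OF l])
    ultimately show ?thesis by (simp add: card_image)
  qed
  have "(THE j. j \<ge> 1 \<and> \<iota> j = l \<and> int (card {m. 1 \<le> m \<and> m \<le> j \<and> \<iota> m = l}) = s) = pos l (nat (s - 1))"
  proof (rule the_equality)
    show "1 \<le> pos l (nat (s - 1)) \<and> \<iota> (pos l (nat (s - 1))) = l \<and>
        int (card {m. 1 \<le> m \<and> m \<le> pos l (nat (s - 1)) \<and> \<iota> m = l}) = s"
      using pos_props[OF l] s count[of "nat (s - 1)"] by simp
    fix j assume j: "1 \<le> j \<and> \<iota> j = l \<and> int (card {m. 1 \<le> m \<and> m \<le> j \<and> \<iota> m = l}) = s"
    then obtain r where "j = pos l r" using ex_pos[of j] by auto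
    with j count[of r] show "j = pos l (nat (s - 1))" by (auto intro: arg_cong)
  qed
  then show ?thesis by (simp add: xx_def)
qed

text \<open>In the alternating subsequence, \<open>i\<close> occupies the even and \<open>j\<close>
  the odd entries.\<close>

lemma interleave:
  assumes ij: "i \<in> {1..n}" "j \<in> {1..n}" "i \<noteq> j" and alt: "alternates \<iota> i j"
  shows "pos i r < pos j r" "pos j r < pos i (Suc r)"
proof -
  define S where "S = {k. k \<ge> 1 \<and> \<iota> k \<in> {i, j}}"
  have inf: "infinite S"
    using infinite_occ[OF ij(1)] by (rule contrapos_nn) (auto simp: S_def elim: rev_finite_subset)
  note sm = strict_mono_enumerate[OF inf]
  have val: "\<iota> (enumerate S q) = (if even q then i else j)" for q
    using alt by (simp add: alternates_def subsequence_def S_def)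
  have mem: "enumerate S q \<ge> 1" for q using enumerate_in_set[OF inf, of q] by (auto simp: S_def)
  have ex: "\<exists>q. x = enumerate S q" if "x \<in> S" for x using enumerate_Ex[OF inf that] by metis
  have pi: "pos i q = enumerate S (2 * q)" for q unfolding pos_def
  proof (rule enumerate_eqI)
    show "strict_mono (\<lambda>q. enumerate S (2 * q))" using sm by (auto simp: strict_mono_def)
    show "range (\<lambda>q. enumerate S (2 * q)) = {k. 1 \<le> k \<and> \<iota> k = i}"
    proof (intro equalityI subsetI)
      fix x assume x: "x \<in> {k. 1 \<le> k \<and> \<iota> k = i}"
      then obtain q where q: "x = enumerate S q" using ex[of x] by (auto simp: S_def)
      then have "even q" using val[of q] x ij(3) by (auto split: if_splits)
      then show "x \<in> range (\<lambda>q. enumerate S (2 * q))" using q by (auto elim: evenE)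
    qed (use val mem in auto)
  qed
  have pj: "pos j q = enumerate S (2 * q + 1)" for q unfolding pos_def
  proof (rule enumerate_eqI)
    show "strict_mono (\<lambda>q. enumerate S (2 * q + 1))" using sm by (auto simp: strict_mono_def)
    show "range (\<lambda>q. enumerate S (2 * q + 1)) = {k. 1 \<le> k \<and> \<iota> k = j}"
    proof (intro equalityI subsetI)
      fix x assume x: "x \<in> {k. 1 \<le> k \<and> \<iota> k = j}"
      then obtain q where q: "x = enumerate S q" using ex[of x] by (auto simp: S_def)
      then have "odd q" using val[of q] x ij(3) by (auto split: if_splits)
      then show "x \<in> range (\<lambda>q. enumerate S (2 * q + 1))" using q by (auto elim: oddE)
    qed (use val mem in auto)
  qed
  show "pos i r < pos j r" "pos j r < pos i (Suc r)"
    using sm by (auto simp: pi pj strict_mono_def)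
qed

lemma pp_cases:
  assumes "i \<in> {1..n}" "j \<in> {1..n}" "cartan n i j < 0"
  shows "alternates \<iota> i j \<and> pp \<iota> i j = 1 \<and> pp \<iota> j i = 0 \<or> alternates \<iota> j i \<and> pp \<iota> j i = 1 \<and> pp \<iota> i j = 0"
proof -
  have ne: "i \<noteq> j" using assms(3) by (auto simp: cartan_def)
  have "\<not> (alternates \<iota> i j \<and> alternates \<iota> j i)"
  proof
    assume "alternates \<iota> i j \<and> alternates \<iota> j i"
    then have "subsequence \<iota> i j 0 = i" "subsequence \<iota> j i 0 = j" unfolding alternates_def by auto
    then show False using ne by (simp add: subsequence_def insert_commute)
  qed
  moreover have "alternates \<iota> i j \<or> alternates \<iota> j i"
    using adap assms unfolding adapted_def by blast
  ultimately show ?thesis using ne by (auto simp: pp_def)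
qed

text \<open>Between consecutive occurrences of \<open>i\<close> there is exactly one of
  \<open>j\<close>. Its number is one higher if the subsequence starts, on the right, with
  \<open>j\<close>; this is the origin of the numbers \<open>p_ij\<close>.\<close>

lemma between_iff:
  assumes ij: "i \<in> {1..n}" "j \<in> {1..n}" "cartan n i j < 0"
  shows "pos i r < pos j q \<and> pos j q < pos i (Suc r) \<longleftrightarrow> q = r + nat (pp \<iota> j i)"
proof -
  have ne: "i \<noteq> j" "j \<noteq> i" using ij(3) by (auto simp: cartan_def)
  from pp_cases[OF ij] show ?thesis
  proof
    assume a: "alternates \<iota> i j \<and> pp \<iota> i j = 1 \<and> pp \<iota> j i = 0"
    note il = interleave[OF ij(1,2) ne(1) conjunct1[OF a]]
    have "pos j q < pos i r" if "q < r"
      using il(2)[of q] pos_le[OF ij(1), of "Suc q" r] that by simp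
    moreover have "pos i (Suc r) < pos j q" if "q > r"
      using il(1)[of q] pos_le[OF ij(1), of "Suc r" q] that by simp
    ultimately show ?thesis using il a by (cases q r rule: linorder_cases) force+
  next
    assume a: "alternates \<iota> j i \<and> pp \<iota> j i = 1 \<and> pp \<iota> i j = 0"
    note il = interleave[OF ij(2,1) ne(2) conjunct1[OF a]]
    have "pos j q < pos i r" if "q < Suc r"
      using il(1)[of r] pos_le[OF ij(2), of q r] that by simp
    moreover have "pos i (Suc r) < pos j q" if "q > Suc r"
      using il(2)[of "Suc r"] pos_le[OF ij(2), of "Suc (Suc r)" q] that by simp
    ultimately show ?thesis using il[of r] il(1)[of "Suc r"] a by (cases q "Suc r" rule: linorder_cases) force+
  qed
qed

section \<open>The forms \<open>beta\<close> in double indices\<close>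

definition nbrs :: "nat \<Rightarrow> nat set" where "nbrs l = {j \<in> {1..n}. cartan n l j < 0}"

lemma beta_pos:
  assumes l: "l \<in> {1..n}"
  shows "beta n \<iota> (pos l r) m = xf (pos l r) m + xf (pos l (Suc r)) m
     + (\<Sum>j\<in>nbrs l. of_int (cartan n l j) * xf (pos j (r + nat (pp \<iota> j l))) m)"
proof (cases "m \<ge> 1")
  case False
  have "xf (pos j q) m = 0" if "j \<in> {1..n}" for j q
    using False pos_props(1)[OF that, of q] by (auto simp: xf_def)
  moreover have "m \<noteq> pos l q" "\<not> pos l q < m" for q using False pos_props(1)[OF l, of q] by auto
  ultimately show ?thesis using l pos_props[OF l]
    by (simp add: beta_apply[OF seq] kplus_pos nbrs_def)
next
  case True
  define j where "j = \<iota> m"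
  obtain q where q: "m = pos j q" using ex_pos[OF True] by (auto simp: j_def)
  have j: "j \<in> {1..n}" using iota_range[OF True] by (simp add: j_def)
  have xf0: "xf (pos j' q') m = (if j' = j \<and> q' = q then 1 else 0)" if "j' \<in> {1..n}" for j' q'
    using pos_props(2)[OF that, of q'] pos_props(2)[OF j, of q] pos_eq[OF j] by (auto simp: xf_def q)
  have "(\<Sum>j'\<in>nbrs l. of_int (cartan n l j') * xf (pos j' (r + nat (pp \<iota> j' l))) m)
      = (\<Sum>j'\<in>nbrs l. if j' = j then of_int (cartan n l j) * (if q = r + nat (pp \<iota> j l) then 1 else 0) else 0)"
    by (intro sum.cong refl) (auto simp: nbrs_def xf0)
  also have "\<dots> = (if cartan n l j < 0 \<and> q = r + nat (pp \<iota> j l) then of_int (cartan n l j) else 0)"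
    using j by (simp add: nbrs_def)
  finally have sum: "(\<Sum>j'\<in>nbrs l. of_int (cartan n l j') * xf (pos j' (r + nat (pp \<iota> j' l))) m) = \<dots>" .
  have ne: "pos j q = pos l q' \<longleftrightarrow> j = l \<and> q = q'" for q'
    using pos_props(2)[OF l, of q'] pos_props(2)[OF j, of q] pos_eq[OF j] by auto
  show ?thesis unfolding sum
  proof (cases "j = l")
    case True
    then show "beta n \<iota> (pos l r) m = xf (pos l r) m + xf (pos l (Suc r)) m + (if cartan n l j < 0 \<and> q = r + nat (pp \<iota> j l) then of_int (cartan n l j) else 0)"
      using pos_props[OF l] pos_mono[OF l]
      by (simp add: beta_apply[OF seq] kplus_pos[OF l] xf_def q pos_eq[OF l] cartan_def)
  next
    case False
    have b: "beta n \<iota> (pos l r) m = (if pos l r < pos j q \<and> pos j q < pos l (Suc r) then of_int (cartan n l j) else 0)"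
      using False pos_props[OF l] pos_props[OF j] by (simp add: beta_apply[OF seq] kplus_pos[OF l] q ne)
    have x: "xf (pos l r) m = 0" "xf (pos l (Suc r)) m = 0" using False ne by (simp_all add: xf_def q)
    show "beta n \<iota> (pos l r) m = xf (pos l r) m + xf (pos l (Suc r)) m + (if cartan n l j < 0 \<and> q = r + nat (pp \<iota> j l) then of_int (cartan n l j) else 0)"
    proof (cases "cartan n l j < 0")
      case True
      then show ?thesis unfolding b x between_iff[OF l j True] by simp
    next
      case False
      then have "cartan n l j = 0" using \<open>j \<noteq> l\<close> by (auto simp: cartan_def split: if_splits)
      then show ?thesis unfolding b x by simp
    qed
  qed
qed

definition period :: int where "period = 2 * int n - 1"

text \<open>The factor \<open>2\<close> is \<open>- a\<^sub>2\<^sub>,\<^sub>1\<close>. The entry \<open>a\<^sub>n\<^sub>,\<^sub>n\<^sub>-\<^sub>1 = -2\<close> needs none, as a column of colour \<open>n\<close> has two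
  neighbours of colour \<open>n - 1\<close>.\<close>

definition nb :: "int \<Rightarrow> int \<Rightarrow> int \<Rightarrow> form" where
  "nb \<sigma> u v m = (if pi1 n v = 1 then 2 else 1) * xx \<iota> (\<sigma> + pp \<iota> (pi1 n v) (pi1 n u)) (pi1 n v) m"

text \<open>The representative of \<open>u\<close> in \<open>1..2n-1\<close>, that is, the position
  of a column within one period of colours.\<close>

definition res :: "int \<Rightarrow> int" where "res u = (u - 1) mod period + 1"

lemma res_range: "1 \<le> res u" "res u \<le> period"
proof -
  have "period > 0" using n3 by (simp add: period_def)
  from pos_mod_bound[OF this, of "u - 1"] pos_mod_sign[OF this, of "u - 1"]
  show "1 \<le> res u" "res u \<le> period" unfolding res_def by linarith+
qed

lemma pi1_res: "pi1 n u = nat (if res u \<le> int n then res u else 2 * int n - res u)"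
  by (simp add: pi1_def Let_def res_def period_def)

lemma pi1_range: "pi1 n u \<in> {1..n}"
  using res_range[of u] n3 by (auto simp: pi1_res period_def nat_le_iff le_nat_iff)

lemma res_mod: "u mod period = 0 \<longleftrightarrow> res u = period" "(u - 1) mod period = 0 \<longleftrightarrow> res u = 1"
proof -
  have "u mod period = res u mod period" by (simp add: res_def mod_add_left_eq)
  then show "u mod period = 0 \<longleftrightarrow> res u = period"
    using res_range[of u] by (cases "res u = period") (auto simp: mod_pos_pos_trivial)
qed (auto simp: res_def)

lemma res_Suc: "res (u + 1) = (if res u = period then 1 else res u + 1)"
proof -
  have "u mod period = res u mod period" by (simp add: res_def mod_add_left_eq)
  then show ?thesis using res_range[of u] by (auto simp: res_def[of "u + 1"] mod_pos_pos_trivial)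
qed

lemma res_pred: "res (u - 1) = (if res u = 1 then period else res u - 1)"
  using res_Suc[of "u - 1"] res_range[of u] res_range[of "u - 1"] by (auto split: if_splits)

lemma nbrs_eq: "nbrs 1 = {2}" "nbrs n = {n - 1}" "1 < l \<Longrightarrow> l < n \<Longrightarrow> nbrs l = {l - 1, l + 1}"
  using n3 by (auto simp: nbrs_def cartan_def split: if_splits)

lemma pp_nonneg: "0 \<le> pp \<iota> i j" by (simp add: pp_def)

text \<open>The columns \<open>u - 1\<close> and \<open>u + 1\<close> carry the colours adjacent to
  that of \<open>u\<close>, except across the edge between two columns of colour 1. At colour
  \<open>n\<close> both have colour \<open>n - 1\<close>, which accounts for
  \<open>a_(n,n-1) = -2\<close>; \<open>a_(2,1) = -2\<close> is the factor in
  \<open>nb\<close>.\<close>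

lemma beta_nb:
  assumes s: "\<sigma> \<ge> 1"
  shows "beta n \<iota> (pos (pi1 n u) (nat (\<sigma> - 1))) m = xx \<iota> \<sigma> (pi1 n u) m + xx \<iota> (\<sigma> + 1) (pi1 n u) m
     - (if (u - 1) mod period = 0 then 0 else nb \<sigma> u (u - 1) m)
     - (if u mod period = 0 then 0 else nb \<sigma> u (u + 1) m)"
proof -
  define l where "l = pi1 n u"
  have l: "l \<in> {1..n}" unfolding l_def by (rule pi1_range)
  have e1: "xf (pos j (nat (\<sigma> - 1) + nat (pp \<iota> j l))) = xx \<iota> (\<sigma> + pp \<iota> j l) j" if "j \<in> {1..n}" for j
    using s pp_nonneg[of j l] by (subst xx_pos[OF that]) (auto simp: nat_add_distrib[symmetric] algebra_simps)
  have e2: "xf (pos l (nat (\<sigma> - 1))) = xx \<iota> \<sigma> l" "xf (pos l (Suc (nat (\<sigma> - 1)))) = xx \<iota> (\<sigma> + 1) l"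
    using s by (simp_all add: xx_pos[OF l] Suc_nat_eq_nat_zadd1)
  have b: "beta n \<iota> (pos l (nat (\<sigma> - 1))) m = xx \<iota> \<sigma> l m + xx \<iota> (\<sigma> + 1) l m
     + (\<Sum>j\<in>nbrs l. of_int (cartan n l j) * xx \<iota> (\<sigma> + pp \<iota> j l) j m)"
    unfolding beta_pos[OF l] e2 by (simp add: e1 nbrs_def)
  define x where "x = res u"
  have x: "1 \<le> x" "x \<le> period" unfolding x_def by (rule res_range)+
  note facts = res_mod[of u, folded x_def] pi1_res[of "u + 1", unfolded res_Suc, folded x_def] pi1_res[of "u - 1", unfolded res_pred, folded x_def]
  have lx: "l = nat (if x \<le> int n then x else 2 * int n - x)" unfolding l_def x_def by (rule pi1_res)
  \<comment> \<open>The two ends of the period, its ascending and descending halves, and the turning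
    point \<open>n\<close>.\<close>
  consider "x = 1" | "1 < x" "x < int n" | "x = int n" | "int n < x" "x < period" | "x = period"
    using x by linarith
  then have "(\<Sum>j\<in>nbrs l. of_int (cartan n l j) * xx \<iota> (\<sigma> + pp \<iota> j l) j m)
    = - (if (u - 1) mod period = 0 then 0 else nb \<sigma> u (u - 1) m) - (if u mod period = 0 then 0 else nb \<sigma> u (u + 1) m)"
  proof cases
    case 1
    then have "l = 1" "pi1 n (u + 1) = 2" using n3 lx facts by (auto simp: period_def)
    then show ?thesis using 1 facts n3 by (simp add: nbrs_eq nbrs_eq(1)[unfolded One_nat_def] nb_def period_def cartan_def flip: l_def)
  next
    case 2
    then have *: "1 < l" "l < n" "pi1 n (u + 1) = l + 1" "pi1 n (u - 1) = l - 1" using n3 lx facts by (auto simp: period_def)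
    show ?thesis using 2 * facts n3 by (auto simp: nbrs_eq nb_def period_def cartan_def simp flip: l_def)
  next
    case 3
    then have *: "l = n" "pi1 n (u + 1) = n - 1" "pi1 n (u - 1) = n - 1" using n3 lx facts by (auto simp: period_def)
    show ?thesis using 3 * facts n3 by (auto simp: nbrs_eq nb_def period_def cartan_def simp flip: l_def)
  next
    case 4
    then have *: "1 < l" "l < n" "pi1 n (u + 1) = l - 1" "pi1 n (u - 1) = l + 1" using n3 lx facts by (auto simp: period_def)
    show ?thesis using 4 * facts n3 by (auto simp: nbrs_eq nb_def period_def cartan_def simp flip: l_def)
  next
    case 5
    then have "l = 1" "pi1 n (u - 1) = 2" using n3 lx facts by (auto simp: period_def)
    then show ?thesis using 5 facts n3 by (simp add: nbrs_eq nbrs_eq(1)[unfolded One_nat_def] nb_def period_def cartan_def flip: l_def)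
  qed
  then show ?thesis using b by (simp add: l_def)
qed

end

section \<open>Forms attached to column profiles\<close>

context adapted_A2
begin

text \<open>A profile \<open>c\<close> of type \<open>K\<close> has \<open>c t\<close> boxes in column \<open>t\<close>, of colour \<open>\<pi>\<^sub>1(K + t)\<close>. The edge \<open>e\<close>
  joins the columns \<open>e\<close> and \<open>e + 1\<close>; \<open>inn e\<close> is the one nearer to the centre \<open>0\<close>. For \<open>K \<ge> 2\<close> the
  profiles are the diagrams in \<open>REYD n K\<close>, with \<open>c t\<close> the depth of \<open>y\<^sub>t\<close> below the empty diagram. For
  \<open>K = 1\<close> only the columns \<open>t \<ge> 0\<close> are used, and \<open>c t\<close> is the length of a row of a Young wall.\<close>

definition relaxed :: "nat \<Rightarrow> int \<Rightarrow> bool" where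
  "relaxed K e \<longleftrightarrow> (int K + e) mod period = 0"

definition inn :: "int \<Rightarrow> int" where "inn e = (if e \<ge> 0 then e else e + 1)"
definition out :: "int \<Rightarrow> int" where "out e = (if e \<ge> 0 then e + 1 else e)"

definition drp :: "(int \<Rightarrow> int) \<Rightarrow> int \<Rightarrow> int" where "drp c e = c (inn e) - c (out e)"

text \<open>For \<open>K = 1\<close> the edges left of the centre are left free: the columns
  \<open>t < 0\<close> are empty there and bound nothing.\<close>

definition step_ok :: "nat \<Rightarrow> int \<Rightarrow> int \<Rightarrow> bool" where
  "step_ok K e d \<longleftrightarrow> (K = 1 \<and> e < 0) \<or> (0 \<le> d \<and> (\<not> relaxed K e \<longrightarrow> d \<le> 1))"

definition profile :: "nat \<Rightarrow> (int \<Rightarrow> int) \<Rightarrow> bool" where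
  "profile K c \<longleftrightarrow> finite {t. c t \<noteq> 0} \<and> (\<forall>t<0. K = 1 \<longrightarrow> c t = 0) \<and> (\<forall>e. step_ok K e (drp c e))"

text \<open>Across a relaxed edge only the presence of a drop counts: whatever its size, the edge
  contributes the same difference of variables, see \<open>edge_relaxed\<close>.\<close>

definition eff :: "nat \<Rightarrow> (int \<Rightarrow> int) \<Rightarrow> int \<Rightarrow> int" where
  "eff K c e = (if K = 1 \<and> e < 0 then 0 else if relaxed K e then min 1 (drp c e) else drp c e)"

text \<open>At a column of colour 1 the ordinary edge has weight 2 and the relaxed one weight 1.
  This is the source of the coefficient 2 of double points.\<close>

definition mul :: "nat \<Rightarrow> int \<Rightarrow> int \<Rightarrow> int" where
  "mul K t e = (if pi1 n (int K + t) = 1 \<and> \<not> relaxed K e then 2 else 1)"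

text \<open>One first index serves the admissible and the removable place of a column alike. For
  walls the last block of a row lies one column before the next slot, and the extra 1 in
  \<open>LY_re\<close> makes up for it.\<close>

definition lab :: "nat \<Rightarrow> nat \<Rightarrow> (int \<Rightarrow> int) \<Rightarrow> int \<Rightarrow> int" where
  "lab s K c t = int s + PT n \<iota> K (int K + t) + c t"

definition vx :: "nat \<Rightarrow> nat \<Rightarrow> (int \<Rightarrow> int) \<Rightarrow> int \<Rightarrow> form" where
  "vx s K c t = xx \<iota> (lab s K c t) (pi1 n (int K + t))"

text \<open>Weighted drop along the inner edge minus that along the outer edge. The centre has outer
  edges only, and the constant 1 of the empty profile, whose form is \<open>x_(s,K)\<close>.\<close>

definition wgt :: "nat \<Rightarrow> (int \<Rightarrow> int) \<Rightarrow> int \<Rightarrow> int" where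
  "wgt K c t =
     (if t = 0 then 1 - mul K 0 0 * eff K c 0 - mul K 0 (-1) * eff K c (-1)
      else if t > 0 then mul K t (t - 1) * eff K c (t - 1) - mul K t t * eff K c t
      else mul K t t * eff K c t - mul K t (t - 1) * eff K c (t - 1))"

definition frm :: "nat \<Rightarrow> nat \<Rightarrow> (int \<Rightarrow> int) \<Rightarrow> form" where
  "frm s K c m = (\<Sum>t | wgt K c t \<noteq> 0. of_int (wgt K c t) * vx s K c t m)"

definition edge :: "nat \<Rightarrow> nat \<Rightarrow> (int \<Rightarrow> int) \<Rightarrow> int \<Rightarrow> form" where
  "edge s K c e m = of_int (eff K c e) *
     (of_int (mul K (out e) e) * vx s K c (out e) m - of_int (mul K (inn e) e) * vx s K c (inn e) m)"

section \<open>The form of a profile as a sum over edges\<close>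

lemma eff_outside:
  assumes "\<forall>t. \<bar>t\<bar> \<ge> N \<longrightarrow> c t = 0" "e \<ge> N \<or> e < - N" "N \<ge> 0"
  shows "eff K c e = 0"
  using assms by (auto simp: eff_def drp_def inn_def out_def)

lemma frm_interval:
  assumes "\<forall>t. \<bar>t\<bar> \<ge> N \<longrightarrow> c t = 0" "N \<ge> 1"
  shows "frm s K c m = (\<Sum>t\<in>{-N..N}. of_int (wgt K c t) * vx s K c t m)"
  unfolding frm_def
proof (rule sum.mono_neutral_left)
  have "wgt K c t = 0" if "t \<notin> {-N..N}" for t
    using that eff_outside[OF assms(1), where K = K] assms(2) by (auto simp: wgt_def)
  then show "{t. wgt K c t \<noteq> 0} \<subseteq> {-N..N}" by blast
qed auto

text \<open>Summation by parts: \<open>A e\<close> and \<open>B e\<close> are the shares of the edge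
  \<open>e\<close> in the coefficients of the columns \<open>e\<close> and
  \<open>e + 1\<close>.\<close>

lemma frm_edges:
  assumes "\<forall>t. \<bar>t\<bar> \<ge> N \<longrightarrow> c t = 0" "N \<ge> 1"
  shows "frm s K c m = vx s K c 0 m + (\<Sum>e\<in>{-N-1..N}. edge s K c e m)"
proof -
  define A where "A t = of_int ((if t \<ge> 0 then - mul K t t else mul K t t) * eff K c t) * vx s K c t m" for t
  define B where "B e = of_int ((if e \<ge> 0 then mul K (e + 1) e else - mul K (e + 1) e) * eff K c e) * vx s K c (e + 1) m" for e
  have G: "edge s K c e m = A e + B e" for e
    by (simp add: edge_def A_def B_def inn_def out_def algebra_simps)
  have w: "of_int (wgt K c t) * vx s K c t m = (if t = 0 then vx s K c 0 m else 0) + A t + B (t - 1)" for t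
    by (auto simp: wgt_def A_def B_def algebra_simps)
  note eo = eff_outside[OF assms(1), where K = K]
  have AB0: "A (- N - 1) = 0" "B N = 0"
    using eo[of "-N-1"] eo[of N] assms(2) by (auto simp: A_def B_def)
  have "frm s K c m = (\<Sum>t\<in>{-N..N}. (if t = 0 then vx s K c 0 m else 0) + A t + B (t - 1))"
    unfolding frm_interval[OF assms] w ..
  also have "\<dots> = vx s K c 0 m + (\<Sum>t\<in>{-N..N}. A t) + (\<Sum>t\<in>{-N..N}. B (t - 1))"
    using assms(2) by (simp add: sum.distrib)
  also have "(\<Sum>t\<in>{-N..N}. A t) = (\<Sum>t\<in>{-N-1..N}. A t)"
  proof -
    have "{-N-1..N} = insert (-N-1) {-N..N}" using assms(2) by auto
    then show ?thesis using AB0 by simp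
  qed
  also have "(\<Sum>t\<in>{-N..N}. B (t - 1)) = (\<Sum>e\<in>{-N-1..N-1}. B e)"
    by (rule sum.reindex_bij_witness[of _ "\<lambda>e. e + 1" "\<lambda>t. t - 1"]) auto
  also have "\<dots> = (\<Sum>e\<in>{-N-1..N}. B e)"
    by (rule sum.mono_neutral_left) (use AB0 in auto)
  finally show ?thesis by (simp add: G sum.distrib)
qed

lemma PT_edge: "PT n \<iota> K (int K + out e) = PT n \<iota> K (int K + inn e) + pp \<iota> (pi1 n (int K + out e)) (pi1 n (int K + inn e))"
proof (cases "e \<ge> 0")
  case True
  have "{int K<..int K + (e + 1)} = insert (int K + (e + 1)) {int K<..int K + e}" using True by auto
  then show ?thesis using True by (simp add: PT_def inn_def out_def add.assoc)
next
  case False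
  have "{int K + e..<int K} = insert (int K + e) {int K + (e + 1)..<int K}" using False by auto
  then show ?thesis using False by (simp add: PT_def inn_def out_def add.assoc)
qed

lemma PT_nonneg: "PT n \<iota> K t \<ge> 0"
  by (auto simp: PT_def intro!: sum_nonneg pp_nonneg)

lemma pi1_eq_1: "pi1 n (int K + t) = 1 \<longleftrightarrow> relaxed K t \<or> relaxed K (t - 1)"
proof -
  have *: "relaxed K t \<longleftrightarrow> res (int K + t) = period" "relaxed K (t - 1) \<longleftrightarrow> res (int K + t) = 1"
    using res_mod[of "int K + t"] by (simp_all add: relaxed_def algebra_simps)
  show ?thesis unfolding * pi1_res using res_range[of "int K + t"] n3 by (auto simp: period_def)
qed

lemma relaxed_pi1: "relaxed K e \<Longrightarrow> pi1 n (int K + inn e) = 1 \<and> pi1 n (int K + out e) = 1"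
  using pi1_eq_1[of K e] pi1_eq_1[of K "e + 1"] by (auto simp: inn_def out_def)

lemma not_relaxed_both: "relaxed K t \<Longrightarrow> \<not> relaxed K (t - 1)"
  using res_mod[of "int K + t"] n3 by (auto simp: relaxed_def algebra_simps period_def)

text \<open>For \<open>K = 1\<close> the edge just left of the centre would be relaxed; it is
  excluded by the guard \<open>e < 0\<close> in the definitions.\<close>

lemma not_relaxed_centre: "K \<in> {1..n} \<Longrightarrow> \<not> relaxed K 0"
  and relaxed_minus_1: "K \<in> {1..n} \<Longrightarrow> relaxed K (-1) \<longleftrightarrow> K = 1"
  using n3 by (auto simp: relaxed_def period_def)

text \<open>The two colours are adjacent, so exactly one of them comes first in the
  sequence.\<close>

lemma pp_edge:
  assumes "\<not> relaxed K e"
  shows "pp \<iota> (pi1 n (int K + out e)) (pi1 n (int K + inn e)) + pp \<iota> (pi1 n (int K + inn e)) (pi1 n (int K + out e)) = 1"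
proof -
  define u where "u = int K + e"
  have ru: "res u \<noteq> period" using assms res_mod(1)[of u] by (auto simp: relaxed_def u_def)
  have "cartan n (pi1 n u) (pi1 n (u + 1)) < 0"
    unfolding pi1_res res_Suc using ru res_range[of u] n3
    by (auto simp: cartan_def period_def nat_eq_iff)
  from pp_cases[OF pi1_range pi1_range this] show ?thesis
    by (auto simp: inn_def out_def u_def add.assoc)
qed

text \<open>For drop 0 the labels at both ends agree because \<open>p_11 = 0\<close>, so the
  difference vanishes like the edge term; any positive drop has effective value 1.\<close>

lemma edge_relaxed:
  assumes "relaxed K e" "\<not> (K = 1 \<and> e < 0)" "step_ok K e (drp c e)"
  shows "edge s K c e m = vx s K c (out e) m - vx s K c (inn e) m"
proof (cases "drp c e = 0")
  case True
  have "vx s K c (out e) = vx s K c (inn e)"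
    using True PT_edge[of K e] relaxed_pi1[OF assms(1)] by (simp add: vx_def lab_def drp_def pp_def)
  then show ?thesis using assms by (simp add: edge_def mul_def)
next
  case False
  then have "eff K c e = 1" using assms by (auto simp: eff_def step_ok_def)
  then show ?thesis using assms(1) by (simp add: edge_def mul_def)
qed

text \<open>On an ordinary edge the drop must go from 1 to 0, which switches the edge term off. The
  inner label is \<open>sigma + 1 - p_(out,inn) = sigma + p_(inn,out)\<close>, so the inner variable
  is the neighbour term of \<open>beta\<close>.\<close>

lemma edge_change_out:
  fixes s m :: nat
  assumes "step_ok K e (drp c e)" "step_ok K e (drp c' e)" "c' = c(out e := c (out e) + 1)"
    and "\<not> (K = 1 \<and> e < 0)"
  defines "\<sigma> \<equiv> lab s K c (out e)" and "u \<equiv> int K + out e"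
  shows "edge s K c' e m - edge s K c e m =
    (if relaxed K e then xx \<iota> (\<sigma> + 1) (pi1 n u) m - xx \<iota> \<sigma> (pi1 n u) m
     else nb \<sigma> u (int K + inn e) m - of_int (mul K (out e) e) * xx \<iota> \<sigma> (pi1 n u) m)"
proof -
  have ne: "inn e \<noteq> out e" by (simp add: inn_def out_def)
  have lab': "lab s K c' (out e) = \<sigma> + 1" "lab s K c' (inn e) = lab s K c (inn e)"
    using ne by (simp_all add: lab_def assms(3) \<sigma>_def)
  have d: "drp c' e = drp c e - 1" using ne by (simp add: drp_def assms(3))
  show ?thesis
  proof (cases "relaxed K e")
    case True
    then show ?thesis using assms(1,2,4)
      by (simp add: edge_relaxed vx_def lab' flip: \<sigma>_def u_def)
  next
    case False
    then have dd: "drp c e = 1" "drp c' e = 0" using assms(1,2,4) d by (auto simp: step_ok_def)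
    have "lab s K c (inn e) = \<sigma> + pp \<iota> (pi1 n (int K + inn e)) (pi1 n u)"
      using PT_edge[of K e] pp_edge[OF False] dd(1) by (simp add: lab_def \<sigma>_def drp_def u_def)
    moreover have "eff K c e = 1" "eff K c' e = 0" using dd assms(4) False by (auto simp: eff_def)
    ultimately show ?thesis using False
      by (simp add: edge_def vx_def nb_def mul_def flip: \<sigma>_def u_def)
  qed
qed

text \<open>On an ordinary edge the drop goes from 0 to 1 and the edge term is switched on; the
  outer label is \<open>sigma + p_(out,inn)\<close>, again as in \<open>beta\<close>.\<close>

lemma edge_change_inn:
  fixes s m :: nat
  assumes "step_ok K e (drp c e)" "step_ok K e (drp c' e)" "c' = c(inn e := c (inn e) + 1)"
    and "\<not> (K = 1 \<and> e < 0)"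
  defines "\<sigma> \<equiv> lab s K c (inn e)" and "u \<equiv> int K + inn e"
  shows "edge s K c' e m - edge s K c e m =
    (if relaxed K e then xx \<iota> \<sigma> (pi1 n u) m - xx \<iota> (\<sigma> + 1) (pi1 n u) m
     else nb \<sigma> u (int K + out e) m - of_int (mul K (inn e) e) * xx \<iota> (\<sigma> + 1) (pi1 n u) m)"
proof -
  have ne: "inn e \<noteq> out e" by (simp add: inn_def out_def)
  have lab': "lab s K c' (inn e) = \<sigma> + 1" "lab s K c' (out e) = lab s K c (out e)"
    using ne by (simp_all add: lab_def assms(3) \<sigma>_def)
  have d: "drp c' e = drp c e + 1" using ne by (simp add: drp_def assms(3))
  show ?thesis
  proof (cases "relaxed K e")
    case True
    then show ?thesis using assms(1,2,4)
      by (simp add: edge_relaxed vx_def lab' flip: \<sigma>_def u_def)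
  next
    case False
    then have dd: "drp c e = 0" "drp c' e = 1" using assms(1,2,4) d by (auto simp: step_ok_def)
    have "lab s K c (out e) = \<sigma> + pp \<iota> (pi1 n (int K + out e)) (pi1 n u)"
      using PT_edge[of K e] dd(1) by (simp add: lab_def \<sigma>_def drp_def u_def)
    moreover have "eff K c e = 0" "eff K c' e = 1" using dd assms(4) False by (auto simp: eff_def)
    ultimately show ?thesis using False
      by (simp add: edge_def vx_def nb_def mul_def lab' flip: \<sigma>_def u_def)
  qed
qed

lemma edge_unguarded: "K = 1 \<and> e < 0 \<Longrightarrow> edge s K c e m = 0"
  by (simp add: edge_def eff_def)

section \<open>Adding a box to a profile\<close>

lemma profile_bound:
  assumes "finite {t. c t \<noteq> (0::int)}"
  obtains N :: int where "N \<ge> 1" "N \<ge> M" "\<forall>t. \<bar>t\<bar> \<ge> N \<longrightarrow> c t = 0"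
proof -
  define N where "N = Max (insert (max 1 M) ((\<lambda>t. \<bar>t\<bar> + 1) ` {t. c t \<noteq> 0}))"
  have fin: "finite (insert (max 1 M) ((\<lambda>t. \<bar>t\<bar> + 1) ` {t. c t \<noteq> 0}))" using assms by simp
  have "max 1 M \<le> N" unfolding N_def by (rule Max_ge[OF fin]) simp
  moreover have "c t = 0" if "\<bar>t\<bar> \<ge> N" for t
  proof (rule ccontr)
    assume "c t \<noteq> 0"
    then have "\<bar>t\<bar> + 1 \<le> N" unfolding N_def by (intro Max_ge[OF fin]) simp
    with that show False by simp
  qed
  ultimately show ?thesis by (intro that[of N]) auto
qed

text \<open>Going outwards from \<open>t\<close>, the values do not increase and finally reach
  0.\<close>

lemma profile_nonneg:
  assumes "profile K c"
  shows "c t \<ge> 0"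
proof -
  obtain N :: int where N: "N \<ge> 1" "\<forall>t. \<bar>t\<bar> \<ge> N \<longrightarrow> c t = 0"
    using assms profile_bound[of c 1] unfolding profile_def by metis
  have d: "\<not> (K = 1 \<and> e < 0) \<Longrightarrow> c (inn e) \<ge> c (out e)" for e
    using assms by (auto simp: profile_def step_ok_def drp_def)
  show ?thesis
  proof (cases "t \<ge> 0")
    case True
    have "c t \<ge> c (t + int k)" for k
    proof (induction k)
      case (Suc k)
      then show ?case using d[of "t + int k"] True by (simp add: inn_def out_def algebra_simps)
    qed simp
    from this[of "nat N"] show ?thesis using N True by auto
  next
    case False
    show ?thesis
    proof (cases "K = 1")
      case True
      then show ?thesis using False assms by (simp add: profile_def)
    next
      case K: False
      have "c t \<ge> c (t - int k)" for k
      proof (induction k)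
        case (Suc k)
        then show ?case using d[of "t - int k - 1"] False K by (simp add: inn_def out_def algebra_simps)
      qed simp
      from this[of "nat N"] show ?thesis using N False by auto
    qed
  qed
qed

lemma lab_ge_1: "profile K c \<Longrightarrow> s \<ge> 1 \<Longrightarrow> lab s K c t \<ge> 1"
  using PT_nonneg[of K "int K + t"] profile_nonneg[of K c t] by (simp add: lab_def)

definition vpos :: "nat \<Rightarrow> nat \<Rightarrow> (int \<Rightarrow> int) \<Rightarrow> int \<Rightarrow> nat" where
  "vpos s K c t = pos (pi1 n (int K + t)) (nat (lab s K c t - 1))"

lemma vx_xf: "profile K c \<Longrightarrow> s \<ge> 1 \<Longrightarrow> vx s K c t = xf (vpos s K c t)"
  unfolding vx_def vpos_def by (rule xx_pos[OF pi1_range lab_ge_1])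

text \<open>Only the two edges at column \<open>t\<close> change and, for \<open>t = 0\<close>, the
  central variable. Ordinary edges give the neighbour terms. At colour 1 the relaxed edge gives
  \<open>x_(sigma+1) - x_sigma\<close> or its negative; with weight 2 on the other edge the total is
  again \<open>- x_sigma - x_(sigma+1)\<close>. For \<open>K = 1\<close> and \<open>t = 0\<close>
  the change of the central variable takes the place of the relaxed edge.\<close>

lemma frm_add_box:
  assumes K: "K \<in> {1..n}" and s: "s \<ge> 1" and c: "profile K c" and c': "profile K c'"
    and c'_def: "c' = c(t := c t + 1)"
  shows "frm s K c' m = frm s K c m - beta n \<iota> (vpos s K c t) m"
proof -
  define \<sigma> where "\<sigma> = lab s K c t"
  define u where "u = int K + t"
  have \<sigma>1: "\<sigma> \<ge> 1" unfolding \<sigma>_def by (rule lab_ge_1[OF c s])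
  have Kt: "t \<ge> 0" if "K = 1"
  proof (rule ccontr)
    assume "\<not> t \<ge> 0"
    then have "c t = 0" "c' t = 0" using c c' that by (auto simp: profile_def)
    then show False by (simp add: c'_def)
  qed
  obtain N :: int where N: "N \<ge> 1" "N \<ge> \<bar>t\<bar> + 1" "\<forall>x. \<bar>x\<bar> \<ge> N \<longrightarrow> c x = 0"
    using c profile_bound[of c "\<bar>t\<bar> + 1"] unfolding profile_def by metis
  have N': "\<forall>x. \<bar>x\<bar> \<ge> N \<longrightarrow> c' x = 0" using N by (auto simp: c'_def)
  have same: "edge s K c' e m - edge s K c e m = 0" if "e \<notin> {t - 1, t}" for e
    using that by (auto simp: edge_def eff_def drp_def vx_def lab_def c'_def inn_def out_def)
  have "frm s K c' m - frm s K c m = (vx s K c' 0 m - vx s K c 0 m) + (\<Sum>e\<in>{-N-1..N}. edge s K c' e m - edge s K c e m)"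
    unfolding frm_edges[OF N(3,1)] frm_edges[OF N' N(1)] by (simp add: sum_subtractf)
  also have "(\<Sum>e\<in>{-N-1..N}. edge s K c' e m - edge s K c e m) = (\<Sum>e\<in>{t - 1, t}. edge s K c' e m - edge s K c e m)"
    by (rule sum.mono_neutral_right) (use N same in auto)
  also have "\<dots> = (edge s K c' (t - 1) m - edge s K c (t - 1) m) + (edge s K c' t m - edge s K c t m)"
    by simp
  finally have diff: "frm s K c' m - frm s K c m = (vx s K c' 0 m - vx s K c 0 m) +
     ((edge s K c' (t - 1) m - edge s K c (t - 1) m) + (edge s K c' t m - edge s K c t m))" .
  have ok: "step_ok K e (drp c e)" "step_ok K e (drp c' e)" for e using c c' by (auto simp: profile_def)
  have v0: "vx s K c' 0 m - vx s K c 0 m = (if t = 0 then xx \<iota> (\<sigma> + 1) (pi1 n u) m - xx \<iota> \<sigma> (pi1 n u) m else 0)"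
    by (simp add: vx_def lab_def c'_def \<sigma>_def u_def ac_simps)
  have b: "beta n \<iota> (vpos s K c t) m = xx \<iota> \<sigma> (pi1 n u) m + xx \<iota> (\<sigma> + 1) (pi1 n u) m
     - (if relaxed K (t - 1) then 0 else nb \<sigma> u (u - 1) m) - (if relaxed K t then 0 else nb \<sigma> u (u + 1) m)"
    using beta_nb[OF \<sigma>1, of u m] by (simp add: vpos_def relaxed_def u_def \<sigma>_def algebra_simps)
  have mul: "mul K t e = (if (relaxed K t \<or> relaxed K (t - 1)) \<and> \<not> relaxed K e then 2 else 1)" for e
    unfolding mul_def pi1_eq_1 by simp
  note nrb = not_relaxed_both[of K t]
  consider "t > 0" | "t < 0" | "t = 0" by linarith
  then show ?thesis
  proof cases
    case 1
    have io: "inn t = t" "out t = t + 1" "inn (t - 1) = t - 1" "out (t - 1) = t" using 1 by (auto simp: inn_def out_def)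
    have "edge s K c' t m - edge s K c t m =
    (if relaxed K t then xx \<iota> \<sigma> (pi1 n u) m - xx \<iota> (\<sigma> + 1) (pi1 n u) m
     else nb \<sigma> u (u + 1) m - of_int (mul K t t) * xx \<iota> (\<sigma> + 1) (pi1 n u) m)"
      using edge_change_inn[of K t c c' s m, OF ok, unfolded io] 1 c'_def by (simp add: \<sigma>_def u_def add.assoc)
    moreover have "edge s K c' (t - 1) m - edge s K c (t - 1) m =
    (if relaxed K (t - 1) then xx \<iota> (\<sigma> + 1) (pi1 n u) m - xx \<iota> \<sigma> (pi1 n u) m
     else nb \<sigma> u (u - 1) m - of_int (mul K t (t - 1)) * xx \<iota> \<sigma> (pi1 n u) m)"
      using edge_change_out[of K "t - 1" c c' s m, OF ok, unfolded io] 1 c'_def by (simp add: \<sigma>_def u_def algebra_simps)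
    ultimately show ?thesis using diff v0 b mul nrb 1 by (auto split: if_splits)
  next
    case 2
    then have K1: "K \<noteq> 1" using Kt by auto
    have io: "inn t = t + 1" "out t = t" "inn (t - 1) = t" "out (t - 1) = t - 1" using 2 by (auto simp: inn_def out_def)
    have "edge s K c' t m - edge s K c t m =
    (if relaxed K t then xx \<iota> (\<sigma> + 1) (pi1 n u) m - xx \<iota> \<sigma> (pi1 n u) m
     else nb \<sigma> u (u + 1) m - of_int (mul K t t) * xx \<iota> \<sigma> (pi1 n u) m)"
      using edge_change_out[of K t c c' s m, OF ok, unfolded io] K1 c'_def by (simp add: \<sigma>_def u_def add.assoc)
    moreover have "edge s K c' (t - 1) m - edge s K c (t - 1) m =
    (if relaxed K (t - 1) then xx \<iota> \<sigma> (pi1 n u) m - xx \<iota> (\<sigma> + 1) (pi1 n u) m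
     else nb \<sigma> u (u - 1) m - of_int (mul K t (t - 1)) * xx \<iota> (\<sigma> + 1) (pi1 n u) m)"
      using edge_change_inn[of K "t - 1" c c' s m, OF ok, unfolded io] K1 c'_def by (simp add: \<sigma>_def u_def algebra_simps)
    ultimately show ?thesis using diff v0 b mul nrb 2 by (auto split: if_splits)
  next
    case 3
    have io: "inn t = t" "out t = t + 1" "inn (t - 1) = t" "out (t - 1) = t - 1" using 3 by (auto simp: inn_def out_def)
    have r: "\<not> relaxed K t" "relaxed K (t - 1) \<longleftrightarrow> K = 1"
      using not_relaxed_centre[OF K] relaxed_minus_1[OF K] 3 by auto
    have "edge s K c' t m - edge s K c t m =
    (if relaxed K t then xx \<iota> \<sigma> (pi1 n u) m - xx \<iota> (\<sigma> + 1) (pi1 n u) m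
     else nb \<sigma> u (u + 1) m - of_int (mul K t t) * xx \<iota> (\<sigma> + 1) (pi1 n u) m)"
      using edge_change_inn[of K t c c' s m, OF ok, unfolded io] 3 c'_def by (simp add: \<sigma>_def u_def add.assoc)
    moreover have "edge s K c' (t - 1) m - edge s K c (t - 1) m =
    (if K = 1 then 0
     else nb \<sigma> u (u - 1) m - of_int (mul K t (t - 1)) * xx \<iota> (\<sigma> + 1) (pi1 n u) m)"
    proof (cases "K = 1")
      case True
      then show ?thesis using 3 by (simp add: edge_unguarded)
    next
      case False
      then show ?thesis
        using edge_change_inn[of K "t - 1" c c' s m, OF ok, unfolded io] r c'_def by (simp add: \<sigma>_def u_def algebra_simps)
    qed
    ultimately show ?thesis using diff v0 b mul r 3 by (auto split: if_splits)
  qed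
qed

end

section \<open>Revised extended Young diagrams as profiles\<close>

context adapted_A2
begin

lemma mul_eq: "mul K t e = (if (relaxed K t \<or> relaxed K (t - 1)) \<and> \<not> relaxed K e then 2 else 1)"
  unfolding mul_def pi1_eq_1 by simp

lemma drp_upd:
  "t > 0 \<Longrightarrow> drp (c(t := c t + d)) t = drp c t + d"
  "t > 0 \<Longrightarrow> drp (c(t := c t + d)) (t - 1) = drp c (t - 1) - d"
  "t < 0 \<Longrightarrow> drp (c(t := c t + d)) t = drp c t - d"
  "t < 0 \<Longrightarrow> drp (c(t := c t + d)) (t - 1) = drp c (t - 1) + d"
  "drp (c(0 := c 0 + d)) 0 = drp c 0 + d"
  "drp (c(0 := c 0 + d)) (- 1) = drp c (- 1) + d"
  by (auto simp: drp_def inn_def out_def)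

lemma drp_upd_other: "e \<noteq> t \<Longrightarrow> e \<noteq> t - 1 \<Longrightarrow> drp (c(t := v)) e = drp c e"
  by (auto simp: drp_def inn_def out_def)

lemma profile_upd:
  assumes "profile K c" "K = 1 \<longrightarrow> t \<ge> 0"
  shows "profile K (c(t := v)) \<longleftrightarrow>
    step_ok K t (drp (c(t := v)) t) \<and> step_ok K (t - 1) (drp (c(t := v)) (t - 1))"
proof -
  have "finite {x. (c(t := v)) x \<noteq> 0}"
    using assms(1) by (auto simp: profile_def intro: rev_finite_subset[of "insert t {x. c x \<noteq> 0}"])
  moreover have "K = 1 \<longrightarrow> (c(t := v)) x = 0" if "x < 0" for x using assms that by (auto simp: profile_def)
  moreover have "step_ok K e (drp (c(t := v)) e)" if "e \<noteq> t" "e \<noteq> t - 1" for e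
    using assms(1) that by (simp add: drp_upd_other profile_def)
  ultimately show ?thesis unfolding profile_def by metis
qed

lemma profile_step: "profile K c \<Longrightarrow> step_ok K e (drp c e)"
  by (simp add: profile_def)

lemma profile_add_pos:
  assumes "profile K c" "t > 0"
  shows "profile K (c(t := c t + d)) \<longleftrightarrow> step_ok K t (drp c t + d) \<and> step_ok K (t - 1) (drp c (t - 1) - d)"
  using profile_upd[OF assms(1), of t "c t + d"] assms(2) by (simp add: drp_upd)

lemma profile_add_neg:
  assumes "profile K c" "t < 0" "K \<noteq> 1"
  shows "profile K (c(t := c t + d)) \<longleftrightarrow> step_ok K t (drp c t - d) \<and> step_ok K (t - 1) (drp c (t - 1) + d)"
  using profile_upd[OF assms(1), of t "c t + d"] assms(2,3) by (simp add: drp_upd)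

lemma profile_add_0:
  assumes "profile K c"
  shows "profile K (c(0 := c 0 + d)) \<longleftrightarrow> step_ok K 0 (drp c 0 + d) \<and> step_ok K (- 1) (drp c (- 1) + d)"
  using profile_upd[OF assms(1), of 0 "c 0 + d"] by (simp add: drp_upd)

text \<open>Weight of a non-central column in terms of the drops \<open>a\<close> and \<open>b\<close> along its inner and
  outer edge, which are relaxed if \<open>A\<close>, resp. \<open>B\<close>, holds.\<close>

definition cwgt :: "bool \<Rightarrow> bool \<Rightarrow> int \<Rightarrow> int \<Rightarrow> int" where
  "cwgt A B a b = (if B then 2 else 1) * (if A then min 1 a else a) - (if A then 2 else 1) * (if B then min 1 b else b)"

lemma wgt_cases:
  assumes "K \<in> {1..n}"
  shows "t > 0 \<Longrightarrow> wgt K c t = cwgt (relaxed K (t - 1)) (relaxed K t) (drp c (t - 1)) (drp c t)"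
    and "t < 0 \<Longrightarrow> K \<noteq> 1 \<Longrightarrow> wgt K c t = cwgt (relaxed K t) (relaxed K (t - 1)) (drp c t) (drp c (t - 1))"
    and "K \<noteq> 1 \<Longrightarrow> wgt K c 0 = 1 - drp c 0 - drp c (- 1)"
    and "K = 1 \<Longrightarrow> wgt K c 0 = 1 - 2 * drp c 0"
    and "t < 0 \<Longrightarrow> K = 1 \<Longrightarrow> wgt K c t = 0"
  using not_relaxed_both[of K t] not_relaxed_centre[OF assms] relaxed_minus_1[OF assms]
  by (auto simp: wgt_def cwgt_def eff_def mul_eq)

text \<open>Away from the centre a positive weight forces a drop along the inner edge and, unless
  the outer edge is relaxed, none along the outer one; at the centre it forces no drop along any
  edge in use. These are the conditions for adding a box.\<close>

lemma wgt_pos_add: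
  assumes K: "K \<in> {1..n}" and c: "profile K c" and w: "wgt K c t > 0"
  shows "profile K (c(t := c t + 1))"
proof -
  note st = profile_step[OF c]
  note wc = wgt_cases[OF K]
  consider "t > 0" | "t < 0" "K \<noteq> 1" | "t = 0" "K \<noteq> 1" | "t = 0" "K = 1"
    using w wc(5)[of t c] by fastforce
  then show ?thesis
  proof cases
    case 1
    then show ?thesis using w st[of t] st[of "t - 1"] not_relaxed_both[of K t] unfolding profile_add_pos[OF c 1] wc(1)[OF 1]
      by (auto simp: step_ok_def cwgt_def split: if_splits)
  next
    case 2
    then show ?thesis using w st[of t] st[of "t - 1"] not_relaxed_both[of K t] unfolding profile_add_neg[OF c 2] wc(2)[OF 2]
      by (auto simp: step_ok_def cwgt_def split: if_splits)
  next
    case 3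
    then show ?thesis using w st[of 0] st[of "- 1"] profile_add_0[OF c, of 1] wc(3)[OF 3(2)]
      by (auto simp: step_ok_def)
  next
    case 4
    then show ?thesis using w st[of 0] st[of "- 1"] profile_add_0[OF c, of 1] wc(4)[OF 4(2)]
      by (auto simp: step_ok_def)
  qed
qed

text \<open>Dual to \<open>wgt_pos_add\<close>: away from the centre there is a drop along the outer
  edge and, unless the inner edge is relaxed, none along the inner one.\<close>

lemma wgt_neg_remove:
  assumes K: "K \<in> {1..n}" and c: "profile K c" and w: "wgt K c t < 0"
  shows "profile K (c(t := c t - 1))"
proof -
  note st = profile_step[OF c]
  note wc = wgt_cases[OF K]
  consider "t > 0" | "t < 0" "K \<noteq> 1" | "t = 0" "K \<noteq> 1" | "t = 0" "K = 1"
    using w wc(5)[of t c] by fastforce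
  then show ?thesis
  proof cases
    case 1
    then show ?thesis using w st[of t] st[of "t - 1"] not_relaxed_both[of K t] profile_add_pos[OF c 1, of "-1"] unfolding wc(1)[OF 1]
      by (auto simp: step_ok_def cwgt_def split: if_splits)
  next
    case 2
    then show ?thesis using w st[of t] st[of "t - 1"] not_relaxed_both[of K t] profile_add_neg[OF c 2, of "-1"] unfolding wc(2)[OF 2]
      by (auto simp: step_ok_def cwgt_def split: if_splits)
  next
    case 3
    then show ?thesis using w st[of 0] st[of "- 1"] profile_add_0[OF c, of "-1"] wc(3)[OF 3(2)] not_relaxed_centre[OF K] relaxed_minus_1[OF K]
      by (auto simp: step_ok_def)
  next
    case 4
    then show ?thesis using w st[of 0] st[of "- 1"] profile_add_0[OF c, of "-1"] wc(4)[OF 4(2)]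
      by (auto simp: step_ok_def)
  qed
qed

text \<open>The instance for \<open>Sprime_closed\<close>; \<open>Omega_eq\<close> identifies it
  with the forms of all diagrams and walls.\<close>

definition Omega :: "form set" where
  "Omega = {frm s K c | s K c. s \<ge> 1 \<and> K \<in> {1..n} \<and> profile K c}"

lemma profile_0: "profile K (\<lambda>_. 0)"
  by (auto simp: profile_def step_ok_def drp_def)

lemma pi1_id: "K \<in> {1..n} \<Longrightarrow> pi1 n (int K) = K"
  using n3 by (auto simp: pi1_def Let_def mod_pos_pos_trivial)

lemma frm_0:
  assumes "K \<in> {1..n}" "s \<ge> 1"
  shows "frm s K (\<lambda>_. 0) = xx \<iota> (int s) K"
proof
  fix m
  have "wgt K (\<lambda>_. 0) t = (if t = 0 then 1 else 0)" for t
    by (simp add: wgt_def eff_def drp_def)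
  then show "frm s K (\<lambda>_. 0) m = xx \<iota> (int s) K m"
    by (simp add: frm_def vx_def lab_def pi1_id[OF assms(1)] PT_def)
qed

text \<open>Several columns may carry the same variable, so a coefficient need not be a single
  weight; but some summand must share its sign.\<close>

lemma frm_pos_ex:
  assumes "frm s K c m > 0" "profile K c" "s \<ge> 1"
  obtains t where "wgt K c t > 0" "vpos s K c t = m"
proof -
  have "\<exists>t\<in>{t. wgt K c t \<noteq> 0}. of_int (wgt K c t) * vx s K c t m > 0"
  proof (rule ccontr)
    assume "\<not> ?thesis"
    then have "frm s K c m \<le> 0" unfolding frm_def by (intro sum_nonpos) (auto simp: not_less)
    then show False using assms(1) by simp
  qed
  then obtain t where "of_int (wgt K c t) * vx s K c t m > 0" by blast
  then show ?thesis using that[of t] by (auto simp: vx_xf[OF assms(2,3)] xf_def split: if_splits)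
qed

lemma frm_neg_ex:
  assumes "frm s K c m < 0" "profile K c" "s \<ge> 1"
  obtains t where "wgt K c t < 0" "vpos s K c t = m"
proof -
  have "\<exists>t\<in>{t. wgt K c t \<noteq> 0}. of_int (wgt K c t) * vx s K c t m < 0"
  proof (rule ccontr)
    assume "\<not> ?thesis"
    then have "frm s K c m \<ge> 0" unfolding frm_def by (intro sum_nonneg) (auto simp: not_less)
    then show False using assms(1) by simp
  qed
  then obtain t where "of_int (wgt K c t) * vx s K c t m < 0" by blast
  then show ?thesis using that[of t] by (auto simp: vx_xf[OF assms(2,3)] xf_def split: if_splits)
qed

text \<open>The label of the smaller profile is still at least 1, so the variable at
  \<open>t\<close> is not the first of its colour. The positivity condition rests on this.\<close>

lemma kminus_vpos:
  assumes "profile K (c(t := c t - 1))" "s \<ge> 1"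
  shows "kminus \<iota> (vpos s K c t) = vpos s K (c(t := c t - 1)) t" "kminus \<iota> (vpos s K c t) \<noteq> 0"
proof -
  have "lab s K c t = lab s K (c(t := c t - 1)) t + 1" by (simp add: lab_def)
  then have "nat (lab s K c t - 1) = Suc (nat (lab s K (c(t := c t - 1)) t - 1))"
    using lab_ge_1[OF assms, of t] by simp
  then show "kminus \<iota> (vpos s K c t) = vpos s K (c(t := c t - 1)) t"
    by (simp add: vpos_def kminus_pos(2)[OF pi1_range])
  then show "kminus \<iota> (vpos s K c t) \<noteq> 0"
    using pos_props(1)[OF pi1_range, of "int K + t" "nat (lab s K (c(t := c t - 1)) t - 1)"]
    by (simp add: vpos_def)
qed

text \<open>\<open>S'_m\<close> adds a box at a column of positive weight or removes one at a column
  of negative weight; the coordinates are the forms of empty profiles.\<close>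

lemma Sprime_closed_Omega: "Sprime_closed n \<iota> Omega"
proof
  show "index_seq n \<iota>" by (rule seq)
next
  fix j :: nat assume j: "j \<ge> 1"
  obtain r where r: "j = pos (\<iota> j) r" using ex_pos[OF j] by blast
  have "xf j = frm (Suc r) (\<iota> j) (\<lambda>_. 0)"
    using r iota_range[OF j] by (simp add: frm_0 xx_pos)
  then show "xf j \<in> Omega" using iota_range[OF j] profile_0 unfolding Omega_def
    by (intro CollectI exI[of _ "Suc r"] exI[of _ "\<iota> j"] exI[of _ "\<lambda>_. 0"]) simp
next
  fix f m assume "f \<in> Omega"
  then show "f m \<in> \<int>"
    by (auto simp: Omega_def frm_def vx_xf xf_def intro!: Ints_sum Ints_mult)
next
  fix f and m :: nat assume "f \<in> Omega" and m: "m \<ge> 1"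
  then obtain s K c where f: "f = frm s K c" and s: "s \<ge> 1" and K: "K \<in> {1..n}" and c: "profile K c"
    by (auto simp: Omega_def)
  consider "f m > 0" | "f m < 0" | "f m = 0" by linarith
  then show "Sprime n \<iota> m f \<in> Omega"
  proof cases
    case 1
    then obtain t where t: "wgt K c t > 0" "vpos s K c t = m" using frm_pos_ex[OF _ c s] unfolding f by blast
    note c' = wgt_pos_add[OF K c t(1)]
    have "Sprime n \<iota> m f = frm s K (c(t := c t + 1))"
      using 1 frm_add_box[OF K s c c' refl] by (simp add: Sprime_def f t(2) fun_eq_iff)
    then show ?thesis using s K c' by (auto simp: Omega_def)
  next
    case 2
    then obtain t where t: "wgt K c t < 0" "vpos s K c t = m" using frm_neg_ex[OF _ c s] unfolding f by blast
    note c' = wgt_neg_remove[OF K c t(1)]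
    have "frm s K c m' = frm s K (c(t := c t - 1)) m' - beta n \<iota> (kminus \<iota> m) m'" for m'
      using frm_add_box[OF K s c' c, of t m'] kminus_vpos(1)[OF c' s] by (simp add: t(2))
    then have "Sprime n \<iota> m f = frm s K (c(t := c t - 1))"
      using 2 by (simp add: Sprime_def f fun_eq_iff)
    then show ?thesis using s K c' by (auto simp: Omega_def)
  next
    case 3
    then have "Sprime n \<iota> m f = f" by (simp add: Sprime_def)
    then show ?thesis using \<open>f \<in> Omega\<close> by simp
  qed
next
  fix f and m :: nat assume "f \<in> Omega" and m: "m \<ge> 1" "kminus \<iota> m = 0"
  then obtain s K c where f: "f = frm s K c" and s: "s \<ge> 1" and K: "K \<in> {1..n}" and c: "profile K c"
    by (auto simp: Omega_def)
  show "f m \<ge> 0"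
  proof (rule ccontr)
    assume "\<not> f m \<ge> 0"
    then obtain t where t: "wgt K c t < 0" "vpos s K c t = m" using frm_neg_ex[OF _ c s] unfolding f by (metis not_le)
    from kminus_vpos(2)[OF wgt_neg_remove[OF K c t(1)] s] t(2) m show False by simp
  qed
qed

section \<open>From diagrams to profiles\<close>

definition depth :: "nat \<Rightarrow> (int \<Rightarrow> int) \<Rightarrow> int \<Rightarrow> int" where
  "depth k y = (\<lambda>t. int k + min t 0 - y t)"

lemma depth_depth: "depth k (depth k y) = y"
  by (simp add: depth_def)

lemma depth_upd: "depth k (y(t := y t + d)) = (depth k y)(t := depth k y t + - d)"
  by (auto simp: depth_def)

lemma drp_depth: "drp (depth k y) t = (if t \<ge> 0 then y (t + 1) - y t else 1 + y t - y (t + 1))"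
  by (auto simp: drp_def depth_def inn_def out_def)

text \<open>The conditions agree edge by edge: the drop is \<open>y_(t+1) - y_t\<close> for
  \<open>t \<ge> 0\<close> and \<open>1 + y_t - y_(t+1)\<close> for \<open>t < 0\<close>. A relaxed
  edge 0, about which \<open>REYD\<close> says nothing, does not occur as \<open>k\<close> lies in
  \<open>2..n\<close>.\<close>

lemma REYD_iff:
  assumes k: "k \<in> {2..n}"
  shows "y \<in> REYD n k \<longleftrightarrow> profile k (depth k y)"
proof -
  have "(\<exists>N. \<forall>t\<ge>N. y t = int k) \<and> (\<exists>N. \<forall>t\<le>N. y t = int k + t) \<longleftrightarrow> finite {t. depth k y t \<noteq> 0}"
  proof
    assume "(\<exists>N. \<forall>t\<ge>N. y t = int k) \<and> (\<exists>N. \<forall>t\<le>N. y t = int k + t)"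
    then obtain N M where "\<forall>t\<ge>N. y t = int k" "\<forall>t\<le>M. y t = int k + t" by blast
    then have "depth k y t = 0" if "t \<notin> {min M 0..max N 0}" for t
      using that by (cases "t > max N 0") (auto simp: depth_def)
    then have "{t. depth k y t \<noteq> 0} \<subseteq> {min M 0..max N 0}" by blast
    then show "finite {t. depth k y t \<noteq> 0}" by (rule finite_subset) simp
  next
    assume "finite {t. depth k y t \<noteq> 0}"
    then obtain N :: int where N: "N \<ge> 1" "\<forall>t. \<bar>t\<bar> \<ge> N \<longrightarrow> depth k y t = 0"
      using profile_bound[of "depth k y" 1] by metis
    have "y t = int k + min t 0" if "\<bar>t\<bar> \<ge> N" for t
      using N(2) that by (simp add: depth_def)
    then have "\<forall>t\<ge>N. y t = int k" "\<forall>t\<le>-N. y t = int k + t" using N(1) by auto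
    then show "(\<exists>N. \<forall>t\<ge>N. y t = int k) \<and> (\<exists>N. \<forall>t\<le>N. y t = int k + t)" by blast
  qed
  moreover have "(if (int k + t) mod (2 * int n - 1) \<noteq> 0 then y (t + 1) \<in> {y t, y t + 1}
           else (t > 0 \<longrightarrow> y (t + 1) \<ge> y t) \<and> (t < 0 \<longrightarrow> y (t + 1) \<le> y t + 1)) \<longleftrightarrow> step_ok k t (drp (depth k y) t)" for t
    using k not_relaxed_centre[of k] by (cases "t = 0") (auto simp: step_ok_def drp_depth relaxed_def period_def)
  ultimately show ?thesis using k by (auto simp: REYD_def profile_def)
qed

text \<open>The two counts are the multiplicities, 0, 1 or 2, of the column as an admissible and as
  a removable point; 2 occurs next to a relaxed edge without drop.\<close>

lemma cwgt_count:
  assumes "0 \<le> a" "0 \<le> b" "\<not> (A \<and> B)" "\<not> A \<longrightarrow> a \<le> 1" "\<not> B \<longrightarrow> b \<le> 1"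
  shows "cwgt A B a b =
     (if 0 \<le> a - 1 \<and> (\<not> B \<longrightarrow> b + 1 \<le> 1) then if B \<and> 0 < a \<and> b = 0 then 2 else 1 else 0)
   - (if (\<not> A \<longrightarrow> a + 1 \<le> 1) \<and> 0 \<le> b - 1 then if A \<and> a = 0 \<and> 0 < b then 2 else 1 else 0)"
  using assms by (auto simp: cwgt_def)

lemma sum_doubled:
  fixes f :: "'a \<Rightarrow> rat"
  assumes "D \<subseteq> R" "finite R"
  shows "(\<Sum>x\<in>R - D. f x) + (\<Sum>x\<in>D. 2 * f x) = (\<Sum>x\<in>R. (if x \<in> D then 2 else 1) * f x)"
  unfolding sum.subset_diff[OF assms] by (intro arg_cong2[where f = "(+)"] sum.cong) auto

text \<open>An admissible point \<open>i\<close> concerns column \<open>i\<close>, a removable point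
  \<open>i\<close> concerns column \<open>i - 1\<close>. Column by column, the multiplicity of the
  admissible minus that of the removable point is the weight.\<close>

lemma LT_frm:
  assumes k: "k \<in> {2..n}" and y: "y \<in> REYD n k"
  shows "LT n \<iota> s k y = frm s k (depth k y)"
proof
  fix m
  define c where "c = depth k y"
  have c: "profile k c" using y REYD_iff[OF k] by (simp add: c_def)
  have K: "k \<in> {1..n}" "k \<noteq> 1" using k by auto
  note st = profile_step[OF c]
  obtain N :: int where N: "N \<ge> 1" "\<forall>t. \<bar>t\<bar> \<ge> N \<longrightarrow> c t = 0"
    using c profile_bound[of c 1] unfolding profile_def by metis
  have adm: "t \<in> T_adm n k y \<longleftrightarrow> profile k (c(t := c t + 1))" for t
    using depth_upd[of k y t "-1"] by (simp add: T_adm_def REYD_iff[OF k] c_def)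
  have rem: "i \<in> T_rem n k y \<longleftrightarrow> profile k (c(i - 1 := c (i - 1) - 1))" for i
    using depth_upd[of k y "i - 1" 1] by (simp add: T_rem_def REYD_iff[OF k] c_def)
  have ad: "LT_ad n \<iota> s k i (y i) = vx s k c i" for i
    by (simp add: LT_ad_def vx_def lab_def c_def depth_def add.commute add.left_commute algebra_simps)
  have re: "LT_re n \<iota> s k (t + 1) (y t) = vx s k c t" for t
    by (simp add: LT_re_def vx_def lab_def c_def depth_def add.commute add.left_commute algebra_simps)
  have adm_sub: "T_adm n k y \<subseteq> {-N..N}"
  proof
    fix t assume "t \<in> T_adm n k y"
    then have p: "profile k (c(t := c t + 1))" by (simp add: adm)
    show "t \<in> {-N..N}"
    proof (rule ccontr)
      assume "t \<notin> {-N..N}"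
      then consider "t > N" | "t < - N" by fastforce
      then show False
      proof cases
        case 1
        \<comment> \<open>Outside the support the inner edge has no drop, so no box can be
          added.\<close>
        then have "drp c (t - 1) = 0" using N by (auto simp: drp_def inn_def out_def)
        then show False using p 1 N profile_add_pos[OF c, of t 1] by (simp add: step_ok_def)
      next
        case 2
        then have "drp c t = 0" using N by (auto simp: drp_def inn_def out_def)
        then show False using p 2 N K profile_add_neg[OF c, of t 1] by (simp add: step_ok_def)
      qed
    qed
  qed
  have rem_sub: "(\<lambda>i. i - 1) ` T_rem n k y \<subseteq> {-N..N}"
  proof
    fix t assume "t \<in> (\<lambda>i. i - 1) ` T_rem n k y"
    then have "profile k (c(t := c t - 1))" by (auto simp: rem)
    from profile_nonneg[OF this, of t] have "c t \<noteq> 0" by auto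
    then show "t \<in> {-N..N}" using N by force
  qed
  define a where "a t = (if t \<in> T_adm n k y then if t \<in> T_dadm n k y then 2 else 1 else 0 :: int)" for t
  define r where "r t = (if t + 1 \<in> T_rem n k y then if t + 1 \<in> T_drem n k y then 2 else 1 else 0 :: int)" for t
  have dsub: "T_dadm n k y \<subseteq> T_adm n k y" "T_drem n k y \<subseteq> T_rem n k y" by (auto simp: T_dadm_def T_drem_def)
  have fin: "finite (T_adm n k y)" "finite (T_rem n k y)"
    subgoal by (rule finite_subset[OF adm_sub]) simp
    subgoal by (rule finite_imageD[OF finite_subset[OF rem_sub]]) (auto simp: inj_on_def)
    done
  have S1: "(\<Sum>i\<in>T_adm n k y - T_dadm n k y. LT_ad n \<iota> s k i (y i) m) + (\<Sum>i\<in>T_dadm n k y. 2 * LT_ad n \<iota> s k i (y i) m)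
     = (\<Sum>t\<in>{-N..N}. of_int (a t) * vx s k c t m)"
    unfolding ad sum_doubled[OF dsub(1) fin(1)]
    using adm_sub by (intro sum.mono_neutral_cong_left) (auto simp: a_def)
  have S2: "(\<Sum>i\<in>T_rem n k y - T_drem n k y. LT_re n \<iota> s k i (y (i - 1)) m) + (\<Sum>i\<in>T_drem n k y. 2 * LT_re n \<iota> s k i (y (i - 1)) m)
     = (\<Sum>t\<in>{-N..N}. of_int (r t) * vx s k c t m)"
  proof -
    have re': "LT_re n \<iota> s k i (y (i - 1)) = vx s k c (i - 1)" for i using re[of "i - 1"] by simp
    have "(\<Sum>i\<in>T_rem n k y. (if i \<in> T_drem n k y then 2 else 1) * vx s k c (i - 1) m)
      = (\<Sum>t\<in>(\<lambda>i. i - 1) ` T_rem n k y. of_int (r t) * vx s k c t m)"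
      by (subst sum.reindex) (auto simp: inj_on_def r_def intro!: sum.cong)
    also have "\<dots> = (\<Sum>t\<in>{-N..N}. of_int (r t) * vx s k c t m)"
    proof (rule sum.mono_neutral_left)
      have "t + 1 \<notin> T_rem n k y" if "t \<notin> (\<lambda>i. i - 1) ` T_rem n k y" for t
        using that by (force simp: image_iff)
      then show "\<forall>t\<in>{-N..N} - (\<lambda>i. i - 1) ` T_rem n k y. of_int (r t) * vx s k c t m = 0"
        by (auto simp: r_def)
    qed (use rem_sub in auto)
    finally show ?thesis unfolding re' sum_doubled[OF dsub(2) fin(2)] .
  qed
  have mod1: "(t + int k) mod (2 * int n - 1) = 1 \<longleftrightarrow> relaxed k (t - 1)" for t
  proof -
    have "(int k + (t - 1)) mod period = 0 \<longleftrightarrow> (t + int k) mod period = 1 mod period"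
      by (simp add: mod_eq_dvd_iff mod_eq_0_iff_dvd algebra_simps)
    moreover have "1 mod period = 1" using n3 by (simp add: period_def)
    ultimately show ?thesis by (simp add: relaxed_def period_def)
  qed
  have mod0: "(t + int k) mod (2 * int n - 1) = 0 \<longleftrightarrow> relaxed k t" for t
    by (simp add: relaxed_def period_def add.commute)
  have key: "a t - r t = wgt k c t" for t
  proof -
    have dc: "drp c t = (if t \<ge> 0 then y (t + 1) - y t else 1 + y t - y (t + 1))" 
      "drp c (t - 1) = (if t \<ge> 1 then y t - y (t - 1) else 1 + y (t - 1) - y t)"
      by (auto simp: c_def drp_depth)
    note s1 = st[of t] and s2 = st[of "t - 1"] and nrb = not_relaxed_both[of k t]
    have da: "t \<in> T_dadm n k y \<longleftrightarrow> t \<in> T_adm n k y \<and> y (t - 1) < y t \<and> y t = y (t + 1) \<and> (relaxed k (t - 1) \<and> t < 0 \<or> relaxed k t \<and> t > 0)"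
      by (auto simp: T_dadm_def mod1 mod0)
    have dr: "t + 1 \<in> T_drem n k y \<longleftrightarrow> t + 1 \<in> T_rem n k y \<and> y (t - 1) = y t \<and> y t < y (t + 1) \<and> (relaxed k (t - 1) \<and> t > 0 \<or> relaxed k t \<and> t < 0)"
      by (auto simp: T_drem_def mod1 mod0)
    have rem': "t + 1 \<in> T_rem n k y \<longleftrightarrow> profile k (c(t := c t + - 1))" by (simp add: rem)
    consider "t > 0" | "t < 0" | "t = 0" by linarith
    then show ?thesis
    proof cases
      case 1
      show ?thesis unfolding a_def r_def da dr adm rem' profile_add_pos[OF c 1] wgt_cases(1)[OF K(1) 1]
        using s1 s2 nrb 1 K dc by (subst cwgt_count) (auto simp: step_ok_def)
    next
      case 2
      show ?thesis unfolding a_def r_def da dr adm rem' profile_add_neg[OF c 2 K(2)] wgt_cases(2)[OF K(1) 2 K(2)]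
        using s1 s2 nrb 2 K dc by (subst cwgt_count) (auto simp: step_ok_def)
    next
      case 3
      show ?thesis unfolding a_def r_def da dr adm rem'
        using s1 s2 3 K wgt_cases(3)[OF K(1,2)] profile_add_0[OF c, of 1] profile_add_0[OF c, of "-1"] not_relaxed_centre[OF K(1)] relaxed_minus_1[OF K(1)]
        by (auto simp: step_ok_def)
    qed
  qed
  have "LT n \<iota> s k y m = (\<Sum>t\<in>{-N..N}. of_int (a t) * vx s k c t m) - (\<Sum>t\<in>{-N..N}. of_int (r t) * vx s k c t m)"
    unfolding LT_def S1[symmetric] S2[symmetric] by simp
  also have "\<dots> = (\<Sum>t\<in>{-N..N}. of_int (wgt k c t) * vx s k c t m)"
    by (simp add: sum_subtractf[symmetric] left_diff_distrib[symmetric] flip: key)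
  also have "\<dots> = frm s k c m" by (rule frm_interval[OF N(2,1), symmetric])
  finally show "LT n \<iota> s k y m = frm s k (depth k y) m" by (simp add: c_def)
qed

end

section \<open>Young walls as row partitions\<close>

context adapted_A2
begin

text \<open>\<open>plc i p\<close> is the place number \<open>p\<close>, counted from \<open>0\<close>, above the ground block in column \<open>i\<close>.\<close>

definition qd :: nat where "qd = 2 * n - 2"
definition pd :: nat where "pd = Suc qd"

lemma qd_ge: "qd \<ge> 4" and qd_n: "Suc (Suc qd) = 2 * n" and int_qd: "int qd = 2 * int n - 2" and int_pd: "int pd = 2 * int n - 1"
  and pd_pos: "pd > 0"
  using n3 by (auto simp: qd_def pd_def)

text \<open>Place 0 is the upper half of the bottom cell, whose lower half is the ground block. Thus
  a higher cell of colour 1 is shared by the last place of one period and the first place of the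
  next, and \<open>pd\<close> places raise the level by \<open>qd\<close>.\<close>

definition lev :: "nat \<Rightarrow> nat" where
  "lev p = qd * (p div pd) + p mod pd + 1"

definition prt :: "nat \<Rightarrow> part" where
  "prt p = (if p mod pd = 0 then Upper else if p mod pd = qd then Lower else Whole)"

definition plc :: "nat \<Rightarrow> nat \<Rightarrow> place" where
  "plc i p = (i, lev p, prt p)"

text \<open>The lower halves above the ground. From such a \<open>p\<close> to \<open>p + 1\<close>
  the cell stays the same; this is the relaxed edge.\<close>

definition last_half :: "nat \<Rightarrow> bool" where "last_half p \<longleftrightarrow> p mod pd = qd"

lemma Suc_div_mod:
  "Suc p div pd = (if last_half p then Suc (p div pd) else p div pd)"
  "Suc p mod pd = (if last_half p then 0 else Suc (p mod pd))"
  by (auto simp: last_half_def div_Suc mod_Suc pd_def)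

lemma lev_Suc: "lev (Suc p) = lev p + (if last_half p then 0 else 1)"
  unfolding lev_def Suc_div_mod by (auto simp: last_half_def algebra_simps)

lemma prt_Suc: "last_half p \<Longrightarrow> prt p = Lower \<and> prt (Suc p) = Upper"
  using qd_ge Suc_div_mod(2)[of p] by (simp add: prt_def) (auto simp: last_half_def)

lemma prt_eq: "prt p = Lower \<longleftrightarrow> last_half p" "prt p = Upper \<longleftrightarrow> p = 0 \<or> last_half (p - 1)"
  subgoal using qd_ge by (auto simp: prt_def last_half_def)
  subgoal using qd_ge Suc_div_mod(2)[of "p - 1"] by (cases p) (auto simp: prt_def)
  done

lemma bottom_plc_mono: "strict_mono (\<lambda>p. bottom (plc i p))"
proof (rule strict_mono_Suc_iff[THEN iffD2], intro allI)
  fix p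
  show "bottom (plc i p) < bottom (plc i (Suc p))"
    using prt_Suc[of p] by (auto simp: bottom_def plc_def lev_Suc)
qed

lemma bottom_plc_gt: "bottom (plc i p) > 1"
proof -
  have "bottom (plc i 0) > 1" by (simp add: bottom_def plc_def lev_def prt_def)
  moreover have "bottom (plc i 0) \<le> bottom (plc i p)"
    using strict_mono_mono[OF bottom_plc_mono] by (auto dest: monoD)
  ultimately show ?thesis by simp
qed

lemma plc_eq_iff: "plc i p = plc j q \<longleftrightarrow> i = j \<and> p = q"
proof
  assume "plc i p = plc j q"
  then show "i = j \<and> p = q" using strict_mono_eq[OF bottom_plc_mono[of i], of p q] by (auto simp: plc_def)
qed auto

text \<open>Counted by places instead of cells the colours have period \<open>2n - 1\<close>, as a
  cell of colour 1 counts twice. So row \<open>p\<close> has the colour of column \<open>p\<close>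
  in a profile of type 1.\<close>

lemma pi'_lev: "pi' n (lev p) = pi1 n (1 + int p)"
proof -
  define d r where "d = p div pd" and "r = p mod pd"
  have r: "r \<le> qd" unfolding r_def using mod_less_divisor[OF pd_pos, of p] by (simp add: pd_def)
  have "(1 + int p - 1) mod (2 * int n - 1) = int r"
    by (simp add: r_def zmod_int int_pd)
  then have 1: "pi1 n (1 + int p) = nat (if int r + 1 \<le> int n then int r + 1 else 2 * int n - (int r + 1))"
    by (simp add: pi1_def Let_def)
  have "(lev p - 1) mod qd = r mod qd" by (simp add: lev_def r_def)
  then have 2: "pi' n (lev p) = (let x = r mod qd + 1 in if x \<le> n then x else 2 * n - x)"
    by (simp add: pi'_def qd_def)
  show ?thesis
  proof (cases "r = qd")
    case True
    then show ?thesis using 1 2 n3 by (auto simp: Let_def nat_eq_iff int_qd)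
  next
    case False
    then have "r mod qd = r" using r by simp
    then show ?thesis using 1 2 n3 r False by (auto simp: Let_def nat_eq_iff qd_def)
  qed
qed

lemma pi'_eq_1: "pi' n l = 1 \<longleftrightarrow> (l - 1) mod qd = 0"
proof -
  obtain x where x: "x = (l - 1) mod qd" "x < qd" using qd_ge by (metis mod_less_divisor not_numeral_le_zero gr0I)
  have "pi' n l = (let r = x + 1 in if r \<le> n then r else 2 * n - r)" by (simp add: pi'_def qd_def x(1))
  then show ?thesis using x(2) n3 unfolding x(1)[symmetric] by (auto simp: Let_def qd_def)
qed

lemma places_eq: "places n = ground_wall \<union> {plc i p | i p. True}"
proof (intro equalityI subsetI)
  fix x assume "x \<in> places n"
  then obtain i l t where x: "x = (i, l, t)" "l \<ge> 1" "if pi' n l = 1 then t \<in> {Lower, Upper} else t = Whole"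
    by (auto simp: places_def)
  define q r where "q = (l - 1) div qd" and "r = (l - 1) mod qd"
  have r: "r < qd" unfolding r_def using qd_ge by (intro mod_less_divisor) simp
  have rp: "r mod pd = r" "r div pd = 0" "pd \<noteq> 0" using r by (simp_all add: pd_def)
  have l: "l = qd * q + r + 1" using x(2) by (simp add: q_def r_def)
  have dm: "(pd * q + v) div pd = q" "(pd * q + v) mod pd = v" if "v \<le> qd" for q v
      proof -
    have "v < pd" "pd \<noteq> 0" using that by (auto simp: pd_def)
    then show "(pd * q + v) div pd = q" "(pd * q + v) mod pd = v" by simp_all
  qed
  have "x \<in> ground_wall \<or> (\<exists>p. x = plc i p)"
  proof (cases "r = 0")
    case False
    then have "pi' n l \<noteq> 1" unfolding pi'_eq_1 r_def .
    then have "t = Whole" using x(3) by simp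
    then have "x = plc i (pd * q + r)"
      using r False rp by (simp add: plc_def lev_def prt_def dm x(1) l)
    then show ?thesis by blast
  next
    case True
    then have "pi' n l = 1" unfolding pi'_eq_1 r_def .
    then have "t = Lower \<or> t = Upper" using x(3) by simp
    then show ?thesis
    proof
      assume "t = Upper"
      then have "x = plc i (pd * q + 0)"
        unfolding plc_def lev_def prt_def dm[where v = 0 and q = q, OF le0] using True by (simp add: x(1) l)
      then show ?thesis by blast
    next
      assume t: "t = Lower"
      show ?thesis
      proof (cases q)
        case 0
        then show ?thesis using t True by (simp add: ground_wall_def x(1) l)
      next
        case (Suc q')
        \<comment> \<open>A lower half above the ground is the last place of the preceding
          period.\<close>
        have "x = plc i (pd * q' + qd)"
          unfolding plc_def lev_def prt_def dm[where v = qd and q = q', OF order_refl] using True t qd_ge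
          by (simp add: x(1) l Suc)
        then show ?thesis by blast
      qed
    qed
  qed
  then show "x \<in> ground_wall \<union> {plc i p | i p. True}" by blast
next
  fix x assume "x \<in> ground_wall \<union> {plc i p | i p. True}"
  then show "x \<in> places n"
  proof
    assume "x \<in> {plc i p | i p. True}"
    then obtain i p where x: "x = plc i p" by blast
    define r where "r = p mod pd"
    have r: "r \<le> qd" unfolding r_def using mod_less_divisor[OF pd_pos, of p] by (simp add: pd_def)
    have "pi' n (lev p) = 1 \<longleftrightarrow> r mod qd = 0" unfolding pi'_eq_1 by (simp add: lev_def r_def)
    also have "\<dots> \<longleftrightarrow> r = 0 \<or> r = qd" using r by (cases "r = qd") auto
    finally show ?thesis unfolding x plc_def places_def by (auto simp: lev_def prt_def r_def)
  next
    assume "x \<in> ground_wall"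
    moreover have "pi' n 1 = 1" unfolding pi'_eq_1 by simp
    ultimately show ?thesis by (auto simp: ground_wall_def places_def)
  qed
qed

lemma plc_not_ground: "plc i p \<notin> ground_wall"
proof
  assume "plc i p \<in> ground_wall"
  then have "bottom (plc i p) = 1" by (auto simp: ground_wall_def plc_def bottom_def)
  then show False using bottom_plc_gt[of i p] by simp
qed

section \<open>Walls described by column heights\<close>

definition bwall :: "(nat \<Rightarrow> nat) \<Rightarrow> place set" where
  "bwall b = ground_wall \<union> {plc i p | i p. p < b i}"

lemma plc_bwall: "plc i p \<in> bwall b \<longleftrightarrow> p < b i"
  using plc_not_ground[of i p] by (auto simp: bwall_def plc_eq_iff)

definition hgt :: "nat \<Rightarrow> rat" where "hgt b = 1/2 + (\<Sum>p<b. if prt p = Whole then 1 else 1/2)"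

lemma hgt_mono: "strict_mono hgt"
  by (rule strict_mono_Suc_iff[THEN iffD2]) (auto simp: hgt_def)

lemma col_height_bwall: "col_height (bwall b) i = hgt (b i)"
proof -
  have "{P \<in> bwall b. fst P = i} = insert (i, 1, Lower) (plc i ` {..<b i})"
    by (auto simp: bwall_def ground_wall_def plc_def)
  moreover have "(i, 1, Lower) \<notin> plc i ` {..<b i}"
  proof
    assume "(i, 1, Lower) \<in> plc i ` {..<b i}"
    then obtain p where "(i, 1, Lower) = plc i p" by blast
    moreover have "(i, 1, Lower) \<in> ground_wall" by (simp add: ground_wall_def)
    ultimately show False using plc_not_ground[of i p] by simp
  qed
  moreover have "inj_on (plc i) {..<b i}" by (auto simp: inj_on_def plc_eq_iff)
  ultimately show ?thesis
    by (simp add: col_height_def hgt_def sum.reindex) (simp add: block_height_def plc_def)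
qed

lemma hgt_closed: "hgt b = of_nat (qd * (b div pd))
   + (if b mod pd = 0 then 1/2 else of_nat (b mod pd))"
proof (induction b)
  case (Suc b)
  have "hgt (Suc b) = hgt b + (if prt b = Whole then 1 else 1/2)" by (simp add: hgt_def)
  then show ?case unfolding Suc.IH Suc_div_mod using qd_ge
    by (auto simp: prt_def last_half_def algebra_simps)
qed (simp add: hgt_def)

text \<open>A column fails to be full exactly when its top block is a lower half, the bare ground
  block included.\<close>

lemma hgt_int: "hgt b \<in> \<int> \<longleftrightarrow> b mod pd \<noteq> 0"
proof (cases "b mod pd = 0")
  case True
  have "hgt b \<notin> \<int>"
  proof
    assume "hgt b \<in> \<int>"
    then have "hgt b - of_nat (qd * (b div pd)) \<in> \<int>" by (intro Ints_diff) auto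
    then have "(1/2 :: rat) \<in> \<int>" using True by (simp add: hgt_closed)
    then obtain z where "(1/2 :: rat) = of_int z" by (elim Ints_cases)
    then have "of_int (2 * z) = (1 :: rat)" by simp
    then have "2 * z = 1" by (metis of_int_1 of_int_eq_iff)
    then show False by presburger
  qed
  then show ?thesis using True by simp
next
  case False
  then have "hgt b = of_nat (qd * (b div pd) + b mod pd)" by (simp add: hgt_closed)
  then show ?thesis using False by (metis Ints_of_nat)
qed

lemma bwall_YW_iff:
  "bwall b \<in> YW n \<longleftrightarrow> finite {i. b i \<noteq> 0} \<and> (\<forall>i. b (i + 1) \<le> b i) \<and>
     (\<forall>i j. i \<noteq> j \<and> b i mod pd \<noteq> 0 \<and> b j mod pd \<noteq> 0 \<longrightarrow> b i \<noteq> b j)"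
proof -
  have diff: "bwall b - ground_wall = (\<lambda>(i, p). plc i p) ` Sigma UNIV (\<lambda>i. {..<b i})"
  proof -
    have "bwall b - ground_wall = {plc i p | i p. p < b i}"
      using plc_not_ground unfolding bwall_def by blast
    also have "\<dots> = (\<lambda>(i, p). plc i p) ` Sigma UNIV (\<lambda>i. {..<b i})"
    proof (intro equalityI subsetI)
      fix x assume "x \<in> {plc i p | i p. p < b i}"
      then obtain i p where "x = plc i p" "p < b i" by blast
      then show "x \<in> (\<lambda>(i, p). plc i p) ` Sigma UNIV (\<lambda>i. {..<b i})"
        by (intro image_eqI[of _ _ "(i, p)"]) auto
    qed auto
    finally show ?thesis .
  qed
  have inj: "inj_on (\<lambda>(i, p). plc i p) A" for A by (auto simp: inj_on_def plc_eq_iff)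
  have fin: "finite (bwall b - ground_wall) \<longleftrightarrow> finite {i. b i \<noteq> 0}"
  proof
    assume "finite (bwall b - ground_wall)"
    then have "finite (Sigma UNIV (\<lambda>i. {..<b i}))" unfolding diff using inj by (rule finite_imageD)
    then have "finite (fst ` Sigma UNIV (\<lambda>i. {..<b i}))" by (rule finite_imageI)
    moreover have "{i. b i \<noteq> 0} \<subseteq> fst ` Sigma UNIV (\<lambda>i. {..<b i})" by (force simp: image_iff)
    ultimately show "finite {i. b i \<noteq> 0}" by (rule finite_subset[rotated])
  next
    assume "finite {i. b i \<noteq> 0}"
    then have "finite (Sigma {i. b i \<noteq> 0} (\<lambda>i. {..<b i}))" by simp
    moreover have "Sigma UNIV (\<lambda>i. {..<b i}) \<subseteq> Sigma {i. b i \<noteq> 0} (\<lambda>i. {..<b i})" by auto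
    ultimately show "finite (bwall b - ground_wall)" unfolding diff by (meson finite_imageI finite_subset)
  qed
  have down: "Q \<in> bwall b" if PQ: "P \<in> bwall b" "Q \<in> places n" "fst Q = fst P" "bottom Q < bottom P" for P Q
  proof (cases "Q \<in> ground_wall")
    case True
    then show ?thesis by (simp add: bwall_def)
  next
    case False
    then obtain i q where Q: "Q = plc i q" using PQ(2) unfolding places_eq by blast
    have "P \<notin> ground_wall"
      using PQ(4) bottom_plc_gt[of i q] by (auto simp: Q ground_wall_def bottom_def)
    then obtain i' p where P: "P = plc i' p" "p < b i'" using PQ(1) by (auto simp: bwall_def)
    have "i' = i" using PQ(3) by (simp add: P Q plc_def)
    then have "q < p" using PQ(4) strict_mono_less[OF bottom_plc_mono[of i]] by (simp add: P Q)
    then show ?thesis using P(2) \<open>i' = i\<close> by (simp add: Q plc_bwall)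
  qed
  show ?thesis
    unfolding YW_def young_wall_def full_col_def col_height_bwall mem_Collect_eq hgt_int
      strict_mono_less_eq[OF hgt_mono] strict_mono_eq[OF hgt_mono] fin
    using down by (auto simp: bwall_def places_eq)
qed

lemma YW_bwall:
  assumes Y: "Y \<in> YW n"
  obtains b where "Y = bwall b"
proof -
  have Yw: "ground_wall \<subseteq> Y" "Y \<subseteq> places n" "finite (Y - ground_wall)"
    and down: "\<And>P Q. P \<in> Y \<Longrightarrow> Q \<in> places n \<Longrightarrow> fst Q = fst P \<Longrightarrow> bottom Q < bottom P \<Longrightarrow> Q \<in> Y"
    using Y unfolding YW_def young_wall_def by blast+
  define b where "b i = card {p. plc i p \<in> Y}" for i
  have "{p. plc i p \<in> Y} = {..<b i}" for i
  proof -
    have "plc i ` {p. plc i p \<in> Y} \<subseteq> Y - ground_wall" using plc_not_ground by auto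
    then have "finite (plc i ` {p. plc i p \<in> Y})" using Yw(3) by (rule finite_subset)
    then have fin: "finite {p. plc i p \<in> Y}" by (rule finite_imageD) (auto simp: inj_on_def plc_eq_iff)
    have dc: "q \<in> {p. plc i p \<in> Y}" if "p \<in> {p. plc i p \<in> Y}" "q < p" for p q
      using that down[of "plc i p" "plc i q"] strict_mono_less[OF bottom_plc_mono[of i], of q p]
      by (auto simp: places_eq plc_def)
    show ?thesis
    proof (cases "{p. plc i p \<in> Y} = {}")
      case True
      then show ?thesis by (simp add: b_def)
    next
      case False
      define M where "M = Max {p. plc i p \<in> Y}"
      have M: "M \<in> {p. plc i p \<in> Y}" "\<And>p. p \<in> {p. plc i p \<in> Y} \<Longrightarrow> p \<le> M"
        unfolding M_def using Max_in[OF fin False] Max_ge[OF fin] by blast+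
      have eq: "{p. plc i p \<in> Y} = {..M}"
      proof (intro equalityI subsetI)
        fix p assume "p \<in> {..M}"
        then show "p \<in> {p. plc i p \<in> Y}" using dc[OF M(1), of p] M(1) by (cases "p = M") simp_all
      qed (simp add: M(2))
      then have "b i = Suc M" by (simp add: b_def)
      then show ?thesis unfolding eq by (simp add: lessThan_Suc_atMost)
    qed
  qed
  then have "plc i p \<in> Y \<longleftrightarrow> p < b i" for i p by (simp add: set_eq_iff)
  then have iff: "plc i p \<in> Y \<longleftrightarrow> plc i p \<in> bwall b" for i p by (simp add: plc_bwall)
  have "Y = bwall b"
  proof (intro equalityI subsetI)
    fix x assume "x \<in> Y"
    then have "x \<in> ground_wall \<or> (\<exists>i p. x = plc i p)" using Yw(2) unfolding places_eq by blast
    then show "x \<in> bwall b"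
    proof (elim disjE exE)
      fix i p assume "x = plc i p"
      then show ?thesis using \<open>x \<in> Y\<close> iff by simp
    qed (simp add: bwall_def)
  next
    fix x assume x: "x \<in> bwall b"
    then have "x \<in> ground_wall \<or> (\<exists>i p. x = plc i p)" unfolding bwall_def by blast
    then show "x \<in> Y"
    proof (elim disjE exE)
      fix i p assume "x = plc i p"
      then show ?thesis using x iff by simp
    qed (use Yw(1) in blast)
  qed
  then show ?thesis by (rule that)
qed

section \<open>Walls described by row lengths\<close>

definition rwall :: "(nat \<Rightarrow> nat) \<Rightarrow> place set" where
  "rwall c = ground_wall \<union> {plc i p | i p. i < c p}"

lemma plc_rwall: "plc i p \<in> rwall c \<longleftrightarrow> i < c p"
  using plc_not_ground[of i p] by (auto simp: rwall_def plc_eq_iff)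

text \<open>Properness read off the rows: with row lengths \<open>x\<close> at \<open>p\<close> and
  \<open>y\<close> at \<open>p + 1\<close>, the columns with exactly \<open>p + 1\<close> places
  above the ground are those numbered \<open>y\<close> to \<open>x - 1\<close>. Two of them are
  allowed only if they are not full, that is, if row \<open>p\<close> consists of lower
  halves.\<close>

definition link :: "nat \<Rightarrow> nat \<Rightarrow> nat \<Rightarrow> bool" where
  "link p x y \<longleftrightarrow> y \<le> x \<and> (\<not> last_half p \<longrightarrow> x \<le> Suc y)"

definition rows_ok :: "(nat \<Rightarrow> nat) \<Rightarrow> bool" where
  "rows_ok c \<longleftrightarrow> finite {p. c p \<noteq> 0} \<and> (\<forall>p. link p (c p) (c (Suc p)))"

text \<open>\<open>c\<close> is the conjugate partition of \<open>b\<close>.\<close>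

lemma transpose_partition:
  fixes b :: "nat \<Rightarrow> nat"
  assumes "finite {i. b i \<noteq> 0}" "\<And>i. b (Suc i) \<le> b i"
  shows "\<exists>c. (\<forall>i p. i < c p \<longleftrightarrow> p < b i) \<and> finite {p. c p \<noteq> (0::nat)} \<and> (\<forall>p. c (Suc p) \<le> c p)"
proof -
  have anti: "b j \<le> b i" if "i \<le> j" for i j using that assms(2) by (rule lift_Suc_antimono_le[rotated])
  obtain N where N: "{i. b i \<noteq> 0} \<subseteq> {..<N}" using assms(1) finite_nat_bounded by blast
  have bN: "b N = 0" using N by fastforce
  define c where "c p = (LEAST i. b i \<le> p)" for p
  have 1: "i < c p \<longleftrightarrow> p < b i" for i p
  proof
    assume "i < c p" then show "p < b i" unfolding c_def using not_less_Least[of i "\<lambda>i. b i \<le> p"] by (simp add: not_le)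
  next
    assume p: "p < b i"
    have "b (c p) \<le> p" unfolding c_def by (rule LeastI[of _ N]) (simp add: bN)
    then show "i < c p" using p anti[of "c p" i] by (cases "i < c p") auto
  qed
  have "{p. c p \<noteq> 0} \<subseteq> {..<b 0}" using 1[of 0] by auto
  then have 2: "finite {p. c p \<noteq> 0}" by (rule finite_subset) simp
  have 3: "c (Suc p) \<le> c p" for p
  proof (rule ccontr)
    assume "\<not> c (Suc p) \<le> c p"
    then have "Suc p < b (c p)" using 1[of "c p" "Suc p"] by simp
    then show False using 1[of "c p" p] by simp
  qed
  show ?thesis using 1 2 3 by blast
qed

lemma mod_period_Suc: "Suc p mod pd \<noteq> 0 \<longleftrightarrow> \<not> last_half p"
  by (simp add: Suc_div_mod)

lemma rows_cols:
  assumes bc: "\<And>i p. i < c p \<longleftrightarrow> p < b i"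
  shows "rwall c = bwall b"
  using bc by (auto simp: rwall_def bwall_def)

lemma rwall_YW_iff: "rwall c \<in> YW n \<longleftrightarrow> rows_ok c"
proof
  assume Y: "rwall c \<in> YW n"
  then obtain b where b: "rwall c = bwall b" by (rule YW_bwall)
  have bc: "i < c p \<longleftrightarrow> p < b i" for i p using plc_rwall[of i p c] by (simp add: b plc_bwall)
  have bY: "finite {i. b i \<noteq> 0}" "\<And>i. b (i + 1) \<le> b i"
     "\<And>i j. i \<noteq> j \<Longrightarrow> b i mod pd \<noteq> 0 \<Longrightarrow> b j mod pd \<noteq> 0 \<Longrightarrow> b i \<noteq> b j"
    using Y unfolding b bwall_YW_iff by blast+
  obtain c' :: "nat \<Rightarrow> nat" where c': "\<And>i p. i < c' p \<longleftrightarrow> p < b i" "finite {p. c' p \<noteq> 0}" "\<And>p. c' (Suc p) \<le> c' p"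
    using transpose_partition[of b, OF bY(1)] bY(2) by auto
  have "c = c'"
  proof
    fix p
    have *: "i < c p \<longleftrightarrow> i < c' p" for i by (simp add: bc c')
    show "c p = c' p" using *[of "c p"] *[of "c' p"] by simp
  qed
  moreover have "c p \<le> Suc (c (Suc p))" if "\<not> last_half p" for p
  proof (rule ccontr)
    assume "\<not> c p \<le> Suc (c (Suc p))"
    \<comment> \<open>Two neighbouring columns would both have exactly \<open>p + 1\<close> places
      above the ground and be full.\<close>
    then have "p < b (c (Suc p))" "p < b (Suc (c (Suc p)))" "\<not> Suc p < b (c (Suc p))" "\<not> Suc p < b (Suc (c (Suc p)))"
      using bc[of "c (Suc p)" p] bc[of "Suc (c (Suc p))" p] bc[of "c (Suc p)" "Suc p"] bc[of "Suc (c (Suc p))" "Suc p"] by auto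
    then have "b (c (Suc p)) = Suc p" "b (Suc (c (Suc p))) = Suc p" by auto
    then show False using bY(3)[of "c (Suc p)" "Suc (c (Suc p))"] that mod_period_Suc by simp
  qed
  ultimately show "rows_ok c" using c' by (auto simp: rows_ok_def link_def)
next
  assume c: "rows_ok c"
  have "finite {p. c p \<noteq> 0}" "\<And>p. c (Suc p) \<le> c p" using c by (auto simp: rows_ok_def link_def)
  then obtain b :: "nat \<Rightarrow> nat" where b: "\<And>p i. p < b i \<longleftrightarrow> i < c p" "finite {i. b i \<noteq> 0}" "\<And>i. b (Suc i) \<le> b i"
    using transpose_partition[of c] by blast
  have neq: "b i \<noteq> b j" if ij: "i < j" and m: "b i mod pd \<noteq> 0" for i j
  proof
    assume e: "b i = b j"
    obtain p where p: "b i = Suc p" using m by (cases "b i") auto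
    then have "j < c p" "\<not> i < c (Suc p)" using b(1)[of p j] b(1)[of "Suc p" i] e by auto
    moreover have "c p \<le> Suc (c (Suc p))" using c m mod_period_Suc[of p] by (simp add: rows_ok_def link_def p)
    ultimately show False using ij by simp
  qed
  have "b i \<noteq> b j" if "i \<noteq> j" "b i mod pd \<noteq> 0" "b j mod pd \<noteq> 0" for i j
    using neq[of i j] neq[of j i] that by (cases i j rule: linorder_cases) auto
  then have "bwall b \<in> YW n" unfolding bwall_YW_iff using b by auto
  then show "rwall c \<in> YW n" using rows_cols[of c b] b(1) by simp
qed

lemma YW_rwall:
  assumes "Y \<in> YW n"
  obtains c where "Y = rwall c" "rows_ok c"
proof -
  obtain b where b: "Y = bwall b" using assms by (rule YW_bwall)
  have "finite {i. b i \<noteq> 0}" "\<And>i. b (Suc i) \<le> b i" using assms unfolding b bwall_YW_iff by auto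
  then obtain c :: "nat \<Rightarrow> nat" where "\<And>i p. i < c p \<longleftrightarrow> p < b i"
    using transpose_partition[of b] by blast
  then have "Y = rwall c" by (simp add: rows_cols b)
  then show ?thesis using that assms rwall_YW_iff by blast
qed

section \<open>Row lengths as a profile of type 1\<close>

definition lift :: "(nat \<Rightarrow> nat) \<Rightarrow> int \<Rightarrow> int" where
  "lift c t = (if t \<ge> 0 then int (c (nat t)) else 0)"

lemma lift_int [simp]: "lift c (int p) = int (c p)"
  by (simp add: lift_def)

lemma relaxed_last_half: "relaxed 1 (int p) \<longleftrightarrow> last_half p"
proof -
  have "relaxed 1 (int p) \<longleftrightarrow> int (Suc p mod pd) = 0"
    by (simp add: relaxed_def period_def zmod_int int_pd)
  also have "\<dots> \<longleftrightarrow> last_half p" by (simp add: Suc_div_mod)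
  finally show ?thesis .
qed

lemma drp_lift: "drp (lift c) (int p) = int (c p) - int (c (Suc p))"
  by (simp add: drp_def inn_def out_def lift_def nat_add_distrib)

lemma profile_lift: "profile 1 (lift c) \<longleftrightarrow> rows_ok c"
proof -
  have "{t. lift c t \<noteq> 0} = int ` {p. c p \<noteq> 0}"
    by (auto simp: lift_def image_iff split: if_splits) (metis nat_0_le)
  then have 1: "finite {t. lift c t \<noteq> 0} \<longleftrightarrow> finite {p. c p \<noteq> 0}"
    by (simp add: finite_image_iff)
  have 2: "step_ok 1 (int p) (drp (lift c) (int p)) \<longleftrightarrow> link p (c p) (c (Suc p))" for p
    by (auto simp: step_ok_def drp_lift link_def relaxed_last_half simp del: One_nat_def)
  have "(\<forall>e. step_ok 1 e (drp (lift c) e)) \<longleftrightarrow> (\<forall>p. step_ok 1 (int p) (drp (lift c) (int p)))"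
  proof (intro iffI allI)
    fix e assume *: "\<forall>p. step_ok 1 (int p) (drp (lift c) (int p))"
    show "step_ok 1 e (drp (lift c) e)"
    proof (cases "e < 0")
      case False
      then show ?thesis using *[rule_format, of "nat e"] by simp
    qed (simp add: step_ok_def)
  qed simp
  then show ?thesis unfolding profile_def rows_ok_def 1 2[symmetric] by (auto simp: lift_def)
qed

lemma profile_lift_ex:
  assumes "profile 1 f"
  obtains c where "f = lift c" "rows_ok c"
proof -
  have "f t = lift (\<lambda>p. nat (f (int p))) t" for t
    using profile_nonneg[OF assms, of t] assms by (auto simp: lift_def profile_def)
  then have "f = lift (\<lambda>p. nat (f (int p)))" by blast
  then show ?thesis using that assms profile_lift by metis
qed

text \<open>Between the two halves of a cell \<open>lev\<close> does not change, while
  \<open>PT\<close> grows by \<open>p_11 = 0\<close>.\<close>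

lemma PY_lev: "PY n \<iota> (lev p) = PT n \<iota> 1 (1 + int p)"
proof (induction p)
  case 0
  then show ?case by (simp add: PY_def PT_def lev_def)
next
  case (Suc p)
  have e: "PT n \<iota> 1 (1 + int (Suc p)) = PT n \<iota> 1 (1 + int p) + pp \<iota> (pi1 n (1 + int (Suc p))) (pi1 n (1 + int p))"
    using PT_edge[of 1 "int p"] by (simp add: inn_def out_def add.commute)
  show ?case
  proof (cases "last_half p")
    case True
    then have "relaxed 1 (int p)" using relaxed_last_half by blast
    from relaxed_pi1[OF this] have "pp \<iota> (pi1 n (1 + int (Suc p))) (pi1 n (1 + int p)) = 0"
      by (simp add: inn_def out_def pp_def add.commute)
    then show ?thesis using True Suc e by (simp add: lev_Suc)
  next
    case False
    have "{2..Suc (lev p)} = insert (Suc (lev p)) {2..lev p}" by (auto simp: lev_def)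
    then have "PY n \<iota> (lev (Suc p)) = PY n \<iota> (lev p) + pp \<iota> (pi' n (lev (Suc p))) (pi' n (lev p))"
      using False by (simp add: PY_def lev_Suc)
    then show ?thesis unfolding Suc e pi'_lev by simp
  qed
qed

lemma LY_ad_vx: "LY_ad n \<iota> s (plc (c p) p) = vx s 1 (lift c) (int p)"
  by (simp add: LY_ad_def plc_def vx_def lab_def PY_lev pi'_lev)

lemma LY_re_vx: "c p \<ge> 1 \<Longrightarrow> LY_re n \<iota> s (plc (c p - 1) p) = vx s 1 (lift c) (int p)"
  by (simp add: LY_re_def plc_def vx_def lab_def PY_lev pi'_lev ac_simps)

lemma insert_rwall: "insert (plc (c p) p) (rwall c) = rwall (c(p := Suc (c p)))"
  by (auto simp: rwall_def less_Suc_eq split: if_splits)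

lemma remove_rwall: "c p \<ge> 1 \<Longrightarrow> rwall c - {plc (c p - 1) p} = rwall (c(p := c p - 1))"
proof -
  assume c: "c p \<ge> 1"
  show "rwall c - {plc (c p - 1) p} = rwall (c(p := c p - 1))"
  proof (intro equalityI subsetI)
    fix x assume x: "x \<in> rwall c - {plc (c p - 1) p}"
    then have "x \<in> ground_wall \<or> (\<exists>i q. x = plc i q \<and> i < c q)" unfolding rwall_def by blast
    then show "x \<in> rwall (c(p := c p - 1))"
    proof (elim disjE exE conjE)
      fix i q assume iq: "x = plc i q" "i < c q"
      then show ?thesis using x unfolding iq(1) plc_rwall by (auto simp: plc_eq_iff plc_rwall)
    qed (simp add: rwall_def)
  next
    fix x assume "x \<in> rwall (c(p := c p - 1))"
    then have "x \<in> ground_wall \<or> (\<exists>i q. x = plc i q \<and> i < (c(p := c p - 1)) q)" unfolding rwall_def by blast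
    then show "x \<in> rwall c - {plc (c p - 1) p}"
    proof (elim disjE exE conjE)
      assume "x \<in> ground_wall"
      then show ?thesis using plc_not_ground[of "c p - 1" p] by (auto simp: rwall_def)
    next
      fix i q assume iq: "x = plc i q" "i < (c(p := c p - 1)) q"
      then show ?thesis using c by (auto simp: plc_eq_iff plc_rwall split: if_splits)
    qed
  qed
qed

text \<open>Rows of a wall are initial segments, so a place is added, resp. removed, at the end of its row.\<close>

lemma Y_adm_rwall:
  "Y_adm n (rwall c) = (\<lambda>p. plc (c p) p) ` {p. rows_ok (c(p := Suc (c p)))}"
proof (intro equalityI subsetI)
  fix x assume "x \<in> Y_adm n (rwall c)"
  then have x: "x \<in> places n" "x \<notin> rwall c" "insert x (rwall c) \<in> YW n" by (auto simp: Y_adm_def)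
  then obtain i p where ip: "x = plc i p" unfolding places_eq rwall_def by blast
  obtain d where d: "insert x (rwall c) = rwall d" "rows_ok d" using x(3) by (rule YW_rwall)
  have r: "j < d q \<longleftrightarrow> j < c q \<or> (q = p \<and> j = i)" for j q
    using plc_rwall[of j q d] plc_rwall[of j q c] by (auto simp: d(1)[symmetric] ip plc_eq_iff)
  have nc: "\<not> i < c p" using x(2) by (simp add: ip plc_rwall)
  have "i = c p"
  proof (rule ccontr)
    assume "i \<noteq> c p"
    then have "c p < i" using nc by simp
    moreover have "i < d p" using r[of i p] by simp
    ultimately have "c p < d p" by simp
    then show False using r[of "c p" p] \<open>i \<noteq> c p\<close> by simp
  qed
  moreover have "rows_ok (c(p := Suc (c p)))"
    using d(2) x(3) insert_rwall[of c p] rwall_YW_iff by (simp add: ip \<open>i = c p\<close>)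
  ultimately show "x \<in> (\<lambda>p. plc (c p) p) ` {p. rows_ok (c(p := Suc (c p)))}" by (simp add: ip)
next
  fix x assume "x \<in> (\<lambda>p. plc (c p) p) ` {p. rows_ok (c(p := Suc (c p)))}"
  then obtain p where p: "x = plc (c p) p" "rows_ok (c(p := Suc (c p)))" by blast
  have "x \<in> places n" unfolding places_eq p(1) by blast
  then show "x \<in> Y_adm n (rwall c)"
    using p rwall_YW_iff by (simp add: Y_adm_def plc_rwall insert_rwall)
qed

lemma Y_rem_rwall:
  "Y_rem n (rwall c) = (\<lambda>p. plc (c p - 1) p) ` {p. c p \<ge> 1 \<and> rows_ok (c(p := c p - 1))}"
proof (intro equalityI subsetI)
  fix x assume "x \<in> Y_rem n (rwall c)"
  then have x: "x \<in> rwall c" "rwall c - {x} \<in> YW n" by (auto simp: Y_rem_def)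
  obtain d where d: "rwall c - {x} = rwall d" "rows_ok d" using x(2) by (rule YW_rwall)
  have "x \<notin> ground_wall" using d(1) unfolding rwall_def by blast
  then obtain i p where ip: "x = plc i p" "i < c p" using x(1) unfolding rwall_def by blast
  have r: "j < d q \<longleftrightarrow> j < c q \<and> \<not> (q = p \<and> j = i)" for j q
    using plc_rwall[of j q d] plc_rwall[of j q c] by (auto simp: d(1)[symmetric] ip plc_eq_iff)
  have "i = c p - 1"
  proof (rule ccontr)
    assume "i \<noteq> c p - 1"
    then have "c p - 1 < d p" using ip(2) r[of "c p - 1" p] by simp
    then have "i < d p" using ip(2) by simp
    then show False using r[of i p] by simp
  qed
  moreover have "rows_ok (c(p := c p - 1))"
    using x(2) remove_rwall[of c p] rwall_YW_iff ip(2) by (simp add: ip(1) \<open>i = c p - 1\<close>)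
  ultimately show "x \<in> (\<lambda>p. plc (c p - 1) p) ` {p. c p \<ge> 1 \<and> rows_ok (c(p := c p - 1))}" using ip by auto
next
  fix x assume "x \<in> (\<lambda>p. plc (c p - 1) p) ` {p. c p \<ge> 1 \<and> rows_ok (c(p := c p - 1))}"
  then obtain p where p: "x = plc (c p - 1) p" "c p \<ge> 1" "rows_ok (c(p := c p - 1))" by blast
  then show "x \<in> Y_rem n (rwall c)"
    using rwall_YW_iff remove_rwall[of c p] by (simp add: Y_rem_def plc_rwall)
qed

text \<open>Both halves go into the same column at the ends of their rows, so rows \<open>p\<close>
  and \<open>p + 1\<close> must have equal length.\<close>

definition dbl_adm :: "(nat \<Rightarrow> nat) \<Rightarrow> nat set" where
  "dbl_adm c = {p. last_half p \<and> c p = c (Suc p) \<and> rows_ok (c(p := Suc (c p), Suc p := Suc (c p)))}"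

definition dbl_rem :: "(nat \<Rightarrow> nat) \<Rightarrow> nat set" where
  "dbl_rem c = {p. last_half p \<and> c p = c (Suc p) \<and> c p \<ge> 1 \<and> rows_ok (c(p := c p - 1, Suc p := c p - 1))}"

lemma plc_halves: "last_half p \<Longrightarrow> plc i p = (i, lev p, Lower) \<and> plc i (Suc p) = (i, lev p, Upper)"
  using prt_Suc[of p] by (simp add: plc_def lev_Suc)

lemma Lower_place:
  assumes "(i, l, Lower) \<in> places n" "(i, l, Lower) \<notin> ground_wall"
  obtains p where "l = lev p" "last_half p"
proof -
  obtain j p where "(i, l, Lower) = plc j p" using assms unfolding places_eq by blast
  then have "l = lev p" "prt p = Lower" by (auto simp: plc_def)
  then show ?thesis using that prt_eq(1) by blast
qed

lemma Y_dadm_rwall: "Y_dadm n (rwall c) = (\<lambda>p. plc (c p) p) ` dbl_adm c"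
proof (intro equalityI subsetI)
  fix x assume "x \<in> Y_dadm n (rwall c)"
  then obtain i l where x: "x = (i, l, Lower)" "(i, l, Lower) \<in> places n" "(i, l, Lower) \<notin> rwall c" "(i, l, Upper) \<notin> rwall c"
    "rwall c \<union> {(i, l, Lower), (i, l, Upper)} \<in> YW n" by (auto simp: Y_dadm_def)
  have "(i, l, Lower) \<notin> ground_wall" using x(3) by (simp add: rwall_def)
  with x(2) obtain p where p: "l = lev p" "last_half p" by (rule Lower_place)
  note h = plc_halves[OF p(2), of i]
  obtain d where d: "rwall c \<union> {(i, l, Lower), (i, l, Upper)} = rwall d" "rows_ok d" using x(5) by (rule YW_rwall)
  have r: "j < d q \<longleftrightarrow> j < c q \<or> ((q = p \<or> q = Suc p) \<and> j = i)" for j q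
  proof -
    have "plc j q \<in> rwall d \<longleftrightarrow> plc j q \<in> rwall c \<or> plc j q = plc i p \<or> plc j q = plc i (Suc p)"
      unfolding d(1)[symmetric] h[THEN conjunct1] h[THEN conjunct2] p(1) by blast
    then show ?thesis by (auto simp: plc_rwall plc_eq_iff)
  qed
  have nc: "\<not> i < c p" "\<not> i < c (Suc p)"
    using x(3,4) h by (simp_all add: p(1) flip: plc_rwall)
  \<comment> \<open>Rows of the enlarged wall are initial segments too, so the new places follow
    directly on the old ends of both rows.\<close>
  have eq: "c q = i" if "q = p \<or> q = Suc p" for q
  proof (rule ccontr)
    assume "c q \<noteq> i"
    then have "c q < i" using nc that by auto
    moreover have "i < d q" using r[of i q] that by auto
    ultimately have "c q < d q" by simp
    then show False using r[of "c q" q] \<open>c q \<noteq> i\<close> by simp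
  qed
  have "d = c(p := Suc (c p), Suc p := Suc (c p))"
  proof
    fix q
    have *: "j < d q \<longleftrightarrow> j < (c(p := Suc (c p), Suc p := Suc (c p))) q" for j
      using r[of j q] eq by (auto simp: less_Suc_eq)
    show "d q = (c(p := Suc (c p), Suc p := Suc (c p))) q"
      using *[of "d q"] *[of "(c(p := Suc (c p), Suc p := Suc (c p))) q"] by simp
  qed
  then have "p \<in> dbl_adm c" using d(2) p(2) eq by (simp add: dbl_adm_def)
  moreover have "x = plc (c p) p" using h eq by (simp add: x(1) p(1))
  ultimately show "x \<in> (\<lambda>p. plc (c p) p) ` dbl_adm c" by blast
next
  fix x assume "x \<in> (\<lambda>p. plc (c p) p) ` dbl_adm c"
  then obtain p where p: "x = plc (c p) p" "last_half p" "c p = c (Suc p)" "rows_ok (c(p := Suc (c p), Suc p := Suc (c p)))"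
    by (auto simp: dbl_adm_def)
  note h = plc_halves[OF p(2), of "c p"]
  have "insert (plc (c p) p) (rwall c) = rwall (c(p := Suc (c p)))" by (rule insert_rwall)
  moreover have "insert (plc (c p) (Suc p)) (rwall (c(p := Suc (c p)))) = rwall (c(p := Suc (c p), Suc p := Suc (c p)))"
    using insert_rwall[of "c(p := Suc (c p))" "Suc p"] p(3) by simp
  ultimately have "rwall c \<union> {plc (c p) p, plc (c p) (Suc p)} = rwall (c(p := Suc (c p), Suc p := Suc (c p)))" by auto
  moreover have "plc (c p) p \<in> places n" "plc (c p) (Suc p) \<in> places n" unfolding places_eq by blast+
  moreover have "plc (c p) p \<notin> rwall c" "plc (c p) (Suc p) \<notin> rwall c" using p(3) by (simp_all add: plc_rwall)
  ultimately show "x \<in> Y_dadm n (rwall c)"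
    using p(4) h rwall_YW_iff[of "c(p := Suc (c p), Suc p := Suc (c p))"] by (simp add: Y_dadm_def p(1))
qed

lemma Y_drem_rwall: "Y_drem n (rwall c) = (\<lambda>p. plc (c p - 1) (Suc p)) ` dbl_rem c"
proof (intro equalityI subsetI)
  fix x assume "x \<in> Y_drem n (rwall c)"
  then obtain i l where x: "x = (i, l, Upper)" "(i, l, Lower) \<in> rwall c" "(i, l, Upper) \<in> rwall c"
    "rwall c - {(i, l, Lower), (i, l, Upper)} \<in> YW n" by (auto simp: Y_drem_def)
  obtain d where d: "rwall c - {(i, l, Lower), (i, l, Upper)} = rwall d" "rows_ok d" using x(4) by (rule YW_rwall)
  have g: "(i, l, Lower) \<notin> ground_wall" using d(1) unfolding rwall_def by blast
  have "(i, l, Lower) \<in> places n" using x(2) unfolding rwall_def places_eq by blast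
  then obtain p where p: "l = lev p" "last_half p" using g by (rule Lower_place)
  note h = plc_halves[OF p(2), of i]
  have r: "j < d q \<longleftrightarrow> j < c q \<and> \<not> ((q = p \<or> q = Suc p) \<and> j = i)" for j q
  proof -
    have "plc j q \<in> rwall d \<longleftrightarrow> plc j q \<in> rwall c \<and> \<not> (plc j q = plc i p \<or> plc j q = plc i (Suc p))"
      unfolding d(1)[symmetric] h[THEN conjunct1] h[THEN conjunct2] p(1) by blast
    then show ?thesis by (auto simp: plc_rwall plc_eq_iff)
  qed
  have ic: "i < c p" "i < c (Suc p)"
    using x(2,3) h by (simp_all add: p(1) flip: plc_rwall)
  have eq: "c q = Suc i" if "q = p \<or> q = Suc p" for q
  proof (rule ccontr)
    assume "c q \<noteq> Suc i"
    then have "Suc i < c q" using ic that by auto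
    then have "Suc i < d q" using r[of "Suc i" q] by simp
    then have "i < d q" by simp
    then show False using r[of i q] that by auto
  qed
  have "d = c(p := c p - 1, Suc p := c p - 1)"
  proof
    fix q
    have *: "j < d q \<longleftrightarrow> j < (c(p := c p - 1, Suc p := c p - 1)) q" for j
      using r[of j q] eq by (auto simp: less_Suc_eq)
    show "d q = (c(p := c p - 1, Suc p := c p - 1)) q"
      using *[of "d q"] *[of "(c(p := c p - 1, Suc p := c p - 1)) q"] by simp
  qed
  then have "p \<in> dbl_rem c" using d(2) p(2) eq by (simp add: dbl_rem_def)
  moreover have "x = plc (c p - 1) (Suc p)" using h eq by (simp add: x(1) p(1))
  ultimately show "x \<in> (\<lambda>p. plc (c p - 1) (Suc p)) ` dbl_rem c" by blast
next
  fix x assume "x \<in> (\<lambda>p. plc (c p - 1) (Suc p)) ` dbl_rem c"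
  then obtain p where p: "x = plc (c p - 1) (Suc p)" "last_half p" "c p = c (Suc p)" "c p \<ge> 1"
    "rows_ok (c(p := c p - 1, Suc p := c p - 1))"
    by (auto simp: dbl_rem_def)
  note h = plc_halves[OF p(2), of "c p - 1"]
  have "rwall c - {plc (c p - 1) p} = rwall (c(p := c p - 1))" using p(4) by (rule remove_rwall)
  moreover have "rwall (c(p := c p - 1)) - {plc (c p - 1) (Suc p)} = rwall (c(p := c p - 1, Suc p := c p - 1))"
    using remove_rwall[of "c(p := c p - 1)" "Suc p"] p(3,4) by simp
  ultimately have "rwall c - {plc (c p - 1) p, plc (c p - 1) (Suc p)} = rwall (c(p := c p - 1, Suc p := c p - 1))" by auto
  moreover have "plc (c p - 1) p \<in> rwall c" "plc (c p - 1) (Suc p) \<in> rwall c" using p(3,4) by (simp_all add: plc_rwall)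
  ultimately show "x \<in> Y_drem n (rwall c)"
    using p(5) h rwall_YW_iff[of "c(p := c p - 1, Suc p := c p - 1)"] by (simp add: Y_drem_def p(1))
qed

section \<open>Counting slots and blocks with multiplicity\<close>

lemma rows_upd:
  assumes "rows_ok c"
  shows "rows_ok (c(p := v)) \<longleftrightarrow> link p v (c (Suc p)) \<and> (p > 0 \<longrightarrow> link (p - 1) (c (p - 1)) v)"
proof -
  have fin: "finite {x. (c(p := v)) x \<noteq> 0}"
    using assms by (auto simp: rows_ok_def intro: rev_finite_subset[of "insert p {x. c x \<noteq> 0}"])
  show ?thesis
  proof
    assume "rows_ok (c(p := v))"
    then have *: "link q ((c(p := v)) q) ((c(p := v)) (Suc q))" for q by (simp add: rows_ok_def)
    show "link p v (c (Suc p)) \<and> (p > 0 \<longrightarrow> link (p - 1) (c (p - 1)) v)"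
      using *[of p] *[of "p - 1"] by (auto split: if_splits)
  next
    assume *: "link p v (c (Suc p)) \<and> (p > 0 \<longrightarrow> link (p - 1) (c (p - 1)) v)"
    have "link q ((c(p := v)) q) ((c(p := v)) (Suc q))" for q
    proof -
      consider "q = p" | "Suc q = p" | "q \<noteq> p" "Suc q \<noteq> p" by blast
      then show ?thesis using * assms by cases (auto simp: rows_ok_def)
    qed
    then show "rows_ok (c(p := v))" using fin by (simp add: rows_ok_def)
  qed
qed

lemma rows_upd2:
  assumes "rows_ok c"
  shows "rows_ok (c(p := v, Suc p := w)) \<longleftrightarrow>
    link p v w \<and> link (Suc p) w (c (Suc (Suc p))) \<and> (p > 0 \<longrightarrow> link (p - 1) (c (p - 1)) v)"
proof -
  have fin: "finite {x. (c(p := v, Suc p := w)) x \<noteq> 0}"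
    using assms by (auto simp: rows_ok_def intro: rev_finite_subset[of "insert (Suc p) (insert p {x. c x \<noteq> 0})"])
  show ?thesis
  proof
    assume "rows_ok (c(p := v, Suc p := w))"
    then have *: "link q ((c(p := v, Suc p := w)) q) ((c(p := v, Suc p := w)) (Suc q))" for q by (simp add: rows_ok_def)
    show "link p v w \<and> link (Suc p) w (c (Suc (Suc p))) \<and> (p > 0 \<longrightarrow> link (p - 1) (c (p - 1)) v)"
      using *[of p] *[of "Suc p"] *[of "p - 1"] by (auto split: if_splits)
  next
    assume *: "link p v w \<and> link (Suc p) w (c (Suc (Suc p))) \<and> (p > 0 \<longrightarrow> link (p - 1) (c (p - 1)) v)"
    have "link q ((c(p := v, Suc p := w)) q) ((c(p := v, Suc p := w)) (Suc q))" for q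
    proof -
      consider "q = p" | "Suc q = p" | "q = Suc p" | "q \<noteq> p" "Suc q \<noteq> p" "q \<noteq> Suc p" by blast
      then show ?thesis using * assms by cases (auto simp: rows_ok_def)
    qed
    then show "rows_ok (c(p := v, Suc p := w))" using fin by (simp add: rows_ok_def)
  qed
qed

lemma last_half_isolated: "last_half p \<Longrightarrow> \<not> last_half (Suc p)" "\<not> last_half 0"
  using qd_ge Suc_div_mod(2)[of p] by (auto simp: last_half_def)

lemma last_half_pos: "last_half p \<Longrightarrow> p > 0"
  using last_half_isolated(2) by (cases p) auto

text \<open>Both rows have colour 1 and \<open>p_11 = 0\<close>, so equal lengths give equal
  labels.\<close>

lemma vx_halves:
  assumes "last_half p" "c (Suc p) = c p"
  shows "vx s 1 (lift c) (int (Suc p)) = vx s 1 (lift c) (int p)"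
proof -
  have r: "relaxed 1 (int p)" using assms(1) relaxed_last_half by blast
  show ?thesis
    using PT_edge[of 1 "int p"] relaxed_pi1[OF r] assms(2)
    by (simp add: vx_def lab_def inn_def out_def pp_def lift_def nat_add_distrib add.commute add.left_commute)
qed

lemma wgt_lift:
  "wgt 1 (lift c) 0 = 1 - 2 * (int (c 0) - int (c 1))"
  "wgt 1 (lift c) (int (Suc q)) =
     cwgt (last_half q) (last_half (Suc q)) (int (c q) - int (c (Suc q))) (int (c (Suc q)) - int (c (Suc (Suc q))))"
proof -
  have one: "1 \<in> {1..n}" using n3 by simp
  show "wgt 1 (lift c) 0 = 1 - 2 * (int (c 0) - int (c 1))"
    using wgt_cases(4)[OF one, of "lift c"] drp_lift[of c 0] by simp
  have pos: "int (Suc q) > 0" and pred: "int (Suc q) - 1 = int q" by simp_all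
  show "wgt 1 (lift c) (int (Suc q)) =
     cwgt (last_half q) (last_half (Suc q)) (int (c q) - int (c (Suc q))) (int (c (Suc q)) - int (c (Suc (Suc q))))"
    unfolding wgt_cases(1)[OF one pos] pred relaxed_last_half drp_lift ..
qed

definition row_adm :: "(nat \<Rightarrow> nat) \<Rightarrow> nat set" where
  "row_adm c = {p. rows_ok (c(p := Suc (c p)))}"

definition row_rem :: "(nat \<Rightarrow> nat) \<Rightarrow> nat set" where
  "row_rem c = {p. c p \<ge> 1 \<and> rows_ok (c(p := c p - 1))}"

text \<open>If the two halves of a row of cells end in the same column, a wall may have a single
  admissible lower slot and a single removable upper block there. For diagrams the analogous pair of
  columns carries a double admissible and a double removable point; the contributions cancel in both
  cases, as the two places have the same label.\<close>

definition both_halves :: "(nat \<Rightarrow> nat) \<Rightarrow> nat set" where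
  "both_halves c = {p. last_half p \<and> c p = c (Suc p) \<and> c (p - 1) = Suc (c p) \<and> c (Suc p) = Suc (c (Suc (Suc p)))}"

definition adm_count :: "(nat \<Rightarrow> nat) \<Rightarrow> nat \<Rightarrow> int" where
  "adm_count c p = (if p \<in> row_adm c then if p \<in> dbl_adm c then 2 else 1 else 0)"

definition rem_count :: "(nat \<Rightarrow> nat) \<Rightarrow> nat \<Rightarrow> int" where
  "rem_count c p = (if p \<in> row_rem c then if p \<in> Suc ` dbl_rem c then 2 else 1 else 0)"

text \<open>For \<open>p\<close> in \<open>both_halves\<close> the weights are 2 at \<open>p\<close>
  and -2 at \<open>p + 1\<close>, but the neighbouring rows prevent adding or removing both halves
  together, so the wall counts only 1 and -1. For all other rows count and weight agree.\<close>

lemma count_wgt: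
  assumes c: "rows_ok c"
  shows "adm_count c p - rem_count c p =
    wgt 1 (lift c) (int p) + (if p \<in> Suc ` both_halves c then 1 else 0) - (if p \<in> both_halves c then 1 else 0)"
proof -
  have lk: "link q (c q) (c (Suc q))" for q using c by (simp add: rows_ok_def)
  show ?thesis
  proof (cases p)
    case 0
    have nl: "\<not> last_half 0" by (rule last_half_isolated)
    show ?thesis
      using lk[of 0] nl wgt_lift(1)[of c]
      by (auto simp: 0 adm_count_def rem_count_def row_adm_def row_rem_def dbl_adm_def dbl_rem_def both_halves_def
          rows_upd[OF c] rows_upd2[OF c] link_def)
  next
    case (Suc q)
    have img: "Suc q \<in> Suc ` X \<longleftrightarrow> q \<in> X" for X by auto
    note defs = adm_count_def rem_count_def row_adm_def row_rem_def dbl_adm_def dbl_rem_def both_halves_def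
          rows_upd[OF c] rows_upd2[OF c] link_def img wgt_lift(2) cwgt_def
    consider "last_half (Suc q)" "\<not> last_half q" | "last_half q" "\<not> last_half (Suc q)"
      | "\<not> last_half q" "\<not> last_half (Suc q)"
      using last_half_isolated(1)[of q] by blast
    then show ?thesis
    proof cases
      case 1
      then have "\<not> last_half (Suc (Suc q))" using last_half_isolated(1) by blast
      then show ?thesis using 1 lk[of q] lk[of "Suc q"] lk[of "Suc (Suc q)"]
        unfolding Suc defs mem_Collect_eq by auto
    next
      case 2
      then have "q > 0" "\<not> last_half (q - 1)" using last_half_pos last_half_isolated(1)[of "q - 1"] by (auto intro: ccontr)
      then show ?thesis using 2 lk[of q] lk[of "Suc q"] lk[of "q - 1"]
        unfolding Suc defs mem_Collect_eq by auto
    next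
      case 3
      then show ?thesis using lk[of q] lk[of "Suc q"]
        unfolding Suc defs mem_Collect_eq by auto
    qed
  qed
qed

lemma dbl_subsets:
  assumes c: "rows_ok c"
  shows "dbl_adm c \<subseteq> row_adm c" "Suc ` dbl_rem c \<subseteq> row_rem c"
  by (auto simp: dbl_adm_def dbl_rem_def row_adm_def row_rem_def rows_upd[OF c] rows_upd2[OF c] link_def)

text \<open>The corrections of \<open>count_wgt\<close> at \<open>p\<close> and \<open>p + 1\<close>
  have opposite signs and the same variable, by \<open>vx_halves\<close>, so they cancel in the
  sum.\<close>

lemma LY_frm:
  assumes c: "rows_ok c"
  shows "LY n \<iota> s (rwall c) = frm s 1 (lift c)"
proof
  fix m
  define v where "v p = vx s 1 (lift c) (int p) m" for p
  obtain M0 where M0: "{p. c p \<noteq> 0} \<subseteq> {..<M0}" using c finite_nat_bounded unfolding rows_ok_def by blast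
  define M where "M = Suc M0"
  have M: "c p = 0" if "p \<ge> M0" for p using M0 that by fastforce
  have subA: "row_adm c \<subseteq> {..M}"
  proof
    fix p assume "p \<in> row_adm c"
    then have "p > 0 \<Longrightarrow> c (p - 1) \<ge> 1" by (auto simp: row_adm_def rows_upd[OF c] link_def)
    moreover have "c (p - 1) = 0" if "p > M" using that by (intro M) (auto simp: M_def)
    ultimately show "p \<in> {..M}" by (cases "p \<le> M") auto
  qed
  have subR: "row_rem c \<subseteq> {..M}"
  proof
    fix p assume "p \<in> row_rem c"
    then show "p \<in> {..M}" using M[of p] by (cases "p \<le> M") (auto simp: M_def row_rem_def)
  qed
  have fin: "finite (row_adm c)" "finite (row_rem c)" using subA subR finite_subset by blast+
  define g h where "g p = plc (c p) p" and "h p = plc (c p - 1) p" for p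
  have inj: "inj_on g X" "inj_on h X" for X by (auto simp: inj_on_def g_def h_def plc_eq_iff)
  have sets: "Y_adm n (rwall c) = g ` row_adm c" "Y_dadm n (rwall c) = g ` dbl_adm c"
    "Y_rem n (rwall c) = h ` row_rem c"
    by (simp_all add: Y_adm_rwall Y_dadm_rwall Y_rem_rwall row_adm_def row_rem_def g_def[abs_def] h_def[abs_def])
  have "Y_drem n (rwall c) = (\<lambda>p. plc (c p - 1) (Suc p)) ` dbl_rem c" by (rule Y_drem_rwall)
  also have "\<dots> = (\<lambda>p. h (Suc p)) ` dbl_rem c" by (intro image_cong) (auto simp: h_def dbl_rem_def)
  finally have setD: "Y_drem n (rwall c) = h ` (Suc ` dbl_rem c)" by (simp add: image_image)
  have finY: "finite (g ` row_adm c)" "finite (h ` row_rem c)" using fin by simp_all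
  have subY: "g ` dbl_adm c \<subseteq> g ` row_adm c" "h ` (Suc ` dbl_rem c) \<subseteq> h ` row_rem c"
    using dbl_subsets[OF c] by blast+
  have mem: "g p \<in> g ` X \<longleftrightarrow> p \<in> X" "h p \<in> h ` X \<longleftrightarrow> p \<in> X" for p X
    by (auto simp: g_def h_def plc_eq_iff)
  have S1: "(\<Sum>P\<in>Y_adm n (rwall c) - Y_dadm n (rwall c). LY_ad n \<iota> s P m) + (\<Sum>P\<in>Y_dadm n (rwall c). 2 * LY_ad n \<iota> s P m)
     = (\<Sum>p\<le>M. of_int (adm_count c p) * v p)"
    unfolding sets sum_doubled[OF subY(1) finY(1)] unfolding sum.reindex[OF inj(1)] o_def mem
    using subA by (intro sum.mono_neutral_cong_left) (auto simp: adm_count_def v_def g_def LY_ad_vx)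
  have re: "LY_re n \<iota> s (h p) m = v p" if "p \<in> row_rem c" for p
  proof -
    have "c p \<ge> 1" using that unfolding row_rem_def by blast
    then show ?thesis unfolding h_def v_def by (simp only: LY_re_vx)
  qed
  have S2: "(\<Sum>P\<in>Y_rem n (rwall c) - Y_drem n (rwall c). LY_re n \<iota> s P m) + (\<Sum>P\<in>Y_drem n (rwall c). 2 * LY_re n \<iota> s P m)
     = (\<Sum>p\<le>M. of_int (rem_count c p) * v p)"
    unfolding sets setD sum_doubled[OF subY(2) finY(2)] unfolding sum.reindex[OF inj(2)] o_def mem
    using subR by (intro sum.mono_neutral_cong_left) (auto simp: rem_count_def re)
  define E where "E = both_halves c"
  have E: "E \<subseteq> {..M}" "Suc ` E \<subseteq> {..M}"
  proof -
    have "p < M0" if "p \<in> E" for p using that M[of p] by (cases "p < M0") (auto simp: E_def both_halves_def)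
    then show "E \<subseteq> {..M}" "Suc ` E \<subseteq> {..M}" by (fastforce simp: M_def)+
  qed
  have vE: "v (Suc p) = v p" if "p \<in> E" for p
    using that vx_halves[of p c s] by (simp add: v_def E_def both_halves_def)
  have "LY n \<iota> s (rwall c) m = (\<Sum>p\<le>M. of_int (adm_count c p) * v p) - (\<Sum>p\<le>M. of_int (rem_count c p) * v p)"
    unfolding LY_def S1[symmetric] S2[symmetric] by simp
  also have "\<dots> = (\<Sum>p\<le>M. of_int (adm_count c p - rem_count c p) * v p)"
    by (simp add: sum_subtractf left_diff_distrib)
  also have "\<dots> = (\<Sum>p\<le>M. of_int (wgt 1 (lift c) (int p)) * v p + (if p \<in> Suc ` E then v p else 0) - (if p \<in> E then v p else 0))"
    unfolding count_wgt[OF c] E_def by (intro sum.cong refl) (simp add: algebra_simps)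
  also have "\<dots> = (\<Sum>p\<le>M. of_int (wgt 1 (lift c) (int p)) * v p) + (\<Sum>p\<in>Suc ` E. v p) - (\<Sum>p\<in>E. v p)"
    using E by (simp add: sum.distrib sum_subtractf sum.If_cases Int_absorb1 inf.absorb2)
  also have "(\<Sum>p\<in>Suc ` E. v p) = (\<Sum>p\<in>E. v p)"
    by (subst sum.reindex) (auto simp: vE)
  also have "(\<Sum>p\<le>M. of_int (wgt 1 (lift c) (int p)) * v p) = (\<Sum>t\<in>int ` {..M}. of_int (wgt 1 (lift c) t) * vx s 1 (lift c) t m)"
    by (subst sum.reindex) (auto simp: v_def)
  also have "\<dots> = (\<Sum>t\<in>{- int M..int M}. of_int (wgt 1 (lift c) t) * vx s 1 (lift c) t m)"
  proof (rule sum.mono_neutral_left)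
    have "t < 0" if "t \<in> {- int M..int M} - int ` {..M}" for t
      using that by (auto simp: image_iff) (metis atMost_iff nat_0_le nat_int not_le of_nat_le_iff)
    then show "\<forall>t\<in>{- int M..int M} - int ` {..M}. of_int (wgt 1 (lift c) t) * vx s 1 (lift c) t m = 0"
      using wgt_cases(5)[of 1] n3 by auto
  qed auto
  also have "\<dots> = frm s 1 (lift c) m"
    by (rule frm_interval[symmetric]) (auto simp: lift_def M_def M)
  finally show "LY n \<iota> s (rwall c) m = frm s 1 (lift c) m" by simp
qed

text \<open>Profiles of type 1 are the row lengths of proper walls, those of types 2 to
  \<open>n\<close> the depths of diagrams.\<close>

lemma Omega_eq:
  "Omega = {LT n \<iota> s k T | s k T. s \<ge> 1 \<and> k \<in> {1..n} - {1} \<and> T \<in> REYD n k} \<union> {LY n \<iota> s Y | s Y. s \<ge> 1 \<and> Y \<in> YW n}"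
proof (intro equalityI subsetI)
  fix f assume "f \<in> Omega"
  then obtain s K c where f: "f = frm s K c" and s: "s \<ge> 1" and K: "K \<in> {1..n}" and c: "profile K c"
    by (auto simp: Omega_def)
  show "f \<in> {LT n \<iota> s k T | s k T. s \<ge> 1 \<and> k \<in> {1..n} - {1} \<and> T \<in> REYD n k} \<union> {LY n \<iota> s Y | s Y. s \<ge> 1 \<and> Y \<in> YW n}"
  proof (cases "K = 1")
    case True
    then obtain d where d: "c = lift d" "rows_ok d" using c profile_lift_ex by blast
    have "f = LY n \<iota> s (rwall d)" using LY_frm[OF d(2)] by (simp add: f True d(1))
    moreover have "rwall d \<in> YW n" using d(2) rwall_YW_iff by blast
    ultimately show ?thesis using s by blast
  next
    case False
    then have K2: "K \<in> {2..n}" using K by auto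
    have T: "depth K c \<in> REYD n K" using c by (simp add: REYD_iff[OF K2] depth_depth)
    have "f = LT n \<iota> s K (depth K c)" using LT_frm[OF K2 T] by (simp add: f depth_depth)
    then show ?thesis using s K False T by blast
  qed
next
  fix f assume "f \<in> {LT n \<iota> s k T | s k T. s \<ge> 1 \<and> k \<in> {1..n} - {1} \<and> T \<in> REYD n k} \<union> {LY n \<iota> s Y | s Y. s \<ge> 1 \<and> Y \<in> YW n}"
  then show "f \<in> Omega"
  proof
    assume "f \<in> {LT n \<iota> s k T | s k T. s \<ge> 1 \<and> k \<in> {1..n} - {1} \<and> T \<in> REYD n k}"
    then obtain s k T where *: "f = LT n \<iota> s k T" "s \<ge> 1" "k \<in> {1..n} - {1}" "T \<in> REYD n k" by blast
    then have k: "k \<in> {2..n}" "k \<in> {1..n}" by auto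
    have "profile k (depth k T)" using *(4) REYD_iff[OF k(1)] by blast
    then show ?thesis using LT_frm[OF k(1) *(4)] *(1,2) k(2) unfolding Omega_def by blast
  next
    assume "f \<in> {LY n \<iota> s Y | s Y. s \<ge> 1 \<and> Y \<in> YW n}"
    then obtain s Y where *: "f = LY n \<iota> s Y" "s \<ge> 1" "Y \<in> YW n" by blast
    obtain c where c: "Y = rwall c" "rows_ok c" using *(3) by (rule YW_rwall)
    have "profile 1 (lift c)" using c(2) profile_lift by blast
    moreover have "1 \<in> {1..n}" using n3 by simp
    ultimately show ?thesis using LY_frm[OF c(2)] *(1,2) c(1) unfolding Omega_def by blast
  qed
qed

end

theorem theorem4p8:
  fixes n :: nat and \<iota> :: "nat \<Rightarrow> nat"
  assumes "n \<ge> 3" and "index_seq n \<iota>" and "adapted n \<iota>"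
  shows "Xi_prime_positive n \<iota> \<and>
    (\<forall>\<Psi>. is_Psi n \<iota> \<Psi> \<longrightarrow>
       \<Psi> ` elems (Binf n) =
         {a \<in> Zinf. \<forall>s\<ge>1.
            (\<forall>k\<in>{1..n} - {1}. \<forall>T\<in>REYD n k. apply_form (LT n \<iota> s k T) a \<ge> 0) \<and>
            (\<forall>Y\<in>YW n. apply_form (LY n \<iota> s Y) a \<ge> 0)})"
proof (intro conjI allI impI)
  interpret adapted_A2 n \<iota> using assms by unfold_locales
  interpret Sprime_closed n \<iota> Omega by (rule Sprime_closed_Omega)
  show "Xi_prime_positive n \<iota>" by (rule Xi_prime_positive)
  fix \<Psi> assume "is_Psi n \<iota> \<Psi>"
  then have "\<Psi> ` elems (Binf n) = cone"
    using image_Psi[OF assms(1)] zero_component_eq_cone by simp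
  also have "\<dots> = {a \<in> Zinf. \<forall>s\<ge>1.
            (\<forall>k\<in>{1..n} - {1}. \<forall>T\<in>REYD n k. apply_form (LT n \<iota> s k T) a \<ge> 0) \<and>
            (\<forall>Y\<in>YW n. apply_form (LY n \<iota> s Y) a \<ge> 0)}"
    unfolding cone_def unfolding Omega_eq by blast
  finally show "\<Psi> ` elems (Binf n) = \<dots>" .
qed

end
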